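(* Let $f(X)=X^6+aX^4+bX^2+c$ with $a,b,c\in \mathbb{Z}$ such that $f$ is irreducible over $\mathbb{Q}$ and $\mathrm{Gal}(f/\mathbb{Q})\cong C_6$. Then $f$ is monogenic if and only if $$(a,b,c)\in \{(-7,14,-7), (-6,9,-3), (5,6,1), (6,5,1), (6,9,1), (9,6,1)\}.$$
   Context: A monic irreducible polynomial $f\in\mathbb{Z}[X]$ with a root $\alpha$ is called monogenic if $\mathbb{Z}[\alpha]$ equals the full ring of integers $\mathcal{O}_K$ of $K=\mathbb{Q}(\alpha)$ (equivalently, the polynomial discriminant of $f$ equals the field discriminant of $K$). $\mathrm{Gal}(f/\mathbb{Q})$ denotes the Galois group of the splitting field of $f$ over $\mathbb{Q}$, and $C_n$ the cyclic group of order $n$. *)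

theory Defs
  imports "HOL-Computational_Algebra.Computational_Algebra"
begin

definition is_subfield_C :: "complex set \<Rightarrow> bool" where
  "is_subfield_C S \<longleftrightarrow> 0 \<in> S \<and> 1 \<in> S \<and>
     (\<forall>x\<in>S. \<forall>y\<in>S. x + y \<in> S \<and> x - y \<in> S \<and> x * y \<in> S) \<and>
     (\<forall>x\<in>S. x \<noteq> 0 \<longrightarrow> inverse x \<in> S)"

definition field_gen :: "complex set \<Rightarrow> complex set" where
  "field_gen A = \<Inter>{S. is_subfield_C S \<and> A \<subseteq> S}"

definition croots :: "int poly \<Rightarrow> complex set" where
  "croots f = {z. poly (map_poly of_int f) z = 0}"

definition splitting_field :: "int poly \<Rightarrow> complex set" where
  "splitting_field f = field_gen (croots f)"

text \<open>Galois group of f over Q: field automorphisms of the splitting field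
  (they automatically fix Q), extended by the identity outside it.\<close>
definition Gal :: "int poly \<Rightarrow> (complex \<Rightarrow> complex) set" where
  "Gal f = {\<sigma>. let L = splitting_field f in
       bij_betw \<sigma> L L \<and>
       (\<forall>x\<in>L. \<forall>y\<in>L. \<sigma> (x + y) = \<sigma> x + \<sigma> y \<and> \<sigma> (x * y) = \<sigma> x * \<sigma> y) \<and>
       \<sigma> 1 = 1 \<and> (\<forall>x. x \<notin> L \<longrightarrow> \<sigma> x = x)}"

definition Gal_cyclic_of_order :: "int poly \<Rightarrow> nat \<Rightarrow> bool" where
  "Gal_cyclic_of_order f n \<longleftrightarrow> finite (Gal f) \<and> card (Gal f) = n \<and>
     (\<exists>\<sigma>\<in>Gal f. Gal f = {\<sigma> ^^ k | k. True})"

definition alg_int :: "complex \<Rightarrow> bool" where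
  "alg_int z \<longleftrightarrow> (\<exists>p :: int poly. lead_coeff p = 1 \<and> poly (map_poly of_int p) z = 0)"

definition ring_of_integers :: "complex set \<Rightarrow> complex set" where
  "ring_of_integers K = {z \<in> K. alg_int z}"

definition Z_adjoin :: "complex \<Rightarrow> complex set" where
  "Z_adjoin \<alpha> = {poly (map_poly of_int p) \<alpha> | p :: int poly. True}"

definition monogenic :: "int poly \<Rightarrow> bool" where
  "monogenic f \<longleftrightarrow> lead_coeff f = 1 \<and> irreducible (map_poly (of_int :: int \<Rightarrow> rat) f) \<and>
     (\<exists>\<alpha>. poly (map_poly of_int f) \<alpha> = (0::complex) \<and>
          Z_adjoin \<alpha> = ring_of_integers (field_gen {\<alpha>}))"

end

theory Submission
  imports Defs "HOL-Computational_Algebra.Field_as_Ring"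
begin

text \<open>Adjoining the roots of an even sextic to \<open>\<rat>(\<alpha>)\<close> only requires square roots, so automorphisms of the splitting
  field can be built by hand; as the Galois group is abelian and transitive on the roots, the stabiliser of \<open>\<alpha>\<close> is
  trivial and the splitting field is \<open>K = \<rat>(\<alpha>)\<close>. Let \<open>\<sigma>\<close> generate the group, so \<open>\<sigma>\<^sup>3 \<alpha> = - \<alpha>\<close>, and put \<open>d = - c\<close>.

  If \<open>\<int>[\<alpha>]\<close> is the ring of integers, then the conjugates of \<open>\<alpha>\<close> are associates in it. Hence \<open>c\<close> divides \<open>\<alpha>\<^sup>6\<close>, and
  the element \<open>x = - \<sigma>(\<alpha>) \<sigma>\<^sup>2(\<alpha>)\<close> of the cubic subfield, for which \<open>x\<^sup>2 \<alpha>\<^sup>2 = d\<close>, is a root of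
  \<open>y\<^sup>3 - d t y\<^sup>2 + d s y - d\<close> with integers \<open>s\<close>, \<open>t\<close>. Comparing the differences of the conjugates of \<open>x\<close> and of \<open>\<alpha>\<^sup>2\<close>
  shows that \<open>1 - d s t\<close> is a unit. The differences of conjugates of \<open>\<alpha>\<^sup>2\<close> are associates of each other, which forces
  the discriminant of the cubic to be \<open>(d D)\<^sup>2\<close> with \<open>D\<close> dividing \<open>27\<close> when \<open>s t = 0\<close>. Together with \<open>c\<close> being
  squarefree and \<open>d\<close> not being \<open>1\<close> modulo \<open>4\<close> this leaves finitely many cases.

  Conversely, for the six polynomials the discriminant of the cubic resolvent \<open>y\<^sup>3 + a y\<^sup>2 + b y + c\<close> is a power of a prime
  at which a translate of it is Eisenstein, which gives the integers of the cubic field. For the quadratic step, an integer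
  \<open>(u + \<alpha> v) / 2\<close> with \<open>u\<close>, \<open>v\<close> integral satisfies \<open>(x u)\<^sup>2 + v\<^sup>2 \<equiv> 0\<close> modulo \<open>4\<close>, and squaring is injective on the
  integers of the cubic field modulo \<open>2\<close>.\<close>

section \<open>Subfields of the complex numbers\<close>

abbreviation (input) sextic :: "int \<Rightarrow> int \<Rightarrow> int \<Rightarrow> int poly" where
  "sextic a b c \<equiv> [:c, 0, b, 0, a, 0, 1:]"

lemma poly_of_int_sextic:
  "poly (map_poly of_int (sextic a b c)) (z :: complex) =
     z^6 + of_int a * z^4 + of_int b * z^2 + of_int c"
  by (simp add: map_poly_pCons algebra_simps power_def)

lemma alg_int_iff: "alg_int z \<longleftrightarrow> algebraic_int z"
  unfolding alg_int_def algebraic_int_altdef_ipoly by blast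

text \<open>These are the subrings of the complex numbers. Taking \<int> and \<rat> as coefficient
  rings lets one span construction produce both \<int>[\<alpha>] and \<rat>(\<alpha>).\<close>

definition int_closed :: "complex set \<Rightarrow> bool" where
  "int_closed R \<longleftrightarrow> \<int> \<subseteq> R \<and> (\<forall>x\<in>R. \<forall>y\<in>R. x + y \<in> R \<and> x - y \<in> R \<and> x * y \<in> R)"

lemma int_closed_Ints: "int_closed \<int>" and int_closed_Rats: "int_closed \<rat>"
  using Ints_subset_Rats by (auto simp: int_closed_def)

lemma int_closedD:
  assumes "int_closed R"
  shows "of_int n \<in> R" "0 \<in> R" "1 \<in> R" "numeral m \<in> R"
    "x \<in> R \<Longrightarrow> y \<in> R \<Longrightarrow> x + y \<in> R" "x \<in> R \<Longrightarrow> y \<in> R \<Longrightarrow> x - y \<in> R" "x \<in> R \<Longrightarrow> y \<in> R \<Longrightarrow> x * y \<in> R"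
    "x \<in> R \<Longrightarrow> - x \<in> R" "x \<in> R \<Longrightarrow> x ^ k \<in> R"
proof -
  show *: "of_int n \<in> R" for n using assms by (auto simp: int_closed_def)
  show 0: "0 \<in> R" and 1: "1 \<in> R" and "numeral m \<in> R"
    using *[of 0] *[of 1] *[of "numeral m"] by simp_all
  show "x \<in> R \<Longrightarrow> y \<in> R \<Longrightarrow> x + y \<in> R" "x \<in> R \<Longrightarrow> y \<in> R \<Longrightarrow> x - y \<in> R"
    and mult: "\<And>x y. x \<in> R \<Longrightarrow> y \<in> R \<Longrightarrow> x * y \<in> R"
    using assms by (auto simp: int_closed_def)
  show "x \<in> R \<Longrightarrow> - x \<in> R" using assms 0 by (metis int_closed_def diff_0)
  show "x \<in> R \<Longrightarrow> x ^ k \<in> R" by (induction k) (auto simp: 1 mult)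
qed

lemma subfield_int_closed:
  assumes "is_subfield_C S" shows "int_closed S"
proof -
  have nat: "of_nat n \<in> S" for n
    by (induction n) (use assms in \<open>auto simp: is_subfield_C_def\<close>)
  have "of_int n \<in> S" for n
  proof (cases n rule: int_cases2)
    case (nonneg m)
    then show ?thesis using nat[of m] by simp
  next
    case (nonpos m)
    have "0 - of_nat m \<in> S" using assms nat[of m] unfolding is_subfield_C_def by blast
    then show ?thesis using nonpos by simp
  qed
  then show ?thesis using assms by (auto simp: int_closed_def is_subfield_C_def elim!: Ints_cases)
qed

lemmas subfieldD = int_closedD[OF subfield_int_closed]

lemma subfield_divide: "is_subfield_C S \<Longrightarrow> x \<in> S \<Longrightarrow> y \<in> S \<Longrightarrow> x / y \<in> S"
  unfolding divide_inverse by (cases "y = 0") (auto simp: is_subfield_C_def)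

lemma subfield_Rats:
  assumes "is_subfield_C S" "x \<in> \<rat>" shows "x \<in> S"
proof -
  obtain p q where "x = of_int p / of_int q" using Rats_cases' \<open>x \<in> \<rat>\<close> by metis
  then show ?thesis using assms by (auto intro!: subfield_divide subfieldD)
qed

lemma subfield_field_gen: "is_subfield_C (field_gen A)"
  unfolding field_gen_def is_subfield_C_def by auto

lemma field_gen_supset: "A \<subseteq> field_gen A"
  unfolding field_gen_def by auto

lemma field_gen_least: "is_subfield_C S \<Longrightarrow> A \<subseteq> S \<Longrightarrow> field_gen A \<subseteq> S"
  unfolding field_gen_def by auto

section \<open>Evaluation of rational polynomials\<close>

definition rat_eval :: "complex \<Rightarrow> rat poly \<Rightarrow> complex" where
  "rat_eval z p = poly (map_poly of_rat p) z"

lemma rat_eval_simps [simp]: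
  "rat_eval z 0 = 0" "rat_eval z 1 = 1" "rat_eval z (pCons r p) = of_rat r + z * rat_eval z p"
  "rat_eval z (p + q) = rat_eval z p + rat_eval z q"
  "rat_eval z (p - q) = rat_eval z p - rat_eval z q"
  "rat_eval z (- p) = - rat_eval z p"
  "rat_eval z (smult r p) = of_rat r * rat_eval z p"
  "rat_eval z (p * q) = rat_eval z p * rat_eval z q"
proof -
  show 0: "rat_eval z 0 = 0" "rat_eval z 1 = 1" and C: "rat_eval z (pCons r p) = of_rat r + z * rat_eval z p" for r p
    by (simp_all add: rat_eval_def map_poly_pCons)
  show add: "rat_eval z (p + q) = rat_eval z p + rat_eval z q" for p q
    by (induction p q rule: poly_induct2) (simp_all add: 0 C of_rat_add algebra_simps)
  show sm: "rat_eval z (smult r p) = of_rat r * rat_eval z p" for r p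
    by (induction p) (simp_all add: 0 C of_rat_mult algebra_simps)
  show "rat_eval z (- p) = - rat_eval z p" using sm[of "-1" p] by (simp add: of_rat_minus)
  then show "rat_eval z (p - q) = rat_eval z p - rat_eval z q" using add[of p "-q"] sm[of "-1" q] by (simp add: of_rat_minus)
  show "rat_eval z (p * q) = rat_eval z p * rat_eval z q"
    by (induction p) (simp_all add: 0 C add sm algebra_simps)
qed

lemma rat_eval_mem:
  assumes "is_subfield_C S" "z \<in> S" shows "rat_eval z p \<in> S"
proof (induction p)
  case (pCons r p)
  moreover have "of_rat r \<in> S" using subfield_Rats[OF assms(1)] by simp
  ultimately show ?case using assms by (simp add: subfieldD)
qed (simp add: subfieldD assms)

text \<open>In the Euclidean ring \<rat>[X] an irreducible element is prime, hence coprime to every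
  polynomial it does not divide.\<close>

lemma bezout_irreducible:
  fixes f p :: "rat poly" assumes "irreducible f" "\<not> f dvd p"
  obtains u v where "u * f + v * p = 1"
  using assms
  by (metis bezout_coefficients_fst_snd coprime_iff_gcd_eq_1 irreducible_imp_prime_elem_gcd prime_elem_imp_coprime)

section \<open>Coordinates in the field generated by a root\<close>

locale sextic_root =
  fixes a b c :: int and \<alpha> :: complex
  assumes irr: "irreducible (map_poly (of_int :: int \<Rightarrow> rat) (sextic a b c))"
    and root: "\<alpha>^6 + of_int a * \<alpha>^4 + of_int b * \<alpha>^2 + of_int c = 0"
begin

definition fQ :: "rat poly" where "fQ = map_poly of_int (sextic a b c)"

lemma rat_eval_fQ: "rat_eval z fQ = z^6 + of_int a * z^4 + of_int b * z^2 + of_int c"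
  by (simp add: fQ_def map_poly_pCons algebra_simps power_def)

lemma degree_fQ: "degree fQ = 6"
  by (simp add: fQ_def map_poly_pCons)

text \<open>\<open>fQ\<close> is the minimal polynomial of \<alpha>: a Bezout identity
  \<open>u * fQ + v * p = 1\<close> would read 0 = 1 at a common root.\<close>

lemma rat_eval_eq_0_iff: "rat_eval \<alpha> p = 0 \<longleftrightarrow> fQ dvd p"
proof
  assume 0: "rat_eval \<alpha> p = 0"
  show "fQ dvd p"
  proof (rule ccontr)
    assume "\<not> fQ dvd p"
    then obtain u v where uv: "u * fQ + v * p = 1"
      using bezout_irreducible irr fQ_def by metis
    have "rat_eval \<alpha> (u * fQ + v * p) = 0" using 0 root by (simp add: rat_eval_fQ)
    then show False using uv by simp
  qed
qed (auto simp: rat_eval_fQ root elim!: dvdE)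

text \<open>A rational relation among the powers below the sixth is a multiple of \<open>fQ\<close>
  of too small a degree.\<close>

lemma lin_indep:
  assumes "of_rat r0 + of_rat r1 * \<alpha> + of_rat r2 * \<alpha>^2 + of_rat r3 * \<alpha>^3 + of_rat r4 * \<alpha>^4 + of_rat r5 * \<alpha>^5 = 0"
  shows "r0 = 0 \<and> r1 = 0 \<and> r2 = 0 \<and> r3 = 0 \<and> r4 = 0 \<and> r5 = 0"
proof -
  let ?p = "[:r0, r1, r2, r3, r4, r5:]"
  have "rat_eval \<alpha> ?p = 0"
    using assms by (simp add: algebra_simps power_def)
  then have "fQ dvd ?p" by (simp only: rat_eval_eq_0_iff)
  moreover have "degree ?p < degree fQ" unfolding degree_fQ by simp
  ultimately have "?p = 0" using dvd_imp_degree_le leD by blast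
  then show ?thesis by (simp add: pCons_eq_0_iff)
qed

lemma coords_unique:
  assumes "r0 \<in> \<rat>" "r1 \<in> \<rat>" "r2 \<in> \<rat>" "r3 \<in> \<rat>" "r4 \<in> \<rat>" "r5 \<in> \<rat>"
    "s0 \<in> \<rat>" "s1 \<in> \<rat>" "s2 \<in> \<rat>" "s3 \<in> \<rat>" "s4 \<in> \<rat>" "s5 \<in> \<rat>"
   and eq: "(r0 + r1 * \<alpha>^2 + r2 * \<alpha>^4) + \<alpha> * (r3 + r4 * \<alpha>^2 + r5 * \<alpha>^4) =
     (s0 + s1 * \<alpha>^2 + s2 * \<alpha>^4) + \<alpha> * (s3 + s4 * \<alpha>^2 + s5 * \<alpha>^4)"
  shows "r0 = s0 \<and> r1 = s1 \<and> r2 = s2 \<and> r3 = s3 \<and> r4 = s4 \<and> r5 = s5"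
proof -
  have *: "\<exists>q. r - s = of_rat q" if "r \<in> \<rat>" "s \<in> \<rat>" for r s :: complex
    using Rats_diff[OF that] by (auto elim: Rats_cases)
  obtain q0 q1 q2 q3 q4 q5 where q: "r0 - s0 = of_rat q0" "r3 - s3 = of_rat q1" "r1 - s1 = of_rat q2"
    "r4 - s4 = of_rat q3" "r2 - s2 = of_rat q4" "r5 - s5 = of_rat q5"
    using * assms(1-12) by meson
  have "of_rat q0 + of_rat q1 * \<alpha> + of_rat q2 * \<alpha>^2 + of_rat q3 * \<alpha>^3 + of_rat q4 * \<alpha>^4 + of_rat q5 * \<alpha>^5 = 0"
    unfolding q[symmetric] using eq by (simp add: algebra_simps power_def)
  from lin_indep[OF this] show ?thesis using q by simp
qed

text \<open>Over \<rat> this and the next definition give the cubic field \<rat>(\<alpha>^2) and the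
  sextic field \<rat>(\<alpha>); over \<int> they give the orders \<int>[\<alpha>^2] and
  \<int>[\<alpha>]. Separating even and odd powers of \<alpha> displays the sextic field as a
  quadratic extension of the cubic one.\<close>

definition cubic_span :: "complex set \<Rightarrow> complex set" where
  "cubic_span R = {r0 + r1 * \<alpha>^2 + r2 * \<alpha>^4 | r0 r1 r2. r0 \<in> R \<and> r1 \<in> R \<and> r2 \<in> R}"

definition sextic_span :: "complex set \<Rightarrow> complex set" where
  "sextic_span R = {u + \<alpha> * v | u v. u \<in> cubic_span R \<and> v \<in> cubic_span R}"

lemma cubic_span_I: "r0 \<in> R \<Longrightarrow> r1 \<in> R \<Longrightarrow> r2 \<in> R \<Longrightarrow> r0 + r1 * \<alpha>^2 + r2 * \<alpha>^4 \<in> cubic_span R"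
  unfolding cubic_span_def by blast

lemma root6: "\<alpha>^6 = - (of_int a * \<alpha>^4 + of_int b * \<alpha>^2 + of_int c)"
  using root by (simp add: eq_neg_iff_add_eq_0 algebra_simps)

text \<open>Closure under products rests on this one reduction, in which the equation of \<alpha>
  rewrites \<alpha>^6.\<close>

lemma cubic_span_beta: assumes "int_closed R" "x \<in> cubic_span R" shows "\<alpha>^2 * x \<in> cubic_span R"
proof -
  obtain r0 r1 r2 where r: "x = r0 + r1 * \<alpha>^2 + r2 * \<alpha>^4" "r0 \<in> R" "r1 \<in> R" "r2 \<in> R"
    using assms(2) by (auto simp: cubic_span_def)
  have "\<alpha>^2 * x = r0 * \<alpha>^2 + r1 * \<alpha>^4 + r2 * \<alpha>^6"
    by (simp add: r algebra_simps flip: power_add)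
  then have "\<alpha>^2 * x = (- of_int c * r2) + (r0 - of_int b * r2) * \<alpha>^2 + (r1 - of_int a * r2) * \<alpha>^4"
    unfolding root6 by (simp add: algebra_simps)
  also have "\<dots> \<in> cubic_span R" using r by (intro cubic_span_I int_closedD[OF assms(1)])
  finally show ?thesis .
qed

lemma cubic_span_add:
  assumes "int_closed R" "x \<in> cubic_span R" "y \<in> cubic_span R" shows "x + y \<in> cubic_span R"
proof -
  obtain r0 r1 r2 where r: "x = r0 + r1 * \<alpha>^2 + r2 * \<alpha>^4" "r0 \<in> R" "r1 \<in> R" "r2 \<in> R"
    using assms(2) by (auto simp: cubic_span_def)
  obtain s0 s1 s2 where s: "y = s0 + s1 * \<alpha>^2 + s2 * \<alpha>^4" "s0 \<in> R" "s1 \<in> R" "s2 \<in> R"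
    using assms(3) by (auto simp: cubic_span_def)
  have "x + y = (r0 + s0) + (r1 + s1) * \<alpha>^2 + (r2 + s2) * \<alpha>^4"
    by (simp add: r s algebra_simps)
  also have "\<dots> \<in> cubic_span R" using r s by (intro cubic_span_I int_closedD[OF assms(1)])
  finally show ?thesis .
qed

lemma cubic_span_scale:
  assumes "int_closed R" "x \<in> cubic_span R" "k \<in> R" shows "k * x \<in> cubic_span R"
proof -
  obtain r0 r1 r2 where r: "x = r0 + r1 * \<alpha>^2 + r2 * \<alpha>^4" "r0 \<in> R" "r1 \<in> R" "r2 \<in> R"
    using assms(2) by (auto simp: cubic_span_def)
  have "k * x = (k * r0) + (k * r1) * \<alpha>^2 + (k * r2) * \<alpha>^4"
    by (simp add: r algebra_simps)
  then show ?thesis using r assms by (auto intro!: cubic_span_I int_closedD[OF assms(1)])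
qed

lemma cubic_span_mult:
  assumes "int_closed R" "x \<in> cubic_span R" "y \<in> cubic_span R" shows "x * y \<in> cubic_span R"
proof -
  obtain r0 r1 r2 where r: "x = r0 + r1 * \<alpha>^2 + r2 * \<alpha>^4" "r0 \<in> R" "r1 \<in> R" "r2 \<in> R"
    using assms(2) by (auto simp: cubic_span_def)
  have "x * y = r0 * y + (r1 * (\<alpha>^2 * y) + r2 * (\<alpha>^2 * (\<alpha>^2 * y)))"
    by (simp add: r algebra_simps flip: power_add)
  also have "\<dots> \<in> cubic_span R" using r assms by (intro cubic_span_add cubic_span_scale cubic_span_beta)
  finally show ?thesis .
qed

lemma cubic_span_base: assumes "int_closed R" "r \<in> R" shows "r \<in> cubic_span R"
  using cubic_span_I[of r R 0 0] assms by (simp add: int_closedD)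

lemma cubic_span_int_closed: assumes "int_closed R" shows "int_closed (cubic_span R)"
proof -
  have m: "- x \<in> cubic_span R" if "x \<in> cubic_span R" for x
    using cubic_span_scale[OF assms that, of "-1"] int_closedD(1)[OF assms, of "-1"] by simp
  have "x - y \<in> cubic_span R" if "x \<in> cubic_span R" "y \<in> cubic_span R" for x y
    using cubic_span_add[OF assms that(1) m[OF that(2)]] by simp
  then show ?thesis
    using assms cubic_span_base[OF assms] by (auto simp: int_closed_def intro: cubic_span_add cubic_span_mult)
qed

lemma sextic_span_I: "u \<in> cubic_span R \<Longrightarrow> v \<in> cubic_span R \<Longrightarrow> u + \<alpha> * v \<in> sextic_span R"
  unfolding sextic_span_def by blast

lemma cubic_span_subset_sextic_span: assumes "int_closed R" shows "cubic_span R \<subseteq> sextic_span R"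
  using sextic_span_I[of _ R 0] int_closedD[OF cubic_span_int_closed[OF assms]] by force

lemma alpha_sq_cubic_span: assumes "int_closed R" shows "\<alpha>^2 \<in> cubic_span R"
  using cubic_span_I[of 0 R 1 0] assms by (simp add: int_closedD)

lemma alpha_sextic_span: assumes "int_closed R" shows "\<alpha> \<in> sextic_span R"
  using sextic_span_I[of 0 R 1] int_closedD[OF cubic_span_int_closed[OF assms]] by force

lemma sextic_span_int_closed: assumes "int_closed R" shows "int_closed (sextic_span R)"
proof -
  note L = int_closedD[OF cubic_span_int_closed[OF assms]]
  have "x + y \<in> sextic_span R \<and> x - y \<in> sextic_span R \<and> x * y \<in> sextic_span R" if xy: "x \<in> sextic_span R" "y \<in> sextic_span R" for x y
  proof -
    obtain u v u' v' where x: "x = u + \<alpha> * v" "u \<in> cubic_span R" "v \<in> cubic_span R" and y: "y = u' + \<alpha> * v'" "u' \<in> cubic_span R" "v' \<in> cubic_span R"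
      using xy by (auto simp: sextic_span_def)
    have "x + y = (u + u') + \<alpha> * (v + v')" "x - y = (u - u') + \<alpha> * (v - v')"
      "x * y = (u * u' + \<alpha>^2 * (v * v')) + \<alpha> * (u * v' + v * u')"
      by (simp_all add: x y algebra_simps power2_eq_square)
    moreover have "(u + u') + \<alpha> * (v + v') \<in> sextic_span R" "(u - u') + \<alpha> * (v - v') \<in> sextic_span R"
      "(u * u' + \<alpha>^2 * (v * v')) + \<alpha> * (u * v' + v * u') \<in> sextic_span R"
      using x y by (intro sextic_span_I L cubic_span_beta[OF assms]; simp)+
    ultimately show ?thesis by presburger
  qed
  moreover have "\<int> \<subseteq> R" using assms by (simp add: int_closed_def)
  moreover have "R \<subseteq> sextic_span R" using cubic_span_subset_sextic_span[OF assms] cubic_span_base[OF assms] by blast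
  ultimately show ?thesis unfolding int_closed_def by simp
qed

lemma sextic_span_int_eq: "sextic_span \<int> = Z_adjoin \<alpha>"
proof (intro equalityI subsetI)
  fix z assume "z \<in> sextic_span \<int>"
  then obtain r0 r1 r2 s0 s1 s2 :: int where
    "z = (of_int r0 + of_int r1 * \<alpha>^2 + of_int r2 * \<alpha>^4) + \<alpha> * (of_int s0 + of_int s1 * \<alpha>^2 + of_int s2 * \<alpha>^4)"
    unfolding sextic_span_def cubic_span_def by (auto elim!: Ints_cases)
  then have "z = poly (map_poly of_int [:r0, s0, r1, s1, r2, s2:]) \<alpha>"
    by (simp add: map_poly_pCons algebra_simps power_def)
  then show "z \<in> Z_adjoin \<alpha>" unfolding Z_adjoin_def by blast
next
  fix z assume "z \<in> Z_adjoin \<alpha>"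
  then obtain p :: "int poly" where p: "z = poly (map_poly of_int p) \<alpha>" unfolding Z_adjoin_def by blast
  note K = int_closedD[OF sextic_span_int_closed[OF int_closed_Ints]]
  have "poly (map_poly of_int p) \<alpha> \<in> sextic_span \<int>"
    by (induction p) (auto simp: map_poly_pCons K alpha_sextic_span int_closed_Ints)
  with p show "z \<in> sextic_span \<int>" by simp
qed

lemma sextic_span_rat_eq_range: "sextic_span \<rat> = range (rat_eval \<alpha>)"
proof (intro equalityI subsetI)
  fix z assume "z \<in> sextic_span \<rat>"
  then obtain r0 r1 r2 s0 s1 s2 :: rat where
    "z = (of_rat r0 + of_rat r1 * \<alpha>^2 + of_rat r2 * \<alpha>^4) + \<alpha> * (of_rat s0 + of_rat s1 * \<alpha>^2 + of_rat s2 * \<alpha>^4)"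
    unfolding sextic_span_def cubic_span_def by (auto elim!: Rats_cases)
  then have "z = rat_eval \<alpha> [:r0, s0, r1, s1, r2, s2:]"
    by (simp add: algebra_simps power_def)
  then show "z \<in> range (rat_eval \<alpha>)" by blast
next
  fix z assume "z \<in> range (rat_eval \<alpha>)"
  then obtain p where p: "z = rat_eval \<alpha> p" by blast
  note K = int_closedD[OF sextic_span_int_closed[OF int_closed_Rats]]
  have "of_rat r \<in> sextic_span \<rat>" for r
    using cubic_span_base[OF int_closed_Rats] cubic_span_subset_sextic_span[OF int_closed_Rats] by auto
  then have "rat_eval \<alpha> p \<in> sextic_span \<rat>"
    by (induction p) (auto simp: K alpha_sextic_span int_closed_Rats)
  with p show "z \<in> sextic_span \<rat>" by simp
qed

text \<open>Inverses come from Bezout: \<open>u * fQ + v * p = 1\<close> evaluates at \<alpha> to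
  v(\<alpha>) p(\<alpha>) = 1.\<close>

lemma sextic_span_rat_subfield: "is_subfield_C (sextic_span \<rat>)"
proof -
  have "inverse x \<in> sextic_span \<rat>" if x: "x \<in> sextic_span \<rat>" "x \<noteq> 0" for x
  proof -
    obtain p where p: "x = rat_eval \<alpha> p" using x unfolding sextic_span_rat_eq_range by auto
    then have "\<not> fQ dvd p" using x rat_eval_eq_0_iff by simp
    then obtain u v where uv: "u * fQ + v * p = 1"
      using bezout_irreducible irr fQ_def by metis
    have "rat_eval \<alpha> (u * fQ + v * p) = 1" unfolding uv by simp
    then have "rat_eval \<alpha> v * x = 1" using p root by (simp add: rat_eval_fQ)
    then have "inverse x = rat_eval \<alpha> v" using inverse_unique mult.commute by metis
    then show ?thesis unfolding sextic_span_rat_eq_range by auto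
  qed
  then show ?thesis using int_closedD[OF sextic_span_int_closed[OF int_closed_Rats]]
    by (simp add: is_subfield_C_def)
qed

lemma sextic_span_rat_eq: "sextic_span \<rat> = field_gen {\<alpha>}"
proof
  show "sextic_span \<rat> \<subseteq> field_gen {\<alpha>}"
    using rat_eval_mem[OF subfield_field_gen] field_gen_supset sextic_span_rat_eq_range by force
  show "field_gen {\<alpha>} \<subseteq> sextic_span \<rat>"
    by (rule field_gen_least[OF sextic_span_rat_subfield]) (simp add: alpha_sextic_span int_closed_Rats)
qed

end

section \<open>Extending field homomorphisms\<close>

text \<open>A map on all of the complex numbers is judged only on \<open>S\<close>; the clause at 1
  rules out the zero map.\<close>

definition hom_on :: "complex set \<Rightarrow> (complex \<Rightarrow> complex) \<Rightarrow> bool" where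
  "hom_on S h \<longleftrightarrow> h 1 = 1 \<and> (\<forall>x\<in>S. \<forall>y\<in>S. h (x + y) = h x + h y \<and> h (x * y) = h x * h y)"

lemma hom_on_subset: "hom_on T h \<Longrightarrow> S \<subseteq> T \<Longrightarrow> hom_on S h"
  unfolding hom_on_def by blast

locale subfield_hom =
  fixes S h assumes sub: "is_subfield_C S" and hom: "hom_on S h"
begin

lemma add: "x \<in> S \<Longrightarrow> y \<in> S \<Longrightarrow> h (x + y) = h x + h y"
  and mult: "x \<in> S \<Longrightarrow> y \<in> S \<Longrightarrow> h (x * y) = h x * h y"
  and one: "h 1 = 1"
  using hom by (auto simp: hom_on_def)

lemma zero: "h 0 = 0"
  using add[of 0 0] subfieldD[OF sub] by simp

lemma minus: "x \<in> S \<Longrightarrow> h (- x) = - h x"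
  using add[of x "-x"] zero subfieldD[OF sub] by (simp add: add_eq_0_iff)

lemma diff: "x \<in> S \<Longrightarrow> y \<in> S \<Longrightarrow> h (x - y) = h x - h y"
  using add[of x "-y"] minus[of y] subfieldD[OF sub] by simp

lemma power: "x \<in> S \<Longrightarrow> h (x ^ n) = h x ^ n"
  by (induction n) (auto simp: one mult subfieldD[OF sub])

lemma inverse: "x \<in> S \<Longrightarrow> h (inverse x) = inverse (h x)"
proof (cases "x = 0")
  case False
  assume x: "x \<in> S"
  then have "inverse x \<in> S" using False sub by (auto simp: is_subfield_C_def)
  from mult[OF x this] have "h x * h (inverse x) = 1" using False one by simp
  then show ?thesis by (metis inverse_unique)
qed (simp add: zero)

lemma divide: "x \<in> S \<Longrightarrow> y \<in> S \<Longrightarrow> h (x / y) = h x / h y"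
  using mult[of x "inverse y"] inverse[of y] subfield_divide[OF sub, of 1 y] subfieldD[OF sub]
  by (simp add: divide_inverse)

lemma eq_0: "x \<in> S \<Longrightarrow> h x = 0 \<Longrightarrow> x = 0"
  using mult[of x "inverse x"] one subfield_divide[OF sub, of 1 x] subfieldD[OF sub]
  by (cases "x = 0") (auto simp: divide_inverse)

lemma inj: "inj_on h S"
  by (rule inj_onI) (metis diff eq_0 eq_iff_diff_eq_0 subfieldD(6)[OF sub])

lemma of_int: "h (of_int n) = of_int n"
proof -
  have nat: "h (of_nat n) = of_nat n" for n
  proof (induction n)
    case (Suc n)
    have "of_nat n \<in> S" using subfieldD(1)[OF sub, of "int n"] by simp
    then show ?case using Suc add[of 1 "of_nat n"] one subfieldD[OF sub] by simp
  qed (simp add: zero)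
  show ?thesis
  proof (cases n rule: int_cases2)
    case (nonneg m)
    then show ?thesis using nat by simp
  next
    case (nonpos m)
    have "of_nat m \<in> S" using subfieldD(1)[OF sub, of "int m"] by simp
    then show ?thesis using nonpos nat minus by simp
  qed
qed

lemma Rats: "x \<in> \<rat> \<Longrightarrow> h x = x"
  by (metis Rats_cases' divide of_int subfieldD(1)[OF sub])

text \<open>Together with the next two lemmas this lets \<open>field_gen_least\<close> carry
  statements about the roots over to the whole splitting field.\<close>

lemma image_subfield: "is_subfield_C (h ` S)"
  unfolding is_subfield_C_def
proof (intro conjI ballI impI)
  show "0 \<in> h ` S" "1 \<in> h ` S" using zero one subfieldD[OF sub] by (metis imageI)+
  fix x y assume "x \<in> h ` S" "y \<in> h ` S"
  then obtain u v where "x = h u" "y = h v" "u \<in> S" "v \<in> S" by blast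
  then show "x + y \<in> h ` S" "x - y \<in> h ` S" "x * y \<in> h ` S"
    using subfieldD[OF sub] add[of u v] diff[of u v] mult[of u v] by (metis imageI)+
next
  fix x assume "x \<in> h ` S" "x \<noteq> 0"
  then obtain u where "x = h u" "u \<in> S" by blast
  then show "inverse x \<in> h ` S" using subfield_divide[OF sub, of 1 u] inverse subfieldD[OF sub]
    by (metis imageI inverse_eq_divide)
qed

lemma vimage_subfield:
  assumes "is_subfield_C L" shows "is_subfield_C {x \<in> S. h x \<in> L}"
  unfolding is_subfield_C_def
proof (intro conjI ballI impI)
  show "0 \<in> {x \<in> S. h x \<in> L}" "1 \<in> {x \<in> S. h x \<in> L}"
    using zero one subfieldD[OF sub] subfieldD[OF assms] by auto
  fix x y assume xy: "x \<in> {x \<in> S. h x \<in> L}" "y \<in> {x \<in> S. h x \<in> L}"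
  then show "x + y \<in> {x \<in> S. h x \<in> L}" "x - y \<in> {x \<in> S. h x \<in> L}" "x * y \<in> {x \<in> S. h x \<in> L}"
    using subfieldD[OF sub] subfieldD[OF assms] by (auto simp: add diff mult)
next
  fix x assume "x \<in> {x \<in> S. h x \<in> L}"
  then show "inverse x \<in> {x \<in> S. h x \<in> L}"
    using subfield_divide[OF sub, of 1 x] subfield_divide[OF assms, of 1 "h x"] inverse
      subfieldD[OF sub] subfieldD[OF assms] by (auto simp: inverse_eq_divide)
qed

lemma fixed_subfield: "is_subfield_C {x \<in> S. h x = x}"
  unfolding is_subfield_C_def
proof (intro conjI ballI impI)
  show "0 \<in> {x \<in> S. h x = x}" "1 \<in> {x \<in> S. h x = x}"
    using zero one subfieldD[OF sub] by auto
  fix x y assume xy: "x \<in> {x \<in> S. h x = x}" "y \<in> {x \<in> S. h x = x}"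
  then show "x + y \<in> {x \<in> S. h x = x}" "x - y \<in> {x \<in> S. h x = x}" "x * y \<in> {x \<in> S. h x = x}"
    using subfieldD[OF sub] by (auto simp: add diff mult)
next
  fix x assume "x \<in> {x \<in> S. h x = x}"
  then show "inverse x \<in> {x \<in> S. h x = x}"
    using subfield_divide[OF sub, of 1 x] inverse subfieldD[OF sub] by (auto simp: inverse_eq_divide)
qed

text \<open>Elements of S(z) are x + y z with unique x, y in \<open>S\<close>, so x + y z can be
  sent to h x + h y w; the condition on w makes this multiplicative. Leaving w to be prescribed
  allows z to be sent to -z.\<close>

lemma extend_sqrt_new:
  assumes z: "z\<^sup>2 \<in> S" "z \<notin> S" and w: "w\<^sup>2 = h (z\<^sup>2)"
  obtains S' h' where "is_subfield_C S'" "S \<subseteq> S'" "z \<in> S'" "hom_on S' h'" "\<And>x. x \<in> S \<Longrightarrow> h' x = h x" "h' z = w"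
proof -
  note S = subfieldD[OF sub]
  define S' where "S' = {x + y * z | x y. x \<in> S \<and> y \<in> S}"
  have uniq: "x = x' \<and> y = y'"
    if "x + y * z = x' + y' * z" "x \<in> S" "y \<in> S" "x' \<in> S" "y' \<in> S" for x y x' y'
  proof -
    have "y = y'"
    proof (rule ccontr)
      assume ne: "y \<noteq> y'"
      have "(y - y') * z = x' - x" using that(1) by (simp add: algebra_simps)
      then have "z = (x' - x) / (y - y')" using ne by (simp add: field_simps)
      then show False using z that S subfield_divide[OF sub] by metis
    qed
    then show ?thesis using that by simp
  qed
  define h' where "h' t = (THE r. \<exists>x y. x \<in> S \<and> y \<in> S \<and> t = x + y * z \<and> r = h x + h y * w)" for t
  have h': "h' (x + y * z) = h x + h y * w" if "x \<in> S" "y \<in> S" for x y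
    unfolding h'_def by (rule the_equality) (use that uniq in blast)+
  have mem: "x + y * z \<in> S'" if "x \<in> S" "y \<in> S" for x y
    using that by (auto simp: S'_def)
  have E: "\<exists>x y. t = x + y * z \<and> x \<in> S \<and> y \<in> S" if "t \<in> S'" for t
    using that by (auto simp: S'_def)
  have mulz: "(x + y * z) * (x' + y' * z) = (x * x' + y * y' * z\<^sup>2) + (x * y' + y * x') * z" for x y x' y'
    by (simp add: algebra_simps power2_eq_square)
  have mulw: "(x + y * w) * (x' + y' * w) = (x * x' + y * y' * h (z\<^sup>2)) + (x * y' + y * x') * w" for x y x' y'
    unfolding w[symmetric] by (simp add: algebra_simps power2_eq_square)
  have sub': "is_subfield_C S'"
    unfolding is_subfield_C_def
  proof (intro conjI ballI impI)
    show "0 \<in> S'" using mem[of 0 0] S by simp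
    show "1 \<in> S'" using mem[of 1 0] S by simp
    fix t u assume "t \<in> S'" "u \<in> S'"
    then obtain x y x' y' where t: "t = x + y * z" "x \<in> S" "y \<in> S" and u: "u = x' + y' * z" "x' \<in> S" "y' \<in> S"
      using E by meson
    have "t + u = (x + x') + (y + y') * z" "t - u = (x - x') + (y - y') * z"
      "t * u = (x * x' + y * y' * z\<^sup>2) + (x * y' + y * x') * z"
      using mulz by (simp_all add: t u algebra_simps)
    then show "t + u \<in> S'" "t - u \<in> S'" "t * u \<in> S'"
      using t u z S mem by metis+
  next
    fix t assume "t \<in> S'" "t \<noteq> 0"
    then obtain x y where t: "t = x + y * z" "x \<in> S" "y \<in> S" using E by meson
    \<comment> \<open>Uniqueness of coordinates makes the conjugate nonzero as well, so multiplying
      by it rationalises the denominator of 1/t.\<close>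
    have "x - y * z \<noteq> 0"
      using uniq[of x "-y" 0 0] t S \<open>t \<noteq> 0\<close> by auto
    moreover have eq: "t * (x - y * z) = x * x - y * y * z\<^sup>2"
      by (simp add: t algebra_simps power2_eq_square)
    ultimately have "inverse t = (x - y * z) / (x * x - y * y * z\<^sup>2)"
      unfolding eq[symmetric] using \<open>t \<noteq> 0\<close> by (simp add: inverse_eq_divide)
    also have "\<dots> = x / (x * x - y * y * z\<^sup>2) + (- y / (x * x - y * y * z\<^sup>2)) * z"
      by (simp add: diff_divide_distrib)
    also have "\<dots> \<in> S'" using t z by (intro mem subfield_divide[OF sub]) (simp_all add: S)
    finally show "inverse t \<in> S'" .
  qed
  have hom': "hom_on S' h'"
    unfolding hom_on_def
  proof (intro conjI ballI)
    show "h' 1 = 1" using h'[of 1 0] S zero one by simp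
    fix t u assume "t \<in> S'" "u \<in> S'"
    then obtain x y x' y' where t: "t = x + y * z" "x \<in> S" "y \<in> S" and u: "u = x' + y' * z" "x' \<in> S" "y' \<in> S"
      using E by meson
    have *: "t + u = (x + x') + (y + y') * z"
      "t * u = (x * x' + y * y' * z\<^sup>2) + (x * y' + y * x') * z"
      using mulz by (simp_all add: t u algebra_simps)
    have "h' (t + u) = h (x + x') + h (y + y') * w" unfolding * by (rule h') (use t u S in simp_all)
    also have "\<dots> = h' t + h' u" using t u by (simp add: add h' algebra_simps)
    finally show "h' (t + u) = h' t + h' u" .
    have "h' (t * u) = h (x * x' + y * y' * z\<^sup>2) + h (x * y' + y * x') * w"
      unfolding * by (rule h') (use t u z S in simp_all)
    also have "\<dots> = (h x * h x' + h y * h y' * h (z\<^sup>2)) + (h x * h y' + h y * h x') * w"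
      using t u z S by (simp add: add mult)
    also have "\<dots> = h' t * h' u" using t u by (simp add: h' mulw)
    finally show "h' (t * u) = h' t * h' u" .
  qed
  show thesis
  proof
    show "S \<subseteq> S'" using mem[of _ 0] S by force
    show "z \<in> S'" using mem[of 0 1] S by simp
    show "\<And>x. x \<in> S \<Longrightarrow> h' x = h x" using h'[of _ 0] S zero by simp
    show "h' z = w" using h'[of 0 1] S zero one by simp
  qed fact+
qed

lemma extend_sqrt:
  assumes z: "z\<^sup>2 \<in> S"
  obtains S' h' where "is_subfield_C S'" "S \<subseteq> S'" "z \<in> S'" "hom_on S' h'" "\<And>x. x \<in> S \<Longrightarrow> h' x = h x"
proof (cases "z \<in> S")
  case True
  then show thesis using that sub hom by blast
next
  case False
  have "(csqrt (h (z\<^sup>2)))\<^sup>2 = h (z\<^sup>2)" by simp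
  from extend_sqrt_new[OF z False this] that show thesis by metis
qed

end

text \<open>An injective homomorphism sends roots to roots and therefore permutes the finite set of
  roots, so it maps the splitting field onto itself. Restricting it and continuing by the identity
  matches the encoding in \<open>Gal\<close>.\<close>

lemma Gal_extends:
  assumes S: "is_subfield_C S" and h: "hom_on S h" and roots: "croots f \<subseteq> S" and f0: "f \<noteq> 0"
  obtains \<tau> where "\<tau> \<in> Gal f" "\<And>x. x \<in> splitting_field f \<Longrightarrow> \<tau> x = h x"
proof -
  define L where "L = splitting_field f"
  have LS: "L \<subseteq> S" unfolding L_def splitting_field_def by (rule field_gen_least[OF S roots])
  have subL: "is_subfield_C L" unfolding L_def splitting_field_def by (rule subfield_field_gen)
  interpret S: subfield_hom S h using S h by unfold_locales
  interpret L: subfield_hom L h using subL hom_on_subset[OF h LS] by unfold_locales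
  have fin: "finite (croots f)"
    unfolding croots_def by (rule poly_roots_finite) (use f0 in \<open>simp add: map_poly_eq_0_iff\<close>)
  have rootsL: "croots f \<subseteq> L" unfolding L_def splitting_field_def by (rule field_gen_supset)
  have int_eval: "h (poly (map_poly of_int p) z) = poly (map_poly of_int p) (h z) \<and> poly (map_poly of_int p) z \<in> L"
    if "z \<in> L" for z and p :: "int poly"
    using that
    by (induction p) (auto simp: map_poly_pCons L.zero L.add L.mult L.of_int subfieldD[OF subL])
  have into: "h ` croots f \<subseteq> croots f"
  proof
    fix y assume "y \<in> h ` croots f"
    then obtain z where z: "y = h z" "z \<in> croots f" by blast
    then show "y \<in> croots f"
      using int_eval[of z f] rootsL L.zero by (auto simp: croots_def)
  qed
  have perm: "h ` croots f = croots f"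
    by (rule endo_inj_surj[OF fin into inj_on_subset[OF L.inj rootsL]])
  have "L \<subseteq> h ` L"
    unfolding L_def splitting_field_def
    by (rule field_gen_least[OF L.image_subfield[unfolded L_def splitting_field_def]])
      (use perm rootsL in \<open>auto simp: L_def splitting_field_def\<close>)
  moreover have "h ` L \<subseteq> L"
  proof -
    have "L \<subseteq> {x \<in> L. h x \<in> L}"
      unfolding L_def splitting_field_def
      by (rule field_gen_least[OF L.vimage_subfield[OF subL, unfolded L_def splitting_field_def]])
        (use into rootsL in \<open>auto simp: L_def splitting_field_def\<close>)
    then show ?thesis by blast
  qed
  ultimately have img: "h ` L = L" by blast
  define \<tau> where "\<tau> x = (if x \<in> L then h x else x)" for x
  have "bij_betw \<tau> L L"
    unfolding bij_betw_def using L.inj img by (auto simp: \<tau>_def inj_on_def)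
  then have "\<tau> \<in> Gal f"
    unfolding Gal_def Let_def L_def[symmetric]
    using L.add L.mult L.one subfieldD[OF subL] by (auto simp: \<tau>_def)
  then show thesis using that[of \<tau>] by (auto simp: \<tau>_def L_def)
qed

section \<open>The Galois group\<close>

text \<open>Finiteness makes two powers coincide and injectivity cancels the smaller one, so some
  positive power is the identity. The least such exponent counts the distinct powers.\<close>

lemma funpow_card_order:
  fixes s :: "'a \<Rightarrow> 'a"
  assumes "inj s" "finite (range (\<lambda>k. s ^^ k))" "card (range (\<lambda>k. s ^^ k)) = n"
  shows "s ^^ n = id" "inj_on (\<lambda>k. s ^^ k) {..<n}"
proof -
  have cancel: "s ^^ (j - i) = id" if "s ^^ i = s ^^ j" "i \<le> j" for i j
  proof
    fix x
    have "(s ^^ i) ((s ^^ (j - i)) x) = (s ^^ i) x"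
      using that by (metis funpow_add comp_apply le_add_diff_inverse)
    then show "(s ^^ (j - i)) x = id x"
      using assms(1) inj_fn by (metis id_apply injD)
  qed
  have "\<not> inj (\<lambda>k. s ^^ k)" using assms(2) finite_imageD infinite_UNIV_nat by blast
  then obtain i j where "i < j" "s ^^ i = s ^^ j" unfolding inj_def by (metis linorder_neqE_nat)
  then have ex: "\<exists>m. 0 < m \<and> s ^^ m = id" using cancel[of i j] by (intro exI[of _ "j - i"]) auto
  define m where "m = (LEAST m. 0 < m \<and> s ^^ m = id)"
  have m: "0 < m" "s ^^ m = id" using LeastI_ex[OF ex] by (auto simp: m_def)
  have least: "m \<le> k" if "0 < k" "s ^^ k = id" for k
    unfolding m_def by (rule Least_le) (use that in simp)
  have inj: "inj_on (\<lambda>k. s ^^ k) {..<m}"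
  proof (rule linorder_inj_onI)
    fix i j assume "i < j" "i \<in> {..<m}" "j \<in> {..<m}"
    then show "s ^^ i \<noteq> s ^^ j" using cancel[of i j] least[of "j - i"] by force
  qed auto
  have "s ^^ k \<in> (\<lambda>k. s ^^ k) ` {..<m}" for k
  proof -
    have "s ^^ (k mod m) = s ^^ k" using m by (intro ext funpow_mod_eq) simp
    then show ?thesis using m by (metis imageI lessThan_iff mod_less_divisor)
  qed
  then have "range (\<lambda>k. s ^^ k) = (\<lambda>k. s ^^ k) ` {..<m}" by auto
  then have "n = m" using assms(3) card_image[OF inj] by simp
  then show "s ^^ n = id" "inj_on (\<lambda>k. s ^^ k) {..<n}" using m inj by auto
qed

context sextic_root
begin

abbreviation K :: "complex set" where "K \<equiv> sextic_span \<rat>"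

lemma croots_iff: "z \<in> croots (sextic a b c) \<longleftrightarrow> z^6 + of_int a * z^4 + of_int b * z^2 + of_int c = 0"
  unfolding croots_def mem_Collect_eq poly_of_int_sextic ..

text \<open>Dividing y^3 + a y^2 + b y + c by y - \<alpha>^2 leaves a quadratic whose discriminant
  is the last right-hand side. Its two roots are \<alpha>1^2 and \<alpha>2^2, so nested square roots
  produce all roots of the sextic.\<close>

lemma factorization:
  obtains \<alpha>1 \<alpha>2 where
    "\<And>z. z \<in> croots (sextic a b c) \<longleftrightarrow> z = \<alpha> \<or> z = - \<alpha> \<or> z = \<alpha>1 \<or> z = - \<alpha>1 \<or> z = \<alpha>2 \<or> z = - \<alpha>2"
    "\<alpha>1^2 + \<alpha>2^2 = - (of_int a + \<alpha>^2)"
    "(\<alpha>1^2 - \<alpha>2^2)^2 = (of_int a + \<alpha>^2)^2 - 4 * (\<alpha>^4 + of_int a * \<alpha>^2 + of_int b)"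
proof -
  define \<epsilon> where "\<epsilon> = csqrt ((of_int a + \<alpha>^2)^2 - 4 * (\<alpha>^4 + of_int a * \<alpha>^2 + of_int b))"
  have \<epsilon>: "\<epsilon>^2 = (of_int a + \<alpha>^2)^2 - 4 * (\<alpha>^4 + of_int a * \<alpha>^2 + of_int b)"
    unfolding \<epsilon>_def by simp
  define \<alpha>1 where "\<alpha>1 = csqrt ((- (of_int a + \<alpha>^2) + \<epsilon>) / 2)"
  define \<alpha>2 where "\<alpha>2 = csqrt ((- (of_int a + \<alpha>^2) - \<epsilon>) / 2)"
  have \<alpha>1: "\<alpha>1^2 = (- (of_int a + \<alpha>^2) + \<epsilon>) / 2" and \<alpha>2: "\<alpha>2^2 = (- (of_int a + \<alpha>^2) - \<epsilon>) / 2"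
    unfolding \<alpha>1_def \<alpha>2_def by simp_all
  have s: "\<alpha>1^2 + \<alpha>2^2 = - (of_int a + \<alpha>^2)" unfolding \<alpha>1 \<alpha>2 by (simp add: field_simps)
  have d: "\<alpha>1^2 - \<alpha>2^2 = \<epsilon>" unfolding \<alpha>1 \<alpha>2 by (simp add: field_simps)
  have "4 * (\<alpha>1^2 * \<alpha>2^2) = (\<alpha>1^2 + \<alpha>2^2)^2 - (\<alpha>1^2 - \<alpha>2^2)^2"
    by (simp add: power2_eq_square algebra_simps)
  also have "\<dots> = 4 * (\<alpha>^4 + of_int a * \<alpha>^2 + of_int b)"
    unfolding s d \<epsilon> by (simp add: power2_eq_square algebra_simps)
  finally have p: "\<alpha>1^2 * \<alpha>2^2 = \<alpha>^4 + of_int a * \<alpha>^2 + of_int b"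
    unfolding mult_cancel_left by simp
  have "(z^2 - \<alpha>^2) * ((z^2 - \<alpha>1^2) * (z^2 - \<alpha>2^2)) = z^6 + of_int a * z^4 + of_int b * z^2 + of_int c" for z
  proof -
    have "(z^2 - \<alpha>1^2) * (z^2 - \<alpha>2^2) = z^4 - (\<alpha>1^2 + \<alpha>2^2) * z^2 + \<alpha>1^2 * \<alpha>2^2"
      by (simp add: algebra_simps flip: power_add)
    also have "(z^2 - \<alpha>^2) * \<dots> = z^6 + of_int a * z^4 + of_int b * z^2 - (\<alpha>^6 + of_int a * \<alpha>^4 + of_int b * \<alpha>^2)"
      unfolding s p by (simp add: algebra_simps flip: power_add)
    finally show ?thesis unfolding root6 by simp
  qed
  then have "z \<in> croots (sextic a b c) \<longleftrightarrow> z^2 = \<alpha>^2 \<or> z^2 = \<alpha>1^2 \<or> z^2 = \<alpha>2^2" for z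
    unfolding croots_iff by (metis (no_types, lifting) eq_iff_diff_eq_0 mult_eq_0_iff)
  then show thesis
    by (intro that[of \<alpha>1 \<alpha>2] s) (auto simp: d \<epsilon> power2_eq_iff)
qed

text \<open>Three square roots are adjoined in turn: first \<alpha>1^2 - \<alpha>2^2, which puts
  both squares into the field, then \<alpha>1 and \<alpha>2.\<close>

lemma extend_to_roots:
  assumes "is_subfield_C S" "hom_on S h" "\<alpha> \<in> S"
  obtains S' h' where "is_subfield_C S'" "hom_on S' h'" "S \<subseteq> S'" "croots (sextic a b c) \<subseteq> S'" "\<And>x. x \<in> S \<Longrightarrow> h' x = h x"
proof -
  obtain \<alpha>1 \<alpha>2 where rt: "\<And>z. z \<in> croots (sextic a b c) \<longleftrightarrow> z = \<alpha> \<or> z = - \<alpha> \<or> z = \<alpha>1 \<or> z = - \<alpha>1 \<or> z = \<alpha>2 \<or> z = - \<alpha>2"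
    and s: "\<alpha>1^2 + \<alpha>2^2 = - (of_int a + \<alpha>^2)"
    and d: "(\<alpha>1^2 - \<alpha>2^2)^2 = (of_int a + \<alpha>^2)^2 - 4 * (\<alpha>^4 + of_int a * \<alpha>^2 + of_int b)"
    using factorization by blast
  interpret S: subfield_hom S h using assms by unfold_locales
  note S = subfieldD[OF assms(1)]
  have "(\<alpha>1^2 - \<alpha>2^2)^2 \<in> S" unfolding d using assms(3) by (simp add: S)
  then obtain S1 h1 where 1: "is_subfield_C S1" "S \<subseteq> S1" "\<alpha>1^2 - \<alpha>2^2 \<in> S1" "hom_on S1 h1" "\<And>x. x \<in> S \<Longrightarrow> h1 x = h x"
    using S.extend_sqrt by blast
  interpret S1: subfield_hom S1 h1 using 1 by unfold_locales
  note S1 = subfieldD[OF 1(1)]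
  have "\<alpha> \<in> S1" using 1 assms by blast
  then have sum: "\<alpha>1^2 + \<alpha>2^2 \<in> S1" unfolding s by (simp add: S1)
  have "((\<alpha>1^2 + \<alpha>2^2) + (\<alpha>1^2 - \<alpha>2^2)) / 2 \<in> S1" "((\<alpha>1^2 + \<alpha>2^2) - (\<alpha>1^2 - \<alpha>2^2)) / 2 \<in> S1"
    by (intro subfield_divide[OF 1(1)] S1(4) S1(5,6)[OF sum 1(3)])+
  then have sq: "\<alpha>1^2 \<in> S1" "\<alpha>2^2 \<in> S1" by simp_all
  obtain S2 h2 where 2: "is_subfield_C S2" "S1 \<subseteq> S2" "\<alpha>1 \<in> S2" "hom_on S2 h2" "\<And>x. x \<in> S1 \<Longrightarrow> h2 x = h1 x"
    using S1.extend_sqrt sq by blast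
  interpret S2: subfield_hom S2 h2 using 2 by unfold_locales
  obtain S3 h3 where 3: "is_subfield_C S3" "S2 \<subseteq> S3" "\<alpha>2 \<in> S3" "hom_on S3 h3" "\<And>x. x \<in> S2 \<Longrightarrow> h3 x = h2 x"
    using S2.extend_sqrt sq 2 by blast
  have sub: "S \<subseteq> S1" "S \<subseteq> S2" "S \<subseteq> S3" using 1(2) 2(2) 3(2) by simp_all
  have "z \<in> S3" if "z \<in> croots (sextic a b c)" for z
    using rt[THEN iffD1, OF that] subfieldD(8)[OF 3(1)] 3(3) subsetD[OF 3(2) 2(3)] subsetD[OF sub(3) assms(3)]
    by (elim disjE) simp_all
  then have "croots (sextic a b c) \<subseteq> S3" ..
  moreover have "h3 x = h x" if "x \<in> S" for x
    using 1(5)[OF that] 2(5)[OF subsetD[OF sub(1) that]] 3(5)[OF subsetD[OF sub(2) that]] by simp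
  ultimately show thesis using that[OF 3(1,4) sub(3)] by simp
qed

text \<open>Polynomials with the same value at \<alpha> differ by a multiple of \<open>fQ\<close>,
  which vanishes at \<alpha>' too, so evaluation at \<alpha>' does not depend on the chosen
  representative.\<close>

lemma conjugation:
  assumes "\<alpha>' \<in> croots (sextic a b c)"
  obtains h where "hom_on K h" "h \<alpha> = \<alpha>'"
proof -
  define h where "h z = rat_eval \<alpha>' (SOME p. rat_eval \<alpha> p = z)" for z
  have h: "h (rat_eval \<alpha> p) = rat_eval \<alpha>' p" for p
  proof -
    define q where "q = (SOME q. rat_eval \<alpha> q = rat_eval \<alpha> p)"
    have "rat_eval \<alpha> q = rat_eval \<alpha> p" unfolding q_def by (rule someI) (rule refl)
    then have "rat_eval \<alpha> (q - p) = 0" by simp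
    then have "fQ dvd q - p" unfolding rat_eval_eq_0_iff .
    then have "rat_eval \<alpha>' (q - p) = 0" using assms
      by (auto simp: croots_iff rat_eval_fQ elim!: dvdE simp del: rat_eval_simps(5))
    then show ?thesis by (simp add: h_def q_def)
  qed
  have "hom_on K h"
    unfolding hom_on_def sextic_span_rat_eq_range
  proof (intro conjI ballI)
    show "h 1 = 1" using h[of 1] by simp
    fix x y assume "x \<in> range (rat_eval \<alpha>)" "y \<in> range (rat_eval \<alpha>)"
    then obtain p q where "x = rat_eval \<alpha> p" "y = rat_eval \<alpha> q" by blast
    then show "h (x + y) = h x + h y" "h (x * y) = h x * h y"
      using h[of "p + q"] h[of "p * q"] h[of p] h[of q] by simp_all
  qed
  moreover have "h \<alpha> = \<alpha>'" using h[of "[:0, 1:]"] by simp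
  ultimately show thesis using that by blast
qed

text \<open>A transitive abelian permutation group has trivial stabilisers, so the six powers of
  \<sigma> take \<alpha> to six different roots. The power taking \<alpha> to -\<alpha> has order
  two, hence is the third.\<close>

lemma cyclic_structure:
  assumes "Gal_cyclic_of_order (sextic a b c) 6"
  obtains \<sigma> where "hom_on K \<sigma>" "\<And>x. x \<in> K \<Longrightarrow> \<sigma> x \<in> K" "\<sigma> (\<sigma> (\<sigma> \<alpha>)) = - \<alpha>"
    "\<alpha>^2 \<noteq> (\<sigma> \<alpha>)^2" "\<alpha>^2 \<noteq> (\<sigma> (\<sigma> \<alpha>))^2" "(\<sigma> \<alpha>)^2 \<noteq> (\<sigma> (\<sigma> \<alpha>))^2"
proof -
  let ?f = "sextic a b c"
  define L where "L = splitting_field ?f"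
  have subL: "is_subfield_C L" unfolding L_def splitting_field_def by (rule subfield_field_gen)
  have rootsL: "croots ?f \<subseteq> L" unfolding L_def splitting_field_def by (rule field_gen_supset)
  have leastL: "L \<subseteq> S" if "is_subfield_C S" "croots ?f \<subseteq> S" for S
    unfolding L_def splitting_field_def by (rule field_gen_least[OF that])
  have \<alpha>root: "\<alpha> \<in> croots ?f" using root croots_iff by blast
  have KL: "K \<subseteq> L" unfolding sextic_span_rat_eq by (rule field_gen_least[OF subL]) (use \<alpha>root rootsL in auto)
  have alpha_K: "\<alpha> \<in> K" by (rule alpha_sextic_span[OF int_closed_Rats])
  obtain \<sigma> where \<sigma>G: "\<sigma> \<in> Gal ?f" and G: "Gal ?f = {\<sigma> ^^ k | k. True}" and fin: "finite (Gal ?f)" and card: "card (Gal ?f) = 6"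
    using assms unfolding Gal_cyclic_of_order_def by blast
  have Gal: "bij_betw \<tau> L L" "hom_on L \<tau>" "\<And>x. x \<notin> L \<Longrightarrow> \<tau> x = x" if "\<tau> \<in> Gal ?f" for \<tau>
    using that unfolding Gal_def Let_def L_def[symmetric] hom_on_def by auto
  have comm: "\<tau> (\<rho> x) = \<rho> (\<tau> x)" if tr: "\<tau> \<in> Gal ?f" "\<rho> \<in> Gal ?f" for \<tau> \<rho> x
  proof -
    obtain k l where "\<tau> = \<sigma> ^^ k" "\<rho> = \<sigma> ^^ l" using tr G by auto
    then show ?thesis by (metis add.commute comp_apply funpow_add)
  qed
  \<comment> \<open>The embedding of \<open>K\<close> with the prescribed value at \<alpha> is
    extended to all roots and then restricted to the splitting field.\<close>
  have trans: "\<exists>\<tau>\<in>Gal ?f. \<tau> \<alpha> = \<alpha>'" if rt: "\<alpha>' \<in> croots ?f" for \<alpha>'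
  proof -
    obtain h where h: "hom_on K h" "h \<alpha> = \<alpha>'" using conjugation[OF rt] .
    obtain S' h' where S': "is_subfield_C S'" "hom_on S' h'" "K \<subseteq> S'" "croots ?f \<subseteq> S'" "\<And>x. x \<in> K \<Longrightarrow> h' x = h x"
      using extend_to_roots[OF sextic_span_rat_subfield h(1) alpha_K] by metis
    obtain \<tau> where "\<tau> \<in> Gal ?f" "\<And>x. x \<in> L \<Longrightarrow> \<tau> x = h' x"
      using Gal_extends[OF S'(1,2,4)] unfolding L_def by auto
    then show ?thesis using S' h alpha_K KL by (intro bexI[of _ \<tau>]) auto
  qed
  \<comment> \<open>Every root is \<rho> \<alpha> for some \<rho> in the group, and \<tau> commutes
    with \<rho>; so \<tau> fixes all roots.\<close>
  have stab: "\<tau> = id" if "\<tau> \<in> Gal ?f" "\<tau> \<alpha> = \<alpha>" for \<tau>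
  proof -
    interpret \<tau>: subfield_hom L \<tau> using subL Gal[OF that(1)] by unfold_locales
    have "\<tau> z = z" if "z \<in> croots ?f" for z
      using trans[OF that] comm \<open>\<tau> \<in> Gal ?f\<close> \<open>\<tau> \<alpha> = \<alpha>\<close> by metis
    then have "L \<subseteq> {x \<in> L. \<tau> x = x}" using \<tau>.fixed_subfield rootsL by (intro leastL) auto
    then show ?thesis using Gal(3)[OF that(1)] by fastforce
  qed
  \<comment> \<open>Otherwise the identity of \<open>K\<close> would extend to an automorphism
    sending z to -z, a nontrivial element of the stabiliser of \<alpha>.\<close>
  have sqrtK: "z \<in> K" if z: "z\<^sup>2 \<in> K" "z \<in> L" for z
  proof (rule ccontr)
    assume "z \<notin> K"
    have "hom_on K id" by (simp add: hom_on_def)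
    then interpret idK: subfield_hom K id using sextic_span_rat_subfield by unfold_locales
    obtain S' h' where 1: "is_subfield_C S'" "K \<subseteq> S'" "z \<in> S'" "hom_on S' h'" "\<And>x. x \<in> K \<Longrightarrow> h' x = id x" "h' z = - z"
      using idK.extend_sqrt_new[OF z(1) \<open>z \<notin> K\<close>, of "- z"] by auto
    obtain S'' h'' where S': "is_subfield_C S''" "hom_on S'' h''" "S' \<subseteq> S''" "croots ?f \<subseteq> S''" "\<And>x. x \<in> S' \<Longrightarrow> h'' x = h' x"
      using extend_to_roots[OF 1(1) 1(4)] 1(2) alpha_K by (metis subsetD)
    obtain \<tau> where \<tau>: "\<tau> \<in> Gal ?f" "\<And>x. x \<in> L \<Longrightarrow> \<tau> x = h'' x"
      using Gal_extends[OF S'(1,2,4)] unfolding L_def by auto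
    have "\<alpha> \<in> S'" "\<alpha> \<in> L" using 1 alpha_K KL by blast+
    then have "\<tau> \<alpha> = \<alpha>" using \<tau> S' 1 alpha_K by simp
    then have "\<tau> = id" using stab \<tau>(1) by blast
    then have "z = h'' z" using \<tau>(2)[OF z(2)] by simp
    also have "\<dots> = - z" using S'(5)[OF 1(3)] 1(6) by simp
    finally have "2 * z = 0" by algebra
    then have "z = 0" by simp
    then show False using \<open>z \<notin> K\<close> subfieldD(2)[OF sextic_span_rat_subfield] by simp
  qed
  note K = subfieldD[OF sextic_span_rat_subfield]
  have rootsK: "croots ?f \<subseteq> K"
  proof -
    obtain \<alpha>1 \<alpha>2 where rt: "\<And>z. z \<in> croots ?f \<longleftrightarrow> z = \<alpha> \<or> z = - \<alpha> \<or> z = \<alpha>1 \<or> z = - \<alpha>1 \<or> z = \<alpha>2 \<or> z = - \<alpha>2"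
      and s: "\<alpha>1^2 + \<alpha>2^2 = - (of_int a + \<alpha>^2)"
      and d: "(\<alpha>1^2 - \<alpha>2^2)^2 = (of_int a + \<alpha>^2)^2 - 4 * (\<alpha>^4 + of_int a * \<alpha>^2 + of_int b)"
      using factorization by blast
    have L12: "\<alpha>1 \<in> L" "\<alpha>2 \<in> L" using rt rootsL by auto
    have "(\<alpha>1^2 - \<alpha>2^2)^2 \<in> K" unfolding d using alpha_K by (simp add: K)
    moreover have "\<alpha>1^2 - \<alpha>2^2 \<in> L" using L12 by (simp add: subfieldD[OF subL])
    ultimately have diff: "\<alpha>1^2 - \<alpha>2^2 \<in> K" by (rule sqrtK)
    have sum: "\<alpha>1^2 + \<alpha>2^2 \<in> K" unfolding s using alpha_K by (simp add: K)
    have "((\<alpha>1^2 + \<alpha>2^2) + (\<alpha>1^2 - \<alpha>2^2)) / 2 \<in> K" "((\<alpha>1^2 + \<alpha>2^2) - (\<alpha>1^2 - \<alpha>2^2)) / 2 \<in> K"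
      by (intro subfield_divide[OF sextic_span_rat_subfield] K(4) K(5,6)[OF sum diff])+
    then have sq: "\<alpha>1^2 \<in> K" "\<alpha>2^2 \<in> K" by simp_all
    have "z \<in> K" if "z \<in> croots ?f" for z
      using rt[THEN iffD1, OF that] sqrtK[OF sq(1) L12(1)] sqrtK[OF sq(2) L12(2)] alpha_K K(8)
      by (elim disjE) simp_all
    then show ?thesis ..
  qed
  have LK: "L = K" using KL leastL[OF sextic_span_rat_subfield rootsK] by blast
  have "inj \<sigma>"
  proof (rule injI)
    fix x y assume "\<sigma> x = \<sigma> y"
    then show "x = y" using Gal(1,3)[OF \<sigma>G] unfolding bij_betw_def inj_on_def by (metis imageI)
  qed
  have G': "Gal ?f = range (\<lambda>k. \<sigma> ^^ k)" using G by auto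
  note ord = funpow_card_order[OF \<open>inj \<sigma>\<close> fin[unfolded G'] card[unfolded G']]
  have pow: "i = j" if "(\<sigma> ^^ i) \<alpha> = (\<sigma> ^^ j) \<alpha>" "i < 6" "j < 6" for i j
  proof -
    have *: "i = j" if "(\<sigma> ^^ i) \<alpha> = (\<sigma> ^^ j) \<alpha>" "i \<le> j" "j < 6" for i j
    proof -
      have "(\<sigma> ^^ i) ((\<sigma> ^^ (j - i)) \<alpha>) = (\<sigma> ^^ i) \<alpha>"
        using that by (metis funpow_add comp_apply le_add_diff_inverse)
      then have "(\<sigma> ^^ (j - i)) \<alpha> = \<alpha>" using \<open>inj \<sigma>\<close> inj_fn injD by metis
      then have "\<sigma> ^^ (j - i) = id" using stab[of "\<sigma> ^^ (j - i)"] G' by blast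
      then have "\<sigma> ^^ (j - i) = \<sigma> ^^ 0" by simp
      then have "j - i = 0" using inj_onD[OF ord(2)] that by fastforce
      then show ?thesis using that by simp
    qed
    show ?thesis using *[of i j] *[of j i] that by (cases "i \<le> j") auto
  qed
  have hom: "hom_on K \<sigma>" and into: "\<And>x. x \<in> K \<Longrightarrow> \<sigma> x \<in> K"
    using Gal(1,2)[OF \<sigma>G] LK by (auto simp: bij_betw_def)
  interpret \<sigma>: subfield_hom K \<sigma> using sextic_span_rat_subfield hom by unfold_locales
  have "\<alpha> \<noteq> 0"
    using lin_indep[of 0 1 0 0 0 0] by auto
  have pow_minus: "(\<sigma> ^^ k) (- \<alpha>) = - (\<sigma> ^^ k) \<alpha> \<and> (\<sigma> ^^ k) \<alpha> \<in> K" for k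
    by (induction k) (auto simp: \<sigma>.minus into alpha_K)
  have neg: "(\<sigma> ^^ 3) \<alpha> = - \<alpha>"
  proof -
    have "- \<alpha> \<in> croots ?f" using \<alpha>root by (simp add: croots_iff)
    then obtain \<tau> where \<tau>: "\<tau> \<in> Gal ?f" "\<tau> \<alpha> = - \<alpha>" using trans by blast
    then obtain k where k: "(\<sigma> ^^ k) \<alpha> = - \<alpha>" using G' by auto
    define l where "l = k mod 6"
    have "\<sigma> ^^ (k mod 6) = \<sigma> ^^ k" using ord(1) by (intro ext funpow_mod_eq) simp
    then have l: "(\<sigma> ^^ l) \<alpha> = - \<alpha>" "l < 6" using k by (simp_all add: l_def)
    \<comment> \<open>Negating twice returns \<alpha>, so 2 l is 0 modulo 6, while l = 0 would force
      \<alpha> = 0.\<close>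
    have "(\<sigma> ^^ (l + l)) \<alpha> = \<alpha>" unfolding funpow_add using l pow_minus[of l] by simp
    moreover have "\<sigma> ^^ ((l + l) mod 6) = \<sigma> ^^ (l + l)" using ord(1) by (intro ext funpow_mod_eq) simp
    ultimately have "(l + l) mod 6 = 0" using pow[of "(l + l) mod 6" 0] by simp
    moreover have "l \<noteq> 0"
    proof
      assume "l = 0"
      then have "2 * \<alpha> = 0" using l(1) by simp
      then show False using \<open>\<alpha> \<noteq> 0\<close> by simp
    qed
    ultimately have "l = 3" using l(2) by presburger
    then show ?thesis using l by simp
  qed
  \<comment> \<open>Equal squares would make the exponent i agree with j or with j + 3, both below 6
    and different from i.\<close>
  have ne: "((\<sigma> ^^ i) \<alpha>)^2 \<noteq> ((\<sigma> ^^ j) \<alpha>)^2" if "i < j" "j < 3" for i j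
  proof
    assume "((\<sigma> ^^ i) \<alpha>)^2 = ((\<sigma> ^^ j) \<alpha>)^2"
    then consider "(\<sigma> ^^ i) \<alpha> = (\<sigma> ^^ j) \<alpha>" | "(\<sigma> ^^ i) \<alpha> = - (\<sigma> ^^ j) \<alpha>" by (auto simp: power2_eq_iff)
    then show False
    proof cases
      case 1 then show False using pow[of i j] that by simp
    next
      case 2
      have "(\<sigma> ^^ (j + 3)) \<alpha> = - (\<sigma> ^^ j) \<alpha>" unfolding funpow_add comp_apply neg using pow_minus by simp
      then show False using pow[of i "j + 3"] that 2 by simp
    qed
  qed
  show thesis
    using neg ne[of 0 1] ne[of 0 2] ne[of 1 2]
    by (intro that[of \<sigma>] hom into) (simp_all add: eval_nat_numeral)
qed

end

section \<open>The cyclic field and its cubic subfield\<close>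

locale cyclic_sextic = sextic_root +
  fixes \<sigma> :: "complex \<Rightarrow> complex"
  assumes hom_\<sigma>: "hom_on K \<sigma>" and into: "x \<in> K \<Longrightarrow> \<sigma> x \<in> K" and \<sigma>3: "\<sigma> (\<sigma> (\<sigma> \<alpha>)) = - \<alpha>"
    and ne01: "\<alpha>^2 \<noteq> (\<sigma> \<alpha>)^2" and ne02: "\<alpha>^2 \<noteq> (\<sigma> (\<sigma> \<alpha>))^2" and ne12: "(\<sigma> \<alpha>)^2 \<noteq> (\<sigma> (\<sigma> \<alpha>))^2"

sublocale cyclic_sextic \<subseteq> subfield_hom K \<sigma>
  using sextic_span_rat_subfield hom_\<sigma> by unfold_locales

context cyclic_sextic
begin

abbreviation L :: "complex set" where "L \<equiv> cubic_span \<rat>"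
abbreviation OL :: "complex set" where "OL \<equiv> cubic_span \<int>"
abbreviation OK :: "complex set" where "OK \<equiv> sextic_span \<int>"

lemmas K_closed = subfieldD[OF sextic_span_rat_subfield]
lemmas L_closed = int_closedD[OF cubic_span_int_closed[OF int_closed_Rats]]
lemmas OK_closed = int_closedD[OF sextic_span_int_closed[OF int_closed_Ints]]
lemmas OL_closed = int_closedD[OF cubic_span_int_closed[OF int_closed_Ints]]

lemma cubic_span_mono: "R \<subseteq> R' \<Longrightarrow> x \<in> cubic_span R \<Longrightarrow> x \<in> cubic_span R'" unfolding cubic_span_def by auto
lemma sextic_span_mono: "R \<subseteq> R' \<Longrightarrow> x \<in> sextic_span R \<Longrightarrow> x \<in> sextic_span R'" unfolding sextic_span_def using cubic_span_mono[of R R'] by blast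

lemma L_subset_K: "x \<in> L \<Longrightarrow> x \<in> K" using cubic_span_subset_sextic_span[OF int_closed_Rats] by blast
lemma OL_subset_O: "x \<in> OL \<Longrightarrow> x \<in> OK" using cubic_span_subset_sextic_span[OF int_closed_Ints] by blast
lemma OL_subset_L: "x \<in> OL \<Longrightarrow> x \<in> L" by (rule cubic_span_mono[OF Ints_subset_Rats])
lemma OK_subset_K: "x \<in> OK \<Longrightarrow> x \<in> K" by (rule sextic_span_mono[OF Ints_subset_Rats])

definition "\<alpha>1 = \<sigma> \<alpha>"
definition "\<alpha>2 = \<sigma> \<alpha>1"

lemma sigma_alpha [simp]: "\<sigma> \<alpha> = \<alpha>1" "\<sigma> \<alpha>1 = \<alpha>2" "\<sigma> \<alpha>2 = - \<alpha>"
  using \<sigma>3 by (simp_all add: \<alpha>1_def \<alpha>2_def)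

lemma alpha_K: "\<alpha> \<in> K" "\<alpha>1 \<in> K" "\<alpha>2 \<in> K"
  using alpha_sextic_span[OF int_closed_Rats] into[of \<alpha>] into[of \<alpha>1] by simp_all

lemma alpha_nonzero: "\<alpha> \<noteq> 0"
  using lin_indep[of 0 1 0 0 0 0] by auto

lemma beta_distinct: "\<alpha>^2 \<noteq> \<alpha>1^2" "\<alpha>^2 \<noteq> \<alpha>2^2" "\<alpha>1^2 \<noteq> \<alpha>2^2"
  using ne01 ne02 ne12 by simp_all

lemma sigma_root:
  assumes "z \<in> K" "z^6 + of_int a * z^4 + of_int b * z^2 + of_int c = 0"
  shows "(\<sigma> z)^6 + of_int a * (\<sigma> z)^4 + of_int b * (\<sigma> z)^2 + of_int c = 0"
proof -
  have "(\<sigma> z)^6 + of_int a * (\<sigma> z)^4 + of_int b * (\<sigma> z)^2 + of_int c =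
      \<sigma> (z^6 + of_int a * z^4 + of_int b * z^2 + of_int c)"
    using assms(1) by (simp add: add mult power of_int K_closed)
  then show ?thesis using assms(2) zero by simp
qed

lemma roots: "\<alpha>1^6 + of_int a * \<alpha>1^4 + of_int b * \<alpha>1^2 + of_int c = 0"
  "\<alpha>2^6 + of_int a * \<alpha>2^4 + of_int b * \<alpha>2^2 + of_int c = 0"
  using sigma_root[OF alpha_K(1) root] sigma_root[OF alpha_K(2)] by simp_all

text \<open>The three squares are distinct roots of y^3 + a y^2 + b y + c. Subtracting their
  equations and cancelling the nonzero differences yields the elementary symmetric
  functions.\<close>

lemma vieta:
  "\<alpha>^2 + \<alpha>1^2 + \<alpha>2^2 = - of_int a"
  "\<alpha>^2 * \<alpha>1^2 + \<alpha>^2 * \<alpha>2^2 + \<alpha>1^2 * \<alpha>2^2 = of_int b"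
  "\<alpha>^2 * \<alpha>1^2 * \<alpha>2^2 = - of_int c"
proof -
  define A B C :: complex where "A = of_int a" and "B = of_int b" and "C = of_int c"
  define x y z where "x = \<alpha>^2" and "y = \<alpha>1^2" and "z = \<alpha>2^2"
  have x: "x^3 + A * x^2 + B * x + C = 0" and y: "y^3 + A * y^2 + B * y + C = 0" and z: "z^3 + A * z^2 + B * z + C = 0"
    using root roots by (simp_all add: x_def y_def z_def A_def B_def C_def flip: power_mult)
  have ne: "x - y \<noteq> 0" "x - z \<noteq> 0" "y - z \<noteq> 0" using beta_distinct by (simp_all add: x_def y_def z_def)
  have "(x - y) * (x^2 + x * y + y^2 + A * (x + y) + B) = 0" using x y by algebra
  then have 1: "x^2 + x * y + y^2 + A * (x + y) + B = 0" using ne by simp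
  have "(x - z) * (x^2 + x * z + z^2 + A * (x + z) + B) = 0" using x z by algebra
  then have 2: "x^2 + x * z + z^2 + A * (x + z) + B = 0" using ne by simp
  have "(y - z) * (x + y + z + A) = 0" using 1 2 by algebra
  then have s: "x + y + z = - A" using ne by (simp add: eq_neg_iff_add_eq_0)
  then have t: "x * y + x * z + y * z = B" using 1 by algebra
  have "x * y * z = - C" using s t x by algebra
  with s t show "\<alpha>^2 + \<alpha>1^2 + \<alpha>2^2 = - of_int a"
    "\<alpha>^2 * \<alpha>1^2 + \<alpha>^2 * \<alpha>2^2 + \<alpha>1^2 * \<alpha>2^2 = of_int b"
    "\<alpha>^2 * \<alpha>1^2 * \<alpha>2^2 = - of_int c"
    by (simp_all add: x_def y_def z_def A_def B_def C_def)
qed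

lemma cubic_span_unique:
  assumes "r0 \<in> \<rat>" "r1 \<in> \<rat>" "r2 \<in> \<rat>" "s0 \<in> \<rat>" "s1 \<in> \<rat>" "s2 \<in> \<rat>"
    and "r0 + r1 * \<alpha>^2 + r2 * \<alpha>^4 = s0 + s1 * \<alpha>^2 + s2 * \<alpha>^4"
  shows "r0 = s0" "r1 = s1" "r2 = s2"
  using coords_unique[of r0 r1 r2 0 0 0 s0 s1 s2 0 0 0] assms by auto

lemma sextic_span_unique:
  assumes "u \<in> L" "v \<in> L" "u' \<in> L" "v' \<in> L" "u + \<alpha> * v = u' + \<alpha> * v'"
  shows "u = u'" "v = v'"
proof -
  obtain r0 r1 r2 where u: "u = r0 + r1 * \<alpha>^2 + r2 * \<alpha>^4" "r0 \<in> \<rat>" "r1 \<in> \<rat>" "r2 \<in> \<rat>"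
    using assms(1) unfolding cubic_span_def by blast
  obtain s0 s1 s2 where v: "v = s0 + s1 * \<alpha>^2 + s2 * \<alpha>^4" "s0 \<in> \<rat>" "s1 \<in> \<rat>" "s2 \<in> \<rat>"
    using assms(2) unfolding cubic_span_def by blast
  obtain t0 t1 t2 where u': "u' = t0 + t1 * \<alpha>^2 + t2 * \<alpha>^4" "t0 \<in> \<rat>" "t1 \<in> \<rat>" "t2 \<in> \<rat>"
    using assms(3) unfolding cubic_span_def by blast
  obtain q0 q1 q2 where v': "v' = q0 + q1 * \<alpha>^2 + q2 * \<alpha>^4" "q0 \<in> \<rat>" "q1 \<in> \<rat>" "q2 \<in> \<rat>"
    using assms(4) unfolding cubic_span_def by blast
  show "u = u'" "v = v'"
    using coords_unique[OF u(2-4) v(2-4) u'(2-4) v'(2-4)] assms(5) unfolding u(1) v(1) u'(1) v'(1) by auto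
qed

lemma sigma_beta: "\<sigma> (\<alpha>^2) = \<alpha>1^2" "\<sigma> (\<alpha>1^2) = \<alpha>2^2" "\<sigma> (\<alpha>2^2) = \<alpha>^2"
  by (simp_all add: power alpha_K)

lemma sigma_L:
  assumes "r0 \<in> \<rat>" "r1 \<in> \<rat>" "r2 \<in> \<rat>" "y \<in> K"
  shows "\<sigma> (r0 + r1 * y^2 + r2 * y^4) = r0 + r1 * (\<sigma> y)^2 + r2 * (\<sigma> y)^4"
  using assms subfield_Rats[OF sextic_span_rat_subfield] by (simp add: add mult power Rats K_closed)

text \<open>The cube of \<sigma> sends \<alpha> to -\<alpha> and so fixes its even powers; it is the
  nontrivial automorphism of \<open>K\<close> over \<open>L\<close>.\<close>

lemma sigma3_L:
  assumes "x \<in> L" shows "\<sigma> (\<sigma> (\<sigma> x)) = x"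
proof -
  obtain r0 r1 r2 where "x = r0 + r1 * \<alpha>^2 + r2 * \<alpha>^4" "r0 \<in> \<rat>" "r1 \<in> \<rat>" "r2 \<in> \<rat>"
    using assms unfolding cubic_span_def by blast
  then show ?thesis by (simp add: sigma_L alpha_K)
qed

lemma sigma3_K:
  assumes "u \<in> L" "v \<in> L" shows "\<sigma> (\<sigma> (\<sigma> (u + \<alpha> * v))) = u - \<alpha> * v"
  using assms alpha_K by (simp add: add mult minus into K_closed L_subset_K sigma3_L)

text \<open>Comparing x with its conjugate u - \<alpha> v kills the odd part. The parameter
  \<open>R\<close> serves the fields and the orders at once.\<close>

lemma fixed3:
  assumes "x \<in> K" "\<sigma> (\<sigma> (\<sigma> x)) = x" "int_closed R" "R \<subseteq> \<rat>" "x \<in> sextic_span R"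
  shows "x \<in> cubic_span R"
proof -
  obtain u v where x: "x = u + \<alpha> * v" "u \<in> cubic_span R" "v \<in> cubic_span R"
    using assms(5) by (auto simp: sextic_span_def)
  then have uv: "u \<in> L" "v \<in> L" using cubic_span_mono[OF assms(4)] by auto
  have "u - \<alpha> * v = u + \<alpha> * v" using assms(2) x sigma3_K[OF uv] by simp
  then have "\<alpha> * v = 0" by simp
  then show ?thesis using x by auto
qed

lemma fixed3_L: "x \<in> K \<Longrightarrow> \<sigma> (\<sigma> (\<sigma> x)) = x \<Longrightarrow> x \<in> L"
  using fixed3[OF _ _ int_closed_Rats] by blast

lemma fixed3_OL: "x \<in> OK \<Longrightarrow> \<sigma> (\<sigma> (\<sigma> x)) = x \<Longrightarrow> x \<in> OL"
  using fixed3[OF _ _ int_closed_Ints Ints_subset_Rats] OK_subset_K by blast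

text \<open>A polynomial of degree at most 2 that takes one value at three distinct points, here the
  conjugates of \<alpha>^2, is constant.\<close>

lemma fixed_Rats:
  assumes "x \<in> K" "\<sigma> x = x" shows "x \<in> \<rat>"
proof -
  have "x \<in> L" using assms by (simp add: fixed3_L)
  then obtain r0 r1 r2 where x: "x = r0 + r1 * \<alpha>^2 + r2 * \<alpha>^4" and r: "r0 \<in> \<rat>" "r1 \<in> \<rat>" "r2 \<in> \<rat>"
    unfolding cubic_span_def by blast
  have x1: "x = r0 + r1 * \<alpha>1^2 + r2 * \<alpha>1^4" using assms(2) sigma_L[OF r alpha_K(1)] x by simp
  then have x2: "x = r0 + r1 * \<alpha>2^2 + r2 * \<alpha>2^4" using assms(2) sigma_L[OF r alpha_K(2)] by simp
  have "(\<alpha>^2 - \<alpha>1^2) * (r1 + r2 * (\<alpha>^2 + \<alpha>1^2)) = 0" using x x1 by algebra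
  moreover have "(\<alpha>^2 - \<alpha>2^2) * (r1 + r2 * (\<alpha>^2 + \<alpha>2^2)) = 0" using x x2 by algebra
  ultimately have *: "r1 + r2 * (\<alpha>^2 + \<alpha>1^2) = 0" "r1 + r2 * (\<alpha>^2 + \<alpha>2^2) = 0" using beta_distinct by simp_all
  then have "r2 * (\<alpha>1^2 - \<alpha>2^2) = 0" by algebra
  then have "r2 = 0" using beta_distinct by simp
  then show ?thesis using * x r by simp
qed

lemma OK_Rats: assumes "x \<in> OK" "x \<in> \<rat>" shows "x \<in> \<int>"
proof -
  obtain u v where x: "x = u + \<alpha> * v" "u \<in> OL" "v \<in> OL"
    using assms(1) by (auto simp: sextic_span_def)
  obtain r0 r1 r2 where u: "u = r0 + r1 * \<alpha>^2 + r2 * \<alpha>^4" "r0 \<in> \<int>" "r1 \<in> \<int>" "r2 \<in> \<int>"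
    using x unfolding cubic_span_def by blast
  have "u = x"
    using sextic_span_unique(1)[OF OL_subset_L[OF x(2)] OL_subset_L[OF x(3)] cubic_span_base[OF int_closed_Rats assms(2)] L_closed(2)] x(1)
    by simp
  then have "r0 + r1 * \<alpha>^2 + r2 * \<alpha>^4 = x + 0 * \<alpha>^2 + 0 * \<alpha>^4" using u by simp
  moreover have "r0 \<in> \<rat>" "r1 \<in> \<rat>" "r2 \<in> \<rat>" using u Ints_subset_Rats by auto
  ultimately have "r0 = x" using cubic_span_unique(1)[of r0 r1 r2 x 0 0] assms(2) by simp
  then show ?thesis using u by simp
qed

lemma OK_fixed:
  assumes "x \<in> OK" "\<sigma> x = x" obtains n where "x = of_int n"
  using OK_Rats[OF assms(1) fixed_Rats[OF OK_subset_K[OF assms(1)] assms(2)]] by (elim Ints_cases)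

lemma beta_OL: "\<alpha>^2 \<in> OL" by (rule alpha_sq_cubic_span[OF int_closed_Ints])
lemma alpha_OK: "\<alpha> \<in> OK" by (rule alpha_sextic_span[OF int_closed_Ints])

end

lemma (in sextic_root) cyclic_sextic_exists:
  assumes "Gal_cyclic_of_order (sextic a b c) 6"
  obtains \<sigma> where "cyclic_sextic a b c \<alpha> \<sigma>"
proof (rule cyclic_structure[OF assms])
  fix \<sigma> assume "hom_on K \<sigma>" "\<And>x. x \<in> K \<Longrightarrow> \<sigma> x \<in> K" "\<sigma> (\<sigma> (\<sigma> \<alpha>)) = - \<alpha>"
    "\<alpha>^2 \<noteq> (\<sigma> \<alpha>)^2" "\<alpha>^2 \<noteq> (\<sigma> (\<sigma> \<alpha>))^2" "(\<sigma> \<alpha>)^2 \<noteq> (\<sigma> (\<sigma> \<alpha>))^2"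
  then have "cyclic_sextic a b c \<alpha> \<sigma>" by unfold_locales
  then show thesis by (rule that)
qed

section \<open>Coefficients of a monogenic sextic\<close>

context cyclic_sextic
begin

lemma OL_coeffs:
  assumes "r0 \<in> \<rat>" "r1 \<in> \<rat>" "r2 \<in> \<rat>" "r0 + r1 * \<alpha>^2 + r2 * \<alpha>^4 \<in> OL"
  shows "r0 \<in> \<int>" "r1 \<in> \<int>" "r2 \<in> \<int>"
proof -
  obtain s0 s1 s2 where s: "r0 + r1 * \<alpha>^2 + r2 * \<alpha>^4 = s0 + s1 * \<alpha>^2 + s2 * \<alpha>^4" "s0 \<in> \<int>" "s1 \<in> \<int>" "s2 \<in> \<int>"
    using assms(4) unfolding cubic_span_def by blast
  then have "s0 \<in> \<rat>" "s1 \<in> \<rat>" "s2 \<in> \<rat>" using Ints_subset_Rats by auto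
  then show "r0 \<in> \<int>" "r1 \<in> \<int>" "r2 \<in> \<int>" using cubic_span_unique[OF assms(1-3) _ _ _ s(1)] s by auto
qed

lemma OK_parts:
  assumes "u \<in> L" "v \<in> L" "u + \<alpha> * v \<in> OK" shows "u \<in> OL" "v \<in> OL"
proof -
  obtain u' v' where "u + \<alpha> * v = u' + \<alpha> * v'" "u' \<in> OL" "v' \<in> OL"
    using assms(3) by (auto simp: sextic_span_def)
  then show "u \<in> OL" "v \<in> OL" using sextic_span_unique[of u v u' v'] assms OL_subset_L by auto
qed

lemma c_nonzero: "c \<noteq> 0"
proof -
  have "\<alpha>1 \<noteq> 0" using eq_0[OF alpha_K(1)] alpha_nonzero by auto
  moreover have "\<alpha>2 \<noteq> 0" using eq_0[OF alpha_K(2)] calculation by auto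
  ultimately show ?thesis using vieta(3) alpha_nonzero by auto
qed

lemma OL_obtain_int:
  assumes "y \<in> OL" obtains y0 y1 y2 :: int where "y = of_int y0 + of_int y1 * \<alpha>^2 + of_int y2 * \<alpha>^4"
  using assms unfolding cubic_span_def by (auto elim!: Ints_cases)

lemma OL_unique:
  assumes "of_int r0 + of_int r1 * \<alpha>^2 + of_int r2 * \<alpha>^4 = of_int s0 + of_int s1 * \<alpha>^2 + of_int s2 * \<alpha>^4"
  shows "r0 = s0" "r1 = s1" "r2 = s2"
  using cubic_span_unique[OF _ _ _ _ _ _ assms] by simp_all

text \<open>Modulo \<alpha>^2 the order \<int>[\<alpha>^2] becomes \<int>/c: in \<alpha>^2 y only
  the reduction of \<alpha>^6 contributes a constant term.\<close>

lemma beta_dvd_const: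
  assumes "y \<in> OL" "\<alpha>^2 * y = of_int r0 + of_int r1 * \<alpha>^2 + of_int r2 * \<alpha>^4"
  shows "c dvd r0"
proof -
  obtain y0 y1 y2 :: int where y: "y = of_int y0 + of_int y1 * \<alpha>^2 + of_int y2 * \<alpha>^4"
    using assms(1) by (rule OL_obtain_int)
  have "\<alpha>^2 * y = of_int (- (c * y2)) + of_int (y0 - b * y2) * \<alpha>^2 + of_int (y1 - a * y2) * \<alpha>^4"
    unfolding y using root by simp algebra
  from OL_unique(1)[OF this[unfolded assms(2)]] show ?thesis by simp
qed

lemma sigma_OK:
  assumes "\<alpha>1 \<in> OK" "x \<in> OK" shows "\<sigma> x \<in> OK"
proof -
  obtain u v where x: "x = u + \<alpha> * v" "u \<in> OL" "v \<in> OL" using assms(2) by (auto simp: sextic_span_def)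
  have OL: "\<sigma> y \<in> OK" if "y \<in> OL" for y
  proof -
    obtain r0 r1 r2 where r: "y = r0 + r1 * \<alpha>^2 + r2 * \<alpha>^4" "r0 \<in> \<int>" "r1 \<in> \<int>" "r2 \<in> \<int>"
      using \<open>y \<in> OL\<close> unfolding cubic_span_def by blast
    have rat: "r0 \<in> \<rat>" "r1 \<in> \<rat>" "r2 \<in> \<rat>" using r Ints_subset_Rats by auto
    have "r0 \<in> OK" "r1 \<in> OK" "r2 \<in> OK" using r OK_closed(1) by (auto elim!: Ints_cases)
    then show ?thesis unfolding r(1) sigma_L[OF rat alpha_K(1)] using assms(1) by (simp add: OK_closed)
  qed
  have "\<sigma> x = \<sigma> u + \<alpha>1 * \<sigma> v"
    using x by (simp add: add mult K_closed alpha_K L_subset_K OL_subset_L)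
  then show ?thesis using OL x assms(1) by (simp add: OK_closed)
qed

text \<open>The factor \<mu> is the divided difference of the quadratic polynomial in \<alpha>^2
  that represents z; applying \<sigma> gives the other two identities.\<close>

lemma difference_quotient:
  assumes "z \<in> OL" "\<alpha>1 \<in> OK"
  obtains \<mu> where "\<mu> \<in> OK" "z - \<sigma> z = (\<alpha>^2 - \<alpha>1^2) * \<mu>"
    "\<sigma> z - \<sigma> (\<sigma> z) = (\<alpha>1^2 - \<alpha>2^2) * \<sigma> \<mu>" "\<sigma> (\<sigma> z) - z = (\<alpha>2^2 - \<alpha>^2) * \<sigma> (\<sigma> \<mu>)"
proof -
  obtain r0 r1 r2 where r: "z = r0 + r1 * \<alpha>^2 + r2 * \<alpha>^4" "r0 \<in> \<int>" "r1 \<in> \<int>" "r2 \<in> \<int>"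
    using assms(1) unfolding cubic_span_def by blast
  have rat: "r0 \<in> \<rat>" "r1 \<in> \<rat>" "r2 \<in> \<rat>" using r Ints_subset_Rats by auto
  have rK: "r1 \<in> K" "r2 \<in> K" using subfield_Rats[OF sextic_span_rat_subfield] rat by auto
  have "r1 \<in> OK" "r2 \<in> OK" using r OK_closed(1) by (auto elim!: Ints_cases)
  then have 0: "r1 + r2 * (\<alpha>^2 + \<alpha>1^2) \<in> OK" using assms(2) alpha_OK by (simp add: OK_closed)
  have z1: "\<sigma> z = r0 + r1 * \<alpha>1^2 + r2 * \<alpha>1^4" using sigma_L[OF rat alpha_K(1)] r by simp
  have z2: "\<sigma> (\<sigma> z) = r0 + r1 * \<alpha>2^2 + r2 * \<alpha>2^4" using sigma_L[OF rat alpha_K(2)] z1 by simp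
  have m1: "\<sigma> (r1 + r2 * (\<alpha>^2 + \<alpha>1^2)) = r1 + r2 * (\<alpha>1^2 + \<alpha>2^2)"
    using rK alpha_K rat by (simp add: add mult power K_closed Rats)
  have m2: "\<sigma> (r1 + r2 * (\<alpha>1^2 + \<alpha>2^2)) = r1 + r2 * (\<alpha>2^2 + \<alpha>^2)"
    using rK alpha_K rat by (simp add: add mult power K_closed Rats)
  show thesis
    by (rule that[OF 0]) (unfold m1 m2, unfold z2, unfold z1, simp_all add: r algebra_simps flip: power_add)
qed

end

section \<open>Consequences of monogenicity\<close>

locale monogenic_cyclic_sextic = cyclic_sextic +
  assumes alg_int_OK: "z \<in> K \<Longrightarrow> alg_int z \<Longrightarrow> z \<in> OK" and OK_alg_int: "z \<in> OK \<Longrightarrow> alg_int z"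
begin

lemma sqrt_OK: assumes "z \<in> K" "z\<^sup>2 \<in> OK" shows "z \<in> OK"
proof -
  have "algebraic_int z"
    by (rule algebraic_int_root[where p = "monom 1 2"])
      (use OK_alg_int[OF assms(2)] in \<open>auto simp: alg_int_iff poly_monom degree_monom_eq coeff_monom\<close>)
  then show ?thesis using alg_int_OK assms(1) by (simp add: alg_int_iff)
qed

text \<open>Let q = \<alpha>^4 + a \<alpha>^2 + b, so \<alpha>^2 q = -c. If c = k^2 m, then \<alpha>
  q / k has the integral square -m q and must lie in \<int>[\<alpha>], but one of its coordinates is
  1/k.\<close>

lemma c_squarefree: assumes "k * k dvd c" shows "k dvd 1"
proof -
  obtain m where m: "c = k * k * m" using assms by (elim dvdE)
  have k0: "k \<noteq> 0" using c_nonzero m by auto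
  define v :: complex where "v = of_int b / of_int k + (of_int a / of_int k) * \<alpha>^2 + (1 / of_int k) * \<alpha>^4"
  have vL: "v \<in> L" unfolding v_def by (intro cubic_span_I Rats_divide) simp_all
  have vk: "of_int k * v = \<alpha>^4 + of_int a * \<alpha>^2 + of_int b" using k0 by (simp add: v_def field_simps)
  have "of_int k^2 * (\<alpha> * v)^2 = \<alpha>^2 * (\<alpha>^4 + of_int a * \<alpha>^2 + of_int b) * (\<alpha>^4 + of_int a * \<alpha>^2 + of_int b)"
    unfolding vk[symmetric] by (simp add: power2_eq_square)
  also have "\<dots> = (\<alpha>^6 + of_int a * \<alpha>^4 + of_int b * \<alpha>^2) * (\<alpha>^4 + of_int a * \<alpha>^2 + of_int b)"
    by (simp add: algebra_simps flip: power_add)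
  also have "\<dots> = of_int k^2 * (- of_int m * (\<alpha>^4 + of_int a * \<alpha>^2 + of_int b))"
    unfolding root6 by (simp add: m algebra_simps power2_eq_square)
  finally have "(of_int k)^2 * (\<alpha> * v)^2 = (of_int k)^2 * (- of_int m * (\<alpha>^4 + of_int a * \<alpha>^2 + of_int b))" .
  then have "(\<alpha> * v)^2 = - of_int m * (\<alpha>^4 + of_int a * \<alpha>^2 + of_int b)"
    unfolding mult_cancel_left using k0 by simp
  also have "\<dots> \<in> OK" using alpha_OK by (simp add: OK_closed)
  finally have sq: "(\<alpha> * v)^2 \<in> OK" .
  have "\<alpha> * v \<in> K" using alpha_K(1) L_subset_K[OF vL] by (rule K_closed(7))
  then have "\<alpha> * v \<in> OK" using sq by (rule sqrt_OK)
  then have "v \<in> OL" using OK_parts(2)[OF L_closed(2) vL] by simp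
  then have "1 / of_int k \<in> (\<int> :: complex set)"
    using OL_coeffs(3)[of "of_int b / of_int k" "of_int a / of_int k" "1 / of_int k"] by (simp add: v_def)
  then obtain j where "1 / of_int k = (of_int j :: complex)" by (elim Ints_cases)
  then have "of_int (k * j) = (1 :: complex)" using k0 by (simp add: field_simps)
  then have "k * j = 1" using of_int_eq_1_iff by blast
  then show ?thesis by (metis dvd_triv_left)
qed

lemma alpha12_OK: "\<alpha>1 \<in> OK" "\<alpha>2 \<in> OK"
proof -
  have "alg_int z" if "z^6 + of_int a * z^4 + of_int b * z^2 + of_int c = 0" for z
    unfolding alg_int_def by (rule exI[of _ "sextic a b c"]) (use that in \<open>simp add: poly_of_int_sextic[unfolded map_poly_pCons]\<close>)
  then show "\<alpha>1 \<in> OK" "\<alpha>2 \<in> OK" using roots alpha_K alg_int_OK by blast+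
qed

lemmas sigma_in_OK = sigma_OK[OF alpha12_OK(1)]

text \<open>The cube of \<sigma> negates \<alpha>1, so \<alpha>1 has no even part and is \<alpha>
  times an element of \<open>OL\<close>. Going once around the cycle, from \<alpha> to -\<alpha>,
  gives the product -1.\<close>

lemma units:
  obtains k0 k1 k2 where "k0 \<in> OL" "k1 \<in> OL" "k2 \<in> OL" "\<alpha>1 = \<alpha> * k0" "\<alpha>2 = \<alpha> * k0 * k1" "k0 * k1 * k2 = -1"
proof -
  obtain u k where x: "\<alpha>1 = u + \<alpha> * k" "u \<in> OL" "k \<in> OL" using alpha12_OK by (auto simp: sextic_span_def)
  have "- \<alpha>1 = \<sigma> (\<sigma> (\<sigma> \<alpha>1))" using alpha_K by (simp add: minus)
  also have "\<dots> = u - \<alpha> * k" using x sigma3_K OL_subset_L by simp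
  finally have "2 * u = 0" using x(1) by algebra
  then have x1: "\<alpha>1 = \<alpha> * k" using x by simp
  define k1 k2 where "k1 = \<sigma> k" and "k2 = \<sigma> k1"
  have kK: "k \<in> K" using x OL_subset_L L_subset_K by blast
  have k3: "\<sigma> k2 = k" using x sigma3_L OL_subset_L by (simp add: k1_def k2_def)
  have "k \<in> OK" using x OL_subset_O by simp
  then have "k1 \<in> OK" "k2 \<in> OK" unfolding k2_def k1_def by (auto intro: sigma_in_OK)
  then have kOL: "k1 \<in> OL" "k2 \<in> OL" using k3 by (auto intro!: fixed3_OL simp: k1_def k2_def)
  have x2: "\<alpha>2 = \<alpha>1 * k1" using arg_cong[OF x1, of \<sigma>] kK alpha_K by (simp add: mult k1_def)
  have x3: "- \<alpha> = \<alpha>2 * k2" using arg_cong[OF x2, of \<sigma>] kK alpha_K by (simp add: mult k1_def k2_def into)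
  have "\<alpha> * (k * k1 * k2 + 1) = 0" using x1 x2 x3 by algebra
  then have "k * k1 * k2 = -1" using alpha_nonzero by (simp add: eq_neg_iff_add_eq_0)
  then show thesis using that[of k k1 k2] x kOL x1 x2 by simp
qed

lemma alpha_pow6_associate: obtains w where "w \<in> OL" "\<alpha>^6 = - of_int c * w"
proof -
  obtain k0 k1 k2 where k: "k0 \<in> OL" "k1 \<in> OL" "k2 \<in> OL" "\<alpha>1 = \<alpha> * k0" "\<alpha>2 = \<alpha> * k0 * k1" "k0 * k1 * k2 = -1"
    using units .
  \<comment> \<open>The product of the three squares is \<alpha>^6 k0^4 k1^2 = -c, and k0 k1 k2 = -1
    makes (k1 k2^2)^2 the inverse of k0^4 k1^2.\<close>
  have "\<alpha>^6 = - of_int c * (k1 * k2^2)^2"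
    using vieta(3) k(6) unfolding k(4,5) by algebra
  moreover have "(k1 * k2^2)^2 \<in> OL" using k by (simp add: OL_closed)
  ultimately show thesis using that by blast
qed

text \<open>The element \<gamma> = \<alpha> \<alpha>1 \<alpha>2 is a square root of -c. If -c were 1
  modulo 4, then (1 + \<gamma>)/2 would be integral although its even part is 1/2.\<close>

lemma c_mod_4: "c mod 4 \<noteq> 3"
proof
  assume "c mod 4 = 3"
  then have "\<exists>m. - c = 4 * m + 1" by presburger
  then obtain m where m: "- c = 4 * m + 1" ..
  define \<gamma> where "\<gamma> = \<alpha> * (\<alpha>1 * \<alpha>2)"
  have "\<gamma>^2 = of_int (- c)" using vieta(3) by (simp add: \<gamma>_def power_mult_distrib mult.assoc)
  then have \<gamma>: "\<gamma>^2 = 4 * of_int m + 1" by (simp only: m) simp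
  have "((1 + \<gamma>) / 2)^2 - (1 + \<gamma>) / 2 - of_int m = 0"
    using \<gamma> by (simp add: power2_eq_square field_simps)
  then have "alg_int ((1 + \<gamma>) / 2)"
    unfolding alg_int_def by (intro exI[of _ "[:- m, -1, 1:]"]) (simp add: map_poly_pCons power2_eq_square algebra_simps)
  moreover have "(1 + \<gamma>) / 2 \<in> K"
    unfolding \<gamma>_def using alpha_K by (intro subfield_divide[OF sextic_span_rat_subfield]) (simp_all add: K_closed)
  ultimately have *: "(1 + \<gamma>) / 2 \<in> OK" by (rule alg_int_OK[rotated])
  have "\<alpha>1 * \<alpha>2 \<in> L"
    by (rule fixed3_L) (use alpha_K in \<open>simp_all add: K_closed mult minus\<close>)
  moreover have half: "(1 / 2 :: complex) \<in> L" by (rule cubic_span_base[OF int_closed_Rats]) simp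
  ultimately have prod: "\<alpha>1 * \<alpha>2 * (1 / 2) \<in> L" by (rule L_closed(7))
  have "1 / 2 + \<alpha> * (\<alpha>1 * \<alpha>2 * (1 / 2)) \<in> OK" using * by (simp add: \<gamma>_def add_divide_distrib)
  then have "(1 / 2 :: complex) \<in> OL" by (rule OK_parts(1)[OF half prod])
  then have "1 / 2 \<in> (\<int> :: complex set)" using OL_coeffs(1)[of "1/2" 0 0] by simp
  then obtain j where "1 / 2 = (of_int j :: complex)" by (elim Ints_cases)
  then have "of_int 1 = (of_int (2 * j) :: complex)" by (simp add: field_simps)
  then have "1 = 2 * j" using of_int_eq_iff by blast
  then show False by presburger
qed

end

context monogenic_cyclic_sextic
begin

text \<open>The conjugates of \<open>x = - \<sigma>(\<alpha>) \<sigma>\<^sup>2(\<alpha>)\<close>; the sign makes their product equal to \<open>d\<close>.\<close>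

definition "d = - c"
definition "X0 = - \<alpha>1 * \<alpha>2"
definition "X1 = \<alpha> * \<alpha>2"
definition "X2 = - \<alpha> * \<alpha>1"

lemma sigma_X: "\<sigma> X0 = X1" "\<sigma> X1 = X2" "\<sigma> X2 = X0"
  using alpha_K by (simp_all add: X0_def X1_def X2_def mult minus K_closed)

lemma X_OK: "X0 \<in> OK" "X1 \<in> OK" "X2 \<in> OK"
  using alpha12_OK alpha_OK by (simp_all add: X0_def X1_def X2_def OK_closed)

lemma X_OL: "X0 \<in> OL" "X1 \<in> OL" "X2 \<in> OL"
  using X_OK by (auto intro!: fixed3_OL simp: sigma_X)

lemma X_prod: "X0 * X1 * X2 = of_int d"
  using vieta(3) unfolding X0_def X1_def X2_def d_def of_int_minus by algebra

lemma d_nonzero: "d \<noteq> 0"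
  using c_nonzero by (simp add: d_def)

lemma X_beta: "X0^2 * \<alpha>^2 = of_int d" "X1^2 * \<alpha>1^2 = of_int d" "X2^2 * \<alpha>2^2 = of_int d"
  using vieta(3) unfolding X0_def X1_def X2_def d_def of_int_minus by algebra+

text \<open>Each of the three is, up to sign, a product of two conjugates of \<alpha>, which are
  associates of \<alpha>.\<close>

lemma X_div_beta:
  obtains y0 y1 y2 where "y0 \<in> OL" "y1 \<in> OL" "y2 \<in> OL" "X0 = \<alpha>^2 * y0" "X1 = \<alpha>^2 * y1" "X2 = \<alpha>^2 * y2"
proof -
  obtain k0 k1 k2 where k: "k0 \<in> OL" "k1 \<in> OL" "k2 \<in> OL" "\<alpha>1 = \<alpha> * k0" "\<alpha>2 = \<alpha> * k0 * k1" "k0 * k1 * k2 = -1"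
    using units .
  show thesis
    by (rule that[of "- (k0^2 * k1)" "k0 * k1" "- k0"])
      (use k in \<open>simp_all add: OL_closed X0_def X1_def X2_def power2_eq_square\<close>)
qed

text \<open>Both symmetric functions are rational integers and multiples of \<alpha>^2 in
  \<open>OL\<close>, hence divisible by c by \<open>beta_dvd_const\<close>.\<close>

lemma d_dvd_symmetric:
  obtains s t where "X0 + X1 + X2 = of_int (d * t)" "X0 * X1 + X1 * X2 + X2 * X0 = of_int (d * s)"
proof -
  obtain y0 y1 y2 where y: "y0 \<in> OL" "y1 \<in> OL" "y2 \<in> OL" "X0 = \<alpha>^2 * y0" "X1 = \<alpha>^2 * y1" "X2 = \<alpha>^2 * y2"
    using X_div_beta .
  have XK: "X0 \<in> K" "X1 \<in> K" "X2 \<in> K" using X_OK OK_subset_K by auto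
  have OK: "X0 + X1 + X2 \<in> OK" "X0 * X1 + X1 * X2 + X2 * X0 \<in> OK" using X_OK by (simp_all add: OK_closed)
  have "\<sigma> (X0 + X1 + X2) = X0 + X1 + X2" using XK by (simp add: add sigma_X K_closed)
  then obtain S where S: "X0 + X1 + X2 = of_int S" using OK_fixed OK by blast
  have "\<sigma> (X0 * X1 + X1 * X2 + X2 * X0) = X0 * X1 + X1 * X2 + X2 * X0"
    using XK by (simp add: add mult sigma_X K_closed)
  then obtain T where T: "X0 * X1 + X1 * X2 + X2 * X0 = of_int T" using OK_fixed OK by blast
  have "\<alpha>^2 * (y0 + y1 + y2) = of_int S + of_int 0 * \<alpha>^2 + of_int 0 * \<alpha>^4"
    unfolding S[symmetric] y(4-6) by (simp add: algebra_simps)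
  then have "c dvd S" using beta_dvd_const[of "y0 + y1 + y2" S 0 0] y by (simp add: OL_closed)
  moreover have "\<alpha>^2 * (y0 * X1 + y1 * X2 + y2 * X0) = of_int T + of_int 0 * \<alpha>^2 + of_int 0 * \<alpha>^4"
    unfolding T[symmetric] y(4-6) by (simp add: algebra_simps)
  then have "c dvd T" using beta_dvd_const[of "y0 * X1 + y1 * X2 + y2 * X0" T 0 0] y(1-3) X_OL by (simp add: OL_closed)
  ultimately have "d dvd S" "d dvd T" by (simp_all add: d_def)
  then obtain t s where "S = d * t" "T = d * s" by (elim dvdE)
  then show thesis using that[of t s] S T by simp
qed

end

section \<open>The cubic polynomial of \<open>X0\<close>: index and discriminant\<close>

locale resolvent = monogenic_cyclic_sextic +
  fixes s t :: int
  assumes X_sum: "X0 + X1 + X2 = of_int (d * t)" and X_sum2: "X0 * X1 + X1 * X2 + X2 * X0 = of_int (d * s)"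
begin

text \<open>Both are sums of squares: d \<alpha>^2 = (X1 X2)^2 gives a, and X0^2 = \<alpha>1^2
  \<alpha>2^2 gives b, each together with its conjugates.\<close>

lemma ab_eq: "a = c * s^2 - 2 * c * t" "b = d^2 * t^2 - 2 * d * s"
proof -
  have "of_int d * (\<alpha>^2 + \<alpha>1^2 + \<alpha>2^2) = (X1 * X2)^2 + (X2 * X0)^2 + (X0 * X1)^2"
    using vieta(3) unfolding X0_def X1_def X2_def d_def of_int_minus by algebra
  also have "\<dots> = (of_int (d * s))^2 - 2 * of_int (d * t) * of_int d"
    unfolding X_sum[symmetric] X_sum2[symmetric] X_prod[symmetric] by algebra
  finally have "(of_int (d * (- a)) :: complex) = of_int ((d * s)^2 - 2 * (d * t) * d)"
    unfolding vieta by simp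
  then have "d * (- a) = (d * s)^2 - 2 * (d * t) * d" using of_int_eq_iff by blast
  also have "\<dots> = d * (d * s^2 - 2 * d * t)" by (simp add: power2_eq_square algebra_simps)
  finally have "- a = d * s^2 - 2 * d * t" unfolding mult_cancel_left using d_nonzero by simp
  then show "a = c * s^2 - 2 * c * t" by (simp add: d_def)
  have "of_int b = X0^2 + X1^2 + X2^2"
    unfolding vieta(2)[symmetric] X0_def X1_def X2_def by algebra
  also have "\<dots> = (of_int (d * t))^2 - 2 * of_int (d * s)"
    unfolding X_sum[symmetric] X_sum2[symmetric] by algebra
  also have "\<dots> = of_int (d^2 * t^2 - 2 * d * s)" by (simp add: power_mult_distrib)
  finally show "b = d^2 * t^2 - 2 * d * s" using of_int_eq_iff by blast
qed

text \<open>Here \<rho> compares differences of conjugates of \<open>X0\<close> and of \<alpha>^2,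
  and n is its norm. Since \<alpha>^2 = d / X0^2, these differences are also related the other way
  round. Multiplying the three relations involves the product of the sums Xi + Xj, which is d^2 s t
  - d.\<close>

lemma index_unit:
  obtains \<rho> n where "\<rho> \<in> OK" "X0 - X1 = (\<alpha>^2 - \<alpha>1^2) * \<rho>" "X1 - X2 = (\<alpha>1^2 - \<alpha>2^2) * \<sigma> \<rho>"
    "X2 - X0 = (\<alpha>2^2 - \<alpha>^2) * \<sigma> (\<sigma> \<rho>)" "\<rho> * \<sigma> \<rho> * \<sigma> (\<sigma> \<rho>) = of_int n" "n * (1 - d * s * t) = 1"
proof -
  obtain \<rho> where \<rho>: "\<rho> \<in> OK" "X0 - X1 = (\<alpha>^2 - \<alpha>1^2) * \<rho>" "X1 - X2 = (\<alpha>1^2 - \<alpha>2^2) * \<sigma> \<rho>"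
    "X2 - X0 = (\<alpha>2^2 - \<alpha>^2) * \<sigma> (\<sigma> \<rho>)"
    using difference_quotient[OF X_OL(1) alpha12_OK(1)] unfolding sigma_X by metis
  have nz: "\<alpha>^2 - \<alpha>1^2 \<noteq> 0" "\<alpha>1^2 - \<alpha>2^2 \<noteq> 0" "\<alpha>2^2 - \<alpha>^2 \<noteq> 0" using beta_distinct by auto
  have \<rho>K: "\<rho> \<in> K" "\<sigma> \<rho> \<in> K" "\<sigma> (\<sigma> \<rho>) \<in> K" using \<rho>(1) OK_subset_K into by auto
  have "X0 - X1 = \<sigma> (X2 - X0)" using sigma_X X_OK by (simp add: diff OK_subset_K)
  also have "\<dots> = (\<alpha>^2 - \<alpha>1^2) * \<sigma> (\<sigma> (\<sigma> \<rho>))"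
    unfolding \<rho>(4) using \<rho>K alpha_K by (simp add: mult diff power K_closed)
  finally have \<rho>3: "\<sigma> (\<sigma> (\<sigma> \<rho>)) = \<rho>" using nz unfolding \<rho>(2) by simp
  have "\<rho> * \<sigma> \<rho> * \<sigma> (\<sigma> \<rho>) \<in> OK" using \<rho>(1) by (simp add: OK_closed sigma_in_OK)
  moreover have "\<sigma> (\<rho> * \<sigma> \<rho> * \<sigma> (\<sigma> \<rho>)) = \<rho> * \<sigma> \<rho> * \<sigma> (\<sigma> \<rho>)"
    using \<rho>K by (simp add: mult K_closed \<rho>3)
  ultimately obtain n where n: "\<rho> * \<sigma> \<rho> * \<sigma> (\<sigma> \<rho>) = of_int n" using OK_fixed by blast
  \<comment> \<open>With x = d/A^2 and y = d/B^2, the difference x - y is -d (A - B)(A + B)/(A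
    B)^2.\<close>
  have key: "(A * B)^2 = - of_int d * r * (A + B)"
    if "A^2 * x = of_int d" "B^2 * y = of_int d" "A - B = (x - y) * r" "x - y \<noteq> 0" for A B x y r :: complex
  proof -
    have "(x - y) * (A * B)^2 = (A^2 * x) * B^2 - (B^2 * y) * A^2" by algebra
    also have "\<dots> = - of_int d * ((A - B) * (A + B))" unfolding that(1,2) by algebra
    also have "\<dots> = (x - y) * (- of_int d * r * (A + B))" unfolding that(3) by algebra
    finally show ?thesis unfolding mult_cancel_left using that(4) by simp
  qed
  have "(X0 * X1)^2 * (X1 * X2)^2 * (X2 * X0)^2 =
      (- of_int d * \<rho> * (X0 + X1)) * (- of_int d * \<sigma> \<rho> * (X1 + X2)) * (- of_int d * \<sigma> (\<sigma> \<rho>) * (X2 + X0))"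
    using key[OF X_beta(1,2) \<rho>(2) nz(1)] key[OF X_beta(2,3) \<rho>(3) nz(2)] key[OF X_beta(3,1) \<rho>(4) nz(3)] by simp
  also have "(X0 * X1)^2 * (X1 * X2)^2 * (X2 * X0)^2 = (X0 * X1 * X2)^4" by algebra
  also have "(- of_int d * \<rho> * (X0 + X1)) * (- of_int d * \<sigma> \<rho> * (X1 + X2)) * (- of_int d * \<sigma> (\<sigma> \<rho>) * (X2 + X0)) =
      - (of_int d ^ 3) * (\<rho> * \<sigma> \<rho> * \<sigma> (\<sigma> \<rho>)) * ((X0 + X1 + X2) * (X0 * X1 + X1 * X2 + X2 * X0) - X0 * X1 * X2)"
    by algebra
  finally have "(of_int (d^4) :: complex) = of_int (- (d ^ 3) * n * (d * t * (d * s) - d))"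
    unfolding X_prod n X_sum X_sum2 by simp
  then have "d^4 = - (d ^ 3) * n * (d * t * (d * s) - d)" using of_int_eq_iff by blast
  then have "d^4 * (n * (1 - d * s * t)) = d^4 * 1" by algebra
  then have "n * (1 - d * s * t) = 1" using d_nonzero by simp
  then show thesis using that \<rho> n by blast
qed

definition "\<delta> = (X0 - X1) * (X1 - X2) * (X2 - X0)"

text \<open>Up to the sign n, \<delta> is the product of the three differences of conjugates of
  \<alpha>^2, and these are associates of each other.\<close>

lemma theta_cube: obtains w where "w \<in> OK" "(\<alpha>^2 - \<alpha>1^2)^3 = \<delta> * w"
proof -
  obtain \<rho> n where \<rho>: "\<rho> \<in> OK" "X0 - X1 = (\<alpha>^2 - \<alpha>1^2) * \<rho>" "X1 - X2 = (\<alpha>1^2 - \<alpha>2^2) * \<sigma> \<rho>"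
    "X2 - X0 = (\<alpha>2^2 - \<alpha>^2) * \<sigma> (\<sigma> \<rho>)" and n: "\<rho> * \<sigma> \<rho> * \<sigma> (\<sigma> \<rho>) = of_int n" "n * (1 - d * s * t) = 1"
    using index_unit .
  have "n = 1 \<or> n = -1" using n(2) by (metis dvd_triv_left zdvd1_eq abs_eq_iff')
  then have "n^2 = 1" by auto
  then have n1: "(of_int n)^2 = (1 :: complex)" by (metis of_int_1 of_int_power)
  have "\<alpha>1^2 \<in> OL" by (rule fixed3_OL) (use alpha12_OK in \<open>simp_all add: OK_closed sigma_beta\<close>)
  from difference_quotient[OF this alpha12_OK(1)]
  obtain \<kappa> where "\<kappa> \<in> OK" "\<alpha>1^2 - \<sigma> (\<alpha>1^2) = (\<alpha>^2 - \<alpha>1^2) * \<kappa>"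
    "\<sigma> (\<alpha>1^2) - \<sigma> (\<sigma> (\<alpha>1^2)) = (\<alpha>1^2 - \<alpha>2^2) * \<sigma> \<kappa>"
    "\<sigma> (\<sigma> (\<alpha>1^2)) - \<alpha>1^2 = (\<alpha>2^2 - \<alpha>^2) * \<sigma> (\<sigma> \<kappa>)" .
  note \<kappa> = this[unfolded sigma_beta]
  define k1 k2 where "k1 = \<sigma> \<kappa>" and "k2 = \<sigma> (\<sigma> \<kappa>)"
  define x y z where "x = \<alpha>^2 - \<alpha>1^2" and "y = \<alpha>1^2 - \<alpha>2^2" and "z = \<alpha>2^2 - \<alpha>^2"
  define r0 r1 r2 where "r0 = \<rho>" and "r1 = \<sigma> \<rho>" and "r2 = \<sigma> (\<sigma> \<rho>)"
  have x0: "x \<noteq> 0" using beta_distinct(1) by (simp add: x_def)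
  have xyz: "y = x * \<kappa>" "z = y * k1" "x = z * k2"
    using \<kappa> by (simp_all add: x_def y_def z_def k1_def k2_def)
  have "x * (\<kappa> * k1 * k2 - 1) = 0" using xyz by algebra
  then have u: "\<kappa> * k1 * k2 = 1" using x0 by simp
  have \<delta>: "\<delta> = (x * r0) * (y * r1) * (z * r2)"
    unfolding \<delta>_def \<rho> x_def y_def z_def r0_def r1_def r2_def by simp
  \<comment> \<open>By \<open>xyz\<close>, \<delta> is x^3 times the unit n \<kappa>^2 k1, whose
    inverse is n k1 k2^2.\<close>
  have "\<delta> * (of_int n * k1 * k2^2) = x^3 * (r0 * r1 * r2) * of_int n * (\<kappa> * k1 * k2)^2"
    unfolding \<delta> xyz(2) xyz(1) by algebra
  also have "\<dots> = x^3" using n(1) n1 unfolding u by (simp add: r0_def r1_def r2_def power2_eq_square)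
  finally have "(\<alpha>^2 - \<alpha>1^2)^3 = \<delta> * (of_int n * k1 * k2^2)" by (simp add: x_def)
  moreover have "of_int n * k1 * k2^2 \<in> OK" using \<kappa>(1) by (simp add: k1_def k2_def OK_closed sigma_in_OK)
  ultimately show thesis using that by blast
qed

text \<open>A cyclic permutation of the three conjugates preserves \<delta>, so \<delta> is an
  integer; its square is the discriminant of y^3 - d t y^2 + d s y - d, which contains the factor
  d^2.\<close>

lemma discriminant:
  obtains D where "\<delta> = of_int (d * D)"
    "D^2 = d^2 * s^2 * t^2 - 4 * d * s^3 - 4 * d^2 * t^3 + 18 * d * s * t - 27"
proof -
  have "\<delta> \<in> OK" using X_OK by (simp add: \<delta>_def OK_closed)
  moreover have "\<sigma> \<delta> = \<delta>" unfolding \<delta>_def using X_OK[THEN OK_subset_K] by (simp add: mult diff sigma_X K_closed)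
  ultimately obtain m where m: "\<delta> = of_int m" using OK_fixed by blast
  have *: "((x - y) * (y - z) * (z - x))^2 = (x + y + z)^2 * (x * y + y * z + z * x)^2 - 4 * (x * y + y * z + z * x)^3
     - 4 * (x + y + z)^3 * (x * y * z) + 18 * (x + y + z) * (x * y + y * z + z * x) * (x * y * z) - 27 * (x * y * z)^2"
    for x y z :: complex by algebra
  have "\<delta>^2 = of_int ((d * t)^2 * (d * s)^2 - 4 * (d * s)^3 - 4 * (d * t)^3 * d + 18 * (d * t) * (d * s) * d - 27 * d^2)"
    unfolding \<delta>_def * X_sum X_sum2 X_prod by simp
  then have "of_int (m^2) = (of_int ((d * t)^2 * (d * s)^2 - 4 * (d * s)^3 - 4 * (d * t)^3 * d + 18 * (d * t) * (d * s) * d - 27 * d^2) :: complex)"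
    unfolding m by simp
  then have "m^2 = (d * t)^2 * (d * s)^2 - 4 * (d * s)^3 - 4 * (d * t)^3 * d + 18 * (d * t) * (d * s) * d - 27 * d^2"
    using of_int_eq_iff by blast
  also have "\<dots> = d^2 * (d^2 * s^2 * t^2 - 4 * d * s^3 - 4 * d^2 * t^3 + 18 * d * s * t - 27)" by algebra
  finally have eq: "m^2 = d^2 * (d^2 * s^2 * t^2 - 4 * d * s^3 - 4 * d^2 * t^3 + 18 * d * s * t - 27)" .
  then have "d^2 dvd m^2" by simp
  then have "d dvd m" by simp
  then obtain D where D: "m = d * D" by (elim dvdE)
  have "d^2 * D^2 = d^2 * (d^2 * s^2 * t^2 - 4 * d * s^3 - 4 * d^2 * t^3 + 18 * d * s * t - 27)"
    using eq by (simp add: D power_mult_distrib)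
  then have "D^2 = d^2 * s^2 * t^2 - 4 * d * s^3 - 4 * d^2 * t^3 + 18 * d * s * t - 27"
    using d_nonzero by simp
  then show thesis using that m D by blast
qed

end

section \<open>Integer solutions of the discriminant equation\<close>

text \<open>Since 189 = 27 * 7, a cube dividing it is 1 or 27 up to sign. The values (D^2 + 27)/4
  for D dividing 27 are 7, 9, 27 and 189, all divisors of 189.\<close>

lemma mult_cube_cases:
  fixes e s k :: int
  assumes e: "e * s^3 = - k" and k: "k dvd 189"
  shows "s = -1 \<and> e = k \<or> s = 1 \<and> e = - k \<or> s = -3 \<and> 27 * e = k \<or> s = 3 \<and> 27 * e = - k"
proof -
  have "s^3 dvd 189" using k dvd_trans[of "s^3" k 189] e by (metis dvd_minus_iff dvd_triv_right)
  then have dvd: "\<bar>s\<bar>^3 dvd 189" by (simp flip: power_abs)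
  then have "\<bar>s\<bar>^3 \<le> 189" by (rule zdvd_imp_le) simp
  have "\<bar>s\<bar> < 6"
  proof (rule ccontr)
    assume "\<not> \<bar>s\<bar> < 6"
    then have "6^3 \<le> \<bar>s\<bar>^3" by (intro power_mono) auto
    then show False using \<open>\<bar>s\<bar>^3 \<le> 189\<close> by simp
  qed
  then have "\<bar>s\<bar> = 0 \<or> \<bar>s\<bar> = 1 \<or> \<bar>s\<bar> = 2 \<or> \<bar>s\<bar> = 3 \<or> \<bar>s\<bar> = 4 \<or> \<bar>s\<bar> = 5" by presburger
  then have "\<bar>s\<bar> = 1 \<or> \<bar>s\<bar> = 3" using dvd by (elim disjE; simp)
  then have "s = -1 \<or> s = 1 \<or> s = -3 \<or> s = 3" by presburger
  then show ?thesis using e by (elim disjE; simp)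
qed

lemma dvd_27_square:
  fixes D :: int assumes "D dvd 27" shows "D^2 \<in> {1, 9, 81, 729}"
proof -
  have "\<bar>D\<bar> dvd 3^3" using assms by simp
  then obtain i where "i \<le> 3" "\<bar>D\<bar> = normalize (3^i)"
    using divides_primepow[of 3 "\<bar>D\<bar>" 3] by (auto simp: prime_int_numeral_eq)
  then have i: "\<bar>D\<bar> = 3^i" by simp
  have "i = 0 \<or> i = 1 \<or> i = 2 \<or> i = 3" using \<open>i \<le> 3\<close> by auto
  then have "\<bar>D\<bar> = 1 \<or> \<bar>D\<bar> = 3 \<or> \<bar>D\<bar> = 9 \<or> \<bar>D\<bar> = 27" using i by auto
  then have "D = 1 \<or> D = -1 \<or> D = 3 \<or> D = -3 \<or> D = 9 \<or> D = -9 \<or> D = 27 \<or> D = -27" by presburger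
  then show ?thesis by (elim disjE; simp)
qed

text \<open>Once d is odd it is 3 modulo 4. If s or t vanishes, the equation reads D^2 + 27 = -4 d
  s^3 or -4 d^2 t^3 with four possible values of D^2. If neither does, then d s t = 2 leaves only d
  = -1.\<close>

lemma discriminant_solutions:
  fixes d s t D :: int
  assumes sqfree: "\<And>k. k * k dvd d \<Longrightarrow> k dvd 1"
    and d4: "d mod 4 \<noteq> 1"
    and dst: "d * s * t = 0 \<or> d * s * t = 2" and d0: "d \<noteq> 0"
    and D: "D^2 = d^2 * s^2 * t^2 - 4 * d * s^3 - 4 * d^2 * t^3 + 18 * d * s * t - 27"
    and D27: "s * t = 0 \<Longrightarrow> D dvd 27"
    and special: "\<not> (d = 7 \<and> s = -3 \<and> t = 0)"
  shows "(d, s, t) \<in> {(7, -1, 0), (3, 0, -1), (-1, 3, 0), (-1, 0, -3), (-1, 1, -2), (-1, 2, -1)}"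
proof -
  have n4: "\<not> 4 dvd d" using sqfree[of 2] by auto
  have n9: "\<not> 9 dvd d" using sqfree[of 3] by auto
  \<comment> \<open>For even d the right-hand side is 5 modulo 8, while odd squares are 1 modulo
    8.\<close>
  have odd: "odd d"
  proof
    assume "even d"
    then obtain e where e: "d = 2 * e" by (elim dvdE)
    define u where "u = e * s * t"
    have "even (u^2 + 9 * u)" by simp
    then obtain q where q: "u^2 + 9 * u = 2 * q" by (elim dvdE)
    have "D^2 = 4 * (u^2 + 9 * u) - 8 * (e * s^3) - 16 * (e^2 * t^3) - 27"
      unfolding D e u_def by algebra
    then have "D^2 = 8 * (q - e * s^3 - 2 * (e^2 * t^3)) - 27" unfolding q by simp
    then obtain w where D': "D^2 = 8 * w - 27" ..
    then have "odd (D^2)" by simp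
    then have "odd D" by simp
    then obtain j where j: "D = 2 * j + 1" by (elim oddE)
    have "even (j^2 + j)" by simp
    then obtain i where i: "j^2 + j = 2 * i" by (elim dvdE)
    have "D^2 = 4 * (j^2 + j) + 1" unfolding j by algebra
    then have "D^2 = 8 * i + 1" unfolding i by simp
    then have "8 * i + 1 = 8 * w - 27" using D' by simp
    then show False by presburger
  qed
  have d34: "d mod 4 = 3" using odd d4 by presburger
  consider "t = 0" "s = 0" | "t = 0" "s \<noteq> 0" | "s = 0" "t \<noteq> 0" | "d * (s * t) = 2"
    using dst d0 by (auto simp: mult.assoc)
  then show ?thesis
  proof cases
    case 1
    then have "D^2 = -27" using D by simp
    then show ?thesis using zero_le_power2[of D] by linarith
  next
    case 2
    have "D^2 = - 4 * (d * s^3) - 27" using D 2 by simp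
    moreover have "D^2 \<in> {1, 9, 81, 729}" using dvd_27_square D27 2 by simp
    ultimately have k: "d * s^3 = -7 \<or> d * s^3 = -9 \<or> d * s^3 = -27 \<or> d * s^3 = -189" by auto
    have "s = -1 \<and> (d = 7 \<or> d = 9 \<or> d = 27 \<or> d = 189) \<or> s = 1 \<and> (d = -7 \<or> d = -9 \<or> d = -27 \<or> d = -189)
      \<or> s = -3 \<and> (d = 1 \<or> d = 7) \<or> s = 3 \<and> (d = -1 \<or> d = -7)"
      using k
    proof (elim disjE)
      assume "d * s^3 = -7"
      from mult_cube_cases[OF this] show ?thesis by presburger
    next
      assume "d * s^3 = -9"
      from mult_cube_cases[OF this] show ?thesis by presburger
    next
      assume "d * s^3 = -27"
      from mult_cube_cases[OF this] show ?thesis by presburger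
    next
      assume "d * s^3 = -189"
      from mult_cube_cases[OF this] show ?thesis by presburger
    qed
    \<comment> \<open>The residue modulo 4 and the exclusion of multiples of 9 leave (d, s) = (7,
      -1), (-1, 3) and (7, -3); the last is removed by \<open>special\<close>.\<close>
    then show ?thesis using 2(1) d34 n9 special by (elim disjE conjE; simp)
  next
    case 3
    have "D^2 = - 4 * (d^2 * t^3) - 27" using D 3 by simp
    moreover have "D^2 \<in> {1, 9, 81, 729}" using dvd_27_square D27 3 by simp
    ultimately have k: "d^2 * t^3 = -7 \<or> d^2 * t^3 = -9 \<or> d^2 * t^3 = -27 \<or> d^2 * t^3 = -189" by auto
    have "t = -1 \<and> (y = 7 \<or> y = 9 \<or> y = 27 \<or> y = 189) \<or> t = -3 \<and> (y = 1 \<or> y = 7)"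
      if "y * t^3 = -7 \<or> y * t^3 = -9 \<or> y * t^3 = -27 \<or> y * t^3 = -189" "0 \<le> y" for y
      using that(1)
    proof (elim disjE)
      assume "y * t^3 = -7"
      from mult_cube_cases[OF this] that(2) show ?thesis by presburger
    next
      assume "y * t^3 = -9"
      from mult_cube_cases[OF this] that(2) show ?thesis by presburger
    next
      assume "y * t^3 = -27"
      from mult_cube_cases[OF this] that(2) show ?thesis by presburger
    next
      assume "y * t^3 = -189"
      from mult_cube_cases[OF this] that(2) show ?thesis by presburger
    qed
    from this[OF k] have "t = -1 \<and> (d^2 = 7 \<or> d^2 = 9 \<or> d^2 = 27 \<or> d^2 = 189) \<or> t = -3 \<and> (d^2 = 1 \<or> d^2 = 7)"
      by simp
    moreover have "d^2 = 9 \<Longrightarrow> d = 3 \<or> d = -3" using power2_eq_iff[of d 3] by simp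
    moreover have "d^2 = 1 \<Longrightarrow> d = 1 \<or> d = -1" using power2_eq_iff[of d 1] by simp
    moreover have "d^2 \<noteq> 7 \<and> d^2 \<noteq> 27 \<and> d^2 \<noteq> 189"
    proof -
      have "d = 4 * (d div 4) + 3" using d34 by presburger
      then obtain e where e: "d = 4 * e + 3" ..
      have "d^2 = 8 * (2 * e^2 + 3 * e + 1) + 1" unfolding e by algebra
      then have "d^2 mod 8 = 1" by presburger
      then show ?thesis by auto
    qed
    ultimately have "t = -1 \<and> (d = 3 \<or> d = -3) \<or> t = -3 \<and> (d = 1 \<or> d = -1)" by argo
    then show ?thesis using 3(1) d34 by (elim disjE conjE; simp)
  next
    case 4
    then have "d dvd 2" by (metis dvd_triv_left)
    then have "\<bar>d\<bar> \<le> 2" using dvd_imp_le_int[of 2 d] by simp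
    then have "d = -1" using d34 d0 by presburger
    then have st: "s * t = -2" using 4 by simp
    then have "s dvd 2" by (metis dvd_triv_left dvd_minus_iff)
    then have "\<bar>s\<bar> \<le> 2" using dvd_imp_le_int[of 2 s] by simp
    then have "s = -2 \<or> s = -1 \<or> s = 0 \<or> s = 1 \<or> s = 2" by presburger
    then have "s = -2 \<and> t = 1 \<or> s = -1 \<and> t = 2 \<or> s = 1 \<and> t = -2 \<or> s = 2 \<and> t = -1"
      using st by (elim disjE; simp; presburger)
    \<comment> \<open>Here D^2 = 13 + 4 (s^3 - t^3), which is negative for the first two
      pairs.\<close>
    then show ?thesis
      using D \<open>d = -1\<close> zero_le_power2[of D] by (elim disjE; simp)
  qed
qed

section \<open>The bound on D and the exceptional triple\<close>

context monogenic_cyclic_sextic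
begin

lemma beta_difference_associate:
  obtains \<kappa> where "\<kappa> \<in> OK" "\<alpha>2^2 - \<alpha>^2 = (\<alpha>^2 - \<alpha>1^2) * \<kappa>"
proof -
  have "\<alpha>1^2 \<in> OL" by (rule fixed3_OL) (use alpha12_OK in \<open>simp_all add: OK_closed sigma_beta\<close>)
  from difference_quotient[OF this alpha12_OK(1)]
  obtain \<kappa> where "\<kappa> \<in> OK" "\<alpha>1^2 - \<sigma> (\<alpha>1^2) = (\<alpha>^2 - \<alpha>1^2) * \<kappa>"
    "\<sigma> (\<alpha>1^2) - \<sigma> (\<sigma> (\<alpha>1^2)) = (\<alpha>1^2 - \<alpha>2^2) * \<sigma> \<kappa>" .
  note \<kappa> = this[unfolded sigma_beta]
  have "\<alpha>2^2 - \<alpha>^2 = (\<alpha>^2 - \<alpha>1^2) * (\<kappa> * \<sigma> \<kappa>)" unfolding \<kappa>(3) \<kappa>(2) by simp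
  moreover have "\<kappa> * \<sigma> \<kappa> \<in> OK" using \<kappa>(1) by (simp add: OK_closed sigma_in_OK)
  ultimately show thesis using that by blast
qed

lemma int_dvd_OK:
  assumes "y \<in> OK" "of_int n = of_int k * y" "n \<noteq> 0" shows "k dvd n"
proof -
  have k: "k \<noteq> 0" using assms by auto
  then have "y = of_int n / of_int k" using assms(2) by (simp add: field_simps)
  then have "y \<in> \<rat>" by simp
  then have "y \<in> \<int>" using OK_Rats assms(1) by blast
  then obtain m where "y = of_int m" by (elim Ints_cases)
  then have "(of_int n :: complex) = of_int (k * m)" using assms(2) by simp
  then have "n = k * m" using of_int_eq_iff by blast
  then show ?thesis by simp
qed

end

context resolvent
begin

text \<open>For t = 0, 3 X0 = (X0 - X1) - (X2 - X0) is a multiple of \<theta>, so 27 X0^3 is a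
  multiple of \<theta>^3 and hence of \<delta> = d D. As X0^3 = d (1 - s X0) with 1 - s X0 of norm
  1, D divides 27. For s = 0 the same works with Y0 = X1 X2.\<close>

lemma D_dvd_27:
  assumes st: "s * t = 0" and D: "\<delta> = of_int (d * D)"
  shows "D dvd 27"
proof -
  obtain \<rho> n where \<rho>: "\<rho> \<in> OK" "X0 - X1 = (\<alpha>^2 - \<alpha>1^2) * \<rho>" "X2 - X0 = (\<alpha>2^2 - \<alpha>^2) * \<sigma> (\<sigma> \<rho>)"
    using index_unit .
  obtain \<kappa> where \<kappa>: "\<kappa> \<in> OK" "\<alpha>2^2 - \<alpha>^2 = (\<alpha>^2 - \<alpha>1^2) * \<kappa>"
    using beta_difference_associate .
  define \<theta> where "\<theta> = \<alpha>^2 - \<alpha>1^2"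
  define r where "r = \<kappa> * \<sigma> (\<sigma> \<rho>)"
  have r: "r \<in> OK" using \<kappa> \<rho> by (simp add: r_def OK_closed sigma_in_OK)
  have X01: "X0 - X1 = \<theta> * \<rho>" and X20: "X2 - X0 = \<theta> * r"
    unfolding \<rho> \<kappa> \<theta>_def r_def by simp_all
  obtain w where w: "w \<in> OK" "\<theta>^3 = \<delta> * w" using theta_cube unfolding \<theta>_def .
  define e :: complex where "e = of_int d"
  define u :: complex where "u = of_int s"
  define v :: complex where "v = of_int t"
  have e0: "e \<noteq> 0" using d_nonzero by (simp add: e_def)
  have S: "X0 + X1 + X2 = e * v" and T: "X0 * X1 + X1 * X2 + X2 * X0 = e * u" and P: "X0 * X1 * X2 = e"
    using X_sum X_sum2 X_prod by (simp_all add: e_def u_def v_def)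
  have \<delta>: "\<delta> = e * of_int D" using D by (simp add: e_def)
  have uv: "u \<in> OK" "v \<in> OK" unfolding u_def v_def by (rule OK_closed(1))+
  from st consider "t = 0" | "s = 0" by auto
  then have "\<exists>y\<in>OK. of_int 27 = of_int D * y"
  proof cases
    case 1
    then have v: "v = 0" by (simp add: v_def)
    define y where "y = \<rho> - r"
    have "3 * X0 = \<theta> * y" using S X01 X20 unfolding v y_def by algebra
    then have "27 * X0^3 = \<theta>^3 * y^3" by algebra
    also have "X0^3 = e * (1 - u * X0)" using S T P unfolding v by algebra
    finally have "e * (27 * (1 - u * X0)) = e * (of_int D * (w * y^3))"
      unfolding w(2) \<delta> by (simp add: mult_ac)
    then have 27: "27 * (1 - u * X0) = of_int D * (w * y^3)" using e0 unfolding mult_cancel_left by blast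
    have "(1 - u * X0) * (1 - u * X1) * (1 - u * X2) = 1" using S T P unfolding v by algebra
    then have "27 = of_int D * (w * y^3 * (1 - u * X1) * (1 - u * X2))" using 27 by algebra
    moreover have "w * y^3 * (1 - u * X1) * (1 - u * X2) \<in> OK"
      using w(1) \<rho>(1) r uv X_OK unfolding y_def by (simp add: OK_closed)
    ultimately show ?thesis by auto
  next
    case 2
    then have u: "u = 0" by (simp add: u_def)
    obtain y0 y1 y2 where y12: "y1 \<in> OL" "y2 \<in> OL" "X1 = \<alpha>^2 * y1" "X2 = \<alpha>^2 * y2"
      using X_div_beta .
    obtain w' where w': "w' \<in> OL" "\<alpha>^6 = - of_int c * w'" using alpha_pow6_associate .
    then have a6: "\<alpha>^6 = e * w'" by (simp add: e_def d_def)
    define Y0 Y1 Y2 where "Y0 = X1 * X2" and "Y1 = X2 * X0" and "Y2 = X0 * X1"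
    define y where "y = y1 * r - y2 * \<rho>"
    \<comment> \<open>Now Y0^3 carries d^2. One factor d comes from \<delta>; the other comes from
      the additional \<alpha>^2, whose cube is a multiple of d.\<close>
    have "3 * Y0 = X2 * (X1 - X0) + X1 * (X2 - X0)" using T unfolding u Y0_def by algebra
    also have "\<dots> = \<theta> * (\<alpha>^2 * y)" using X01 X20 y12(3,4) unfolding y_def by algebra
    finally have "27 * Y0^3 = \<theta>^3 * \<alpha>^6 * y^3" by algebra
    moreover have "Y0^3 = e^2 * (1 - v * Y0)" using S T P unfolding u Y0_def by algebra
    ultimately have "e^2 * (27 * (1 - v * Y0)) = e^2 * (of_int D * (w * w' * y^3))"
      unfolding w(2) \<delta> a6 by (simp add: mult_ac power2_eq_square)
    then have 27: "27 * (1 - v * Y0) = of_int D * (w * w' * y^3)" using e0 unfolding mult_cancel_left by simp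
    have "(1 - v * Y0) * (1 - v * Y1) * (1 - v * Y2) = 1"
      using S T P unfolding u Y0_def Y1_def Y2_def by algebra
    then have "27 = of_int D * (w * w' * y^3 * (1 - v * Y1) * (1 - v * Y2))" using 27 by algebra
    moreover have "w * w' * y^3 * (1 - v * Y1) * (1 - v * Y2) \<in> OK"
      using w(1) w'(1) y12(1,2) \<rho>(1) r uv X_OK unfolding y_def Y1_def Y2_def by (simp add: OK_closed OL_subset_O)
    ultimately show ?thesis by auto
  qed
  then show ?thesis using int_dvd_OK by auto
qed

text \<open>This triple satisfies the discriminant equation with D^2 = 729. But here X0 = 3 W + 1
  with W a root of y^3 + y^2 - 2 y - 1, hence integral, so 3 would divide \<rho>, whose norm is
  1.\<close>

lemma not_special: "\<not> (d = 7 \<and> s = -3 \<and> t = 0)"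
proof
  assume sp: "d = 7 \<and> s = -3 \<and> t = 0"
  obtain \<rho> n where \<rho>: "\<rho> \<in> OK" "X0 - X1 = (\<alpha>^2 - \<alpha>1^2) * \<rho>"
    and n: "\<rho> * \<sigma> \<rho> * \<sigma> (\<sigma> \<rho>) = of_int n" "n * (1 - d * s * t) = 1"
    using index_unit .
  have n1: "n = 1" using n(2) sp by simp
  have S: "X0 + X1 + X2 = 0" and T: "X0 * X1 + X1 * X2 + X2 * X0 = -21" and P: "X0 * X1 * X2 = 7"
    using X_sum X_sum2 X_prod sp by simp_all
  have X3: "X0^3 = 21 * X0 + 7" using S T P by algebra
  define W where "W = (X0 - 1) / 3"
  have "27 * (W^3 + W^2 - 2 * W - 1) = 0"
  proof -
    have "X0 = 3 * W + 1" by (simp add: W_def)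
    then show ?thesis using X3 by algebra
  qed
  then have "W^3 + W^2 - 2 * W - 1 = 0" unfolding mult_eq_0_iff by simp
  then have "alg_int W"
    unfolding alg_int_def
    by (intro exI[of _ "[:-1, -2, 1, 1:]"]) (simp add: map_poly_pCons algebra_simps power_def)
  moreover have "W \<in> K"
    unfolding W_def using OK_subset_K[OF X_OK(1)] by (intro subfield_divide[OF sextic_span_rat_subfield] K_closed)
  ultimately have W: "W \<in> OK" by (rule alg_int_OK[rotated])
  have X1K: "X0 \<in> K" "X1 \<in> K" "X2 \<in> K" using X_OK OK_subset_K by auto
  have \<sigma>W: "\<sigma> ((x - 1) / 3) = (\<sigma> x - 1) / 3" if "x \<in> K" for x
    using that of_int[of 3] by (simp add: divide diff one K_closed)
  have "\<sigma> (\<sigma> (\<sigma> W)) = W" unfolding W_def using X1K by (simp add: \<sigma>W sigma_X)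
  then have "W \<in> OL" using fixed3_OL W by blast
  then obtain \<mu> where \<mu>: "\<mu> \<in> OK" "W - \<sigma> W = (\<alpha>^2 - \<alpha>1^2) * \<mu>"
    using difference_quotient[OF _ alpha12_OK(1)] by metis
  have "X0 - X1 = 3 * (W - \<sigma> W)" unfolding W_def using X1K by (simp add: \<sigma>W sigma_X)
  then have "(\<alpha>^2 - \<alpha>1^2) * \<rho> = (\<alpha>^2 - \<alpha>1^2) * (3 * \<mu>)" using \<rho>(2) \<mu>(2) by simp
  then have "\<rho> = 3 * \<mu>" using beta_distinct(1) unfolding mult_cancel_left by simp
  then have "of_int 1 = of_int 3 * (\<mu> * \<sigma> \<rho> * \<sigma> (\<sigma> \<rho>))" using n(1) n1 by (simp add: mult.assoc)
  moreover have "\<mu> * \<sigma> \<rho> * \<sigma> (\<sigma> \<rho>) \<in> OK" using \<mu>(1) \<rho>(1) by (simp add: OK_closed sigma_in_OK)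
  ultimately have "(3 :: int) dvd 1" using int_dvd_OK by (metis zero_neq_one)
  then show False by simp
qed

lemma coefficients:
  "(a, b, c) \<in> {(-7, 14, -7), (-6, 9, -3), (5, 6, 1), (6, 5, 1), (6, 9, 1), (9, 6, 1)}"
proof -
  obtain n where "n * (1 - d * s * t) = 1" using index_unit by metis
  then have "(1 - d * s * t) dvd 1" by (metis dvd_triv_right)
  then have "\<bar>1 - d * s * t\<bar> = 1" by simp
  then have dst: "d * s * t = 0 \<or> d * s * t = 2" by presburger
  obtain D where D: "\<delta> = of_int (d * D)"
    "D^2 = d^2 * s^2 * t^2 - 4 * d * s^3 - 4 * d^2 * t^3 + 18 * d * s * t - 27"
    using discriminant .
  have sq: "k dvd 1" if "k * k dvd d" for k using c_squarefree that by (simp add: d_def)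
  have "d mod 4 \<noteq> 1" using c_mod_4 unfolding d_def by presburger
  from discriminant_solutions[OF sq this dst d_nonzero D(2) D_dvd_27[OF _ D(1)] not_special]
  have sol: "(d, s, t) \<in> {(7, -1, 0), (3, 0, -1), (-1, 3, 0), (-1, 0, -3), (-1, 1, -2), (-1, 2, -1)}" .
  have coeffs: "(2 * x * z - x * y^2, x^2 * z^2 - 2 * x * y, - x) \<in>
      {(-7, 14, -7), (-6, 9, -3), (5, 6, 1), (6, 5, 1), (6, 9, 1), (9, 6, 1)}"
    if "(x, y, z) \<in> {(7, -1, 0), (3, 0, -1), (-1, 3, 0), (-1, 0, -3), (-1, 1, -2), (-1, 2, -1)}"
    for x y z :: int
    using that by (elim insertE emptyE) simp_all
  have "(a, b, c) = (2 * d * t - d * s^2, d^2 * t^2 - 2 * d * s, - d)"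
    using ab_eq(2) trans[OF ab_eq(1), of "2 * d * t - d * s^2"] unfolding prod.inject d_def by simp
  then show ?thesis using coeffs[OF sol] by (rule ssubst)
qed

end

lemma (in monogenic_cyclic_sextic) coefficients_of_monogenic:
  "(a, b, c) \<in> {(-7, 14, -7), (-6, 9, -3), (5, 6, 1), (6, 5, 1), (6, 9, 1), (9, 6, 1)}"
proof -
  obtain s t where "X0 + X1 + X2 = of_int (d * t)" "X0 * X1 + X1 * X2 + X2 * X0 = of_int (d * s)"
    using d_dvd_symmetric .
  then interpret resolvent a b c \<alpha> \<sigma> s t by unfold_locales
  show ?thesis by (rule coefficients)
qed

section \<open>Maximality of the order generated by a root\<close>

lemma int_closed_sum:
  assumes "int_closed R" "\<And>i. i \<in> A \<Longrightarrow> f i \<in> R" shows "sum f A \<in> R"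
  using assms(2) by (induction A rule: infinite_finite_induct) (simp_all add: int_closedD[OF assms(1)])

text \<open>The left-hand side of \<open>eq\<close> is the norm of \<open>h0 + h1 \<pi> + h2 \<pi>\<^sup>2\<close> for a root \<open>\<pi>\<close> of the Eisenstein polynomial
  \<open>y\<^sup>3 + A y\<^sup>2 + B y + C\<close>.\<close>

lemma prime_dvd_norm_coeffs:
  fixes p :: int
  assumes p: "prime p" and ABC: "p dvd A" "p dvd B" "p dvd C" and pC: "\<not> p^2 dvd C"
    and eq: "h0^3 - A * h0^2 * h1 + (A^2 - 2 * B) * h0^2 * h2 + B * h0 * h1^2 + (3 * C - A * B) * h0 * h1 * h2
      + (B^2 - 2 * A * C) * h0 * h2^2 - C * h1^3 + A * C * h1^2 * h2 - B * C * h1 * h2^2 + C^2 * h2^3 = p^3 * n"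
  shows "p dvd h0" "p dvd h1" "p dvd h2"
proof -
  obtain A' B' C' where A: "A = p * A'" and B: "B = p * B'" and C: "C = p * C'" using ABC by (elim dvdE)
  have pC': "\<not> p dvd C'" using pC by (auto simp: C power2_eq_square)
  have p0: "p \<noteq> 0" using p by auto
  note eq' = eq[unfolded A B C]
  \<comment> \<open>Reading the norm identity modulo p, p^2 and p^3 in turn isolates h0^3, C h1^3
    and C^2 h2^3.\<close>
  have "h0^3 = p * (p^2 * n + A' * h0^2 * h1 - (p * A'^2 - 2 * B') * h0^2 * h2 - B' * h0 * h1^2 - (3 * C' - p * A' * B') * h0 * h1 * h2
      - (p * B'^2 - 2 * p * A' * C') * h0 * h2^2 + C' * h1^3 - p * A' * C' * h1^2 * h2 + p * B' * C' * h1 * h2^2 - p * C'^2 * h2^3)"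
    using eq' by algebra
  then have "p dvd h0^3" by (metis dvd_triv_left)
  then show h0: "p dvd h0" using p prime_dvd_power by blast
  then obtain k0 where k0: "h0 = p * k0" by (elim dvdE)
  have "p * (C' * h1^3) = p * (p * (- (p * n) + p * k0^3 - p * A' * k0^2 * h1 + p * (p * A'^2 - 2 * B') * k0^2 * h2 + B' * k0 * h1^2 + (3 * C' - p * A' * B') * k0 * h1 * h2
      + (p * B'^2 - 2 * p * A' * C') * k0 * h2^2 + A' * C' * h1^2 * h2 - B' * C' * h1 * h2^2 + C'^2 * h2^3))"
    using eq' unfolding k0 by algebra
  then have "C' * h1^3 = p * (- (p * n) + p * k0^3 - p * A' * k0^2 * h1 + p * (p * A'^2 - 2 * B') * k0^2 * h2 + B' * k0 * h1^2 + (3 * C' - p * A' * B') * k0 * h1 * h2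
      + (p * B'^2 - 2 * p * A' * C') * k0 * h2^2 + A' * C' * h1^2 * h2 - B' * C' * h1 * h2^2 + C'^2 * h2^3)"
    using p0 unfolding mult_cancel_left by blast
  then have "p dvd C' * h1^3" by (metis dvd_triv_left)
  then have "p dvd h1^3" using pC' p prime_dvd_multD by blast
  then show h1: "p dvd h1" using p prime_dvd_power by blast
  then obtain k1 where k1: "h1 = p * k1" by (elim dvdE)
  have "p^2 * (C'^2 * h2^3) = p^2 * (p * (n - k0^3 + p * A' * k0^2 * k1 - (p * A'^2 - 2 * B') * k0^2 * h2 - p * B' * k0 * k1^2 - (3 * C' - p * A' * B') * k0 * k1 * h2
      - (B'^2 - 2 * A' * C') * k0 * h2^2 + p * C' * k1^3 - p * A' * C' * k1^2 * h2 + B' * C' * k1 * h2^2))"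
    using eq' unfolding k0 k1 by algebra
  then have "C'^2 * h2^3 = p * (n - k0^3 + p * A' * k0^2 * k1 - (p * A'^2 - 2 * B') * k0^2 * h2 - p * B' * k0 * k1^2 - (3 * C' - p * A' * B') * k0 * k1 * h2
      - (B'^2 - 2 * A' * C') * k0 * h2^2 + p * C' * k1^3 - p * A' * C' * k1^2 * h2 + B' * C' * k1 * h2^2)"
    using p0 unfolding mult_cancel_left by simp
  then have "p dvd C'^2 * h2^3" by (metis dvd_triv_left)
  moreover have "\<not> p dvd C'^2" using pC' p prime_dvd_power by blast
  ultimately have "p dvd h2^3" using p prime_dvd_multD by blast
  then show "p dvd h2" using p prime_dvd_power by blast
qed

section \<open>Elements with a common denominator for their powers\<close>

context cyclic_sextic
begin

text \<open>Elements whose powers have a common denominator. Unlike for the algebraic integers of \<open>K\<close>, with which they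
  turn out to coincide, closure under the ring operations is immediate.\<close>

definition AI :: "complex set" where
  "AI = {w \<in> K. \<exists>N :: int. N \<noteq> 0 \<and> (\<forall>k. of_int N * w^k \<in> OK)}"

lemma AI_K: "w \<in> AI \<Longrightarrow> w \<in> K" by (simp add: AI_def)

lemma AI_E: assumes "w \<in> AI" obtains N :: int where "N \<noteq> 0" "\<And>k. of_int N * w^k \<in> OK"
  using assms unfolding AI_def by blast

lemma AI_I: "w \<in> K \<Longrightarrow> N \<noteq> 0 \<Longrightarrow> (\<And>k. of_int N * w^k \<in> OK) \<Longrightarrow> w \<in> AI" for N :: int
  unfolding AI_def by blast

lemma OK_AI: "x \<in> OK \<Longrightarrow> x \<in> AI"
  by (rule AI_I[of _ 1]) (simp_all add: OK_subset_K OK_closed)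

lemma AI_int_closed: "int_closed AI"
proof -
  have "x + y \<in> AI \<and> x * y \<in> AI" if xy: "x \<in> AI" "y \<in> AI" for x y
  proof
    obtain N where N: "N \<noteq> 0" "\<And>k. of_int N * x^k \<in> OK" using AI_E[OF xy(1)] by blast
    obtain M where M: "M \<noteq> 0" "\<And>k. of_int M * y^k \<in> OK" using AI_E[OF xy(2)] by blast
    show "x * y \<in> AI"
    proof (rule AI_I)
      show "N * M \<noteq> 0" using N M by simp
      fix k
      have "of_int (N * M) * (x * y)^k = (of_int N * x^k) * (of_int M * y^k)"
        by (simp add: power_mult_distrib mult_ac)
      also have "\<dots> \<in> OK" by (rule OK_closed(7)[OF N(2) M(2)])
      finally show "of_int (N * M) * (x * y)^k \<in> OK" .
    qed (use AI_K[OF xy(1)] AI_K[OF xy(2)] K_closed in simp)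
    show "x + y \<in> AI"
    proof (rule AI_I)
      show "N * M \<noteq> 0" using N M by simp
      fix k
      have "of_int (N * M) * (x + y)^k = (\<Sum>i\<le>k. of_int (int (k choose i)) * ((of_int N * x^i) * (of_int M * y^(k - i))))"
        unfolding binomial_ring sum_distrib_left by (simp add: mult_ac)
      also have "\<dots> \<in> OK"
        by (intro int_closed_sum sextic_span_int_closed int_closed_Ints OK_closed(7) N M) (rule OK_closed(1))
      finally show "of_int (N * M) * (x + y)^k \<in> OK" .
    qed (use AI_K[OF xy(1)] AI_K[OF xy(2)] K_closed in simp)
  qed
  moreover have "x \<in> AI" if "x \<in> \<int>" for x
    using that by (auto elim!: Ints_cases intro!: OK_AI OK_closed(1))
  moreover have "- x \<in> AI" if "x \<in> AI" for x
  proof -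
    have "-1 \<in> AI" using OK_AI[OF OK_closed(1), of "-1"] by simp
    then show ?thesis using calculation(1)[OF _ that, of "-1"] by simp
  qed
  ultimately show ?thesis unfolding int_closed_def by (metis add_uminus_conv_diff subsetI)
qed

lemmas AI_closed = int_closedD[OF AI_int_closed]

lemma K_denominator: assumes "w \<in> K" obtains N :: int where "N \<noteq> 0" "of_int N * w \<in> OK"
proof -
  have LD: "\<exists>N :: int. N \<noteq> 0 \<and> of_int N * x \<in> OL" if "x \<in> L" for x
  proof -
    obtain r0 r1 r2 where r: "x = r0 + r1 * \<alpha>^2 + r2 * \<alpha>^4" "r0 \<in> \<rat>" "r1 \<in> \<rat>" "r2 \<in> \<rat>"
      using \<open>x \<in> L\<close> unfolding cubic_span_def by blast
    have den: "\<exists>n m :: int. n \<noteq> 0 \<and> of_int n * q = of_int m" if q: "q \<in> \<rat>" for q :: complex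
    proof -
      obtain m n :: int where "n > 0" "q = of_int m / of_int n" using Rats_cases'[OF q] by metis
      then show ?thesis by (intro exI[of _ n] exI[of _ m]) simp
    qed
    obtain n0 m0 n1 m1 n2 m2 :: int where nm: "n0 \<noteq> 0" "of_int n0 * r0 = of_int m0" "n1 \<noteq> 0" "of_int n1 * r1 = of_int m1"
      "n2 \<noteq> 0" "of_int n2 * r2 = of_int m2" using den r by meson
    have "of_int (n0 * n1 * n2) * x = of_int (n1 * n2) * (of_int n0 * r0) + of_int (n0 * n2) * (of_int n1 * r1) * \<alpha>^2
      + of_int (n0 * n1) * (of_int n2 * r2) * \<alpha>^4" unfolding r(1) by (simp add: algebra_simps)
    also have "\<dots> \<in> OL" unfolding nm by (rule cubic_span_I) (simp_all flip: of_int_mult)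
    finally show ?thesis using nm by (intro exI[of _ "n0 * n1 * n2"]) simp
  qed
  obtain u v where w: "w = u + \<alpha> * v" "u \<in> L" "v \<in> L" using assms by (auto simp: sextic_span_def)
  obtain N M :: int where NM: "N \<noteq> 0" "of_int N * u \<in> OL" "M \<noteq> 0" "of_int M * v \<in> OL" using LD w by meson
  have "of_int (N * M) * w = of_int M * (of_int N * u) + \<alpha> * (of_int N * (of_int M * v))"
    by (simp add: w algebra_simps)
  also have "\<dots> \<in> OK"
    by (rule sextic_span_I[OF OL_closed(7)[OF OL_closed(1) NM(2)] OL_closed(7)[OF OL_closed(1) NM(4)]])
  finally show thesis using that[of "N * M"] NM by simp
qed

text \<open>If N clears the denominator of w and n is the degree of a monic equation of w, then N^n
  works for all powers: directly for exponents below n, and by reducing with the equation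
  beyond.\<close>

lemma alg_int_AI: assumes "w \<in> K" "alg_int w" shows "w \<in> AI"
proof -
  obtain p :: "int poly" where p: "lead_coeff p = 1" "poly (map_poly of_int p) w = 0"
    using assms(2) unfolding alg_int_def by blast
  define n where "n = degree p"
  have "poly (map_poly of_int p) w = (\<Sum>i\<le>n. of_int (coeff p i) * w^i)"
    unfolding poly_altdef n_def by (simp add: coeff_map_poly degree_map_poly)
  also have "\<dots> = (\<Sum>i<n. of_int (coeff p i) * w^i) + w^n"
    using p(1) by (simp add: n_def lessThan_Suc_atMost[symmetric])
  finally have wn: "w^n = - (\<Sum>i<n. of_int (coeff p i) * w^i)" using p(2) by (simp add: add_eq_0_iff)
  obtain N :: int where N: "N \<noteq> 0" "of_int N * w \<in> OK" using K_denominator[OF assms(1)] .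
  show ?thesis
  proof (rule AI_I[OF assms(1), of "N^n"])
    show "N^n \<noteq> 0" using N by simp
    show "of_int (N^n) * w^k \<in> OK" for k
    proof (induction k rule: less_induct)
      case (less k)
      show ?case
      proof (cases "k < n")
        case True
        then have "N^n = N^(n - k) * N^k" by (simp flip: power_add)
        then have "of_int (N^n) * w^k = of_int (N^(n - k)) * (of_int N * w)^k"
          by (simp add: power_mult_distrib)
        also have "\<dots> \<in> OK" by (rule OK_closed(7)[OF OK_closed(1) OK_closed(9)[OF N(2)]])
        finally show ?thesis .
      next
        case False
        then have "w^k = w^(k - n) * w^n" by (simp flip: power_add)
        then have "of_int (N^n) * w^k = - (\<Sum>i<n. of_int (coeff p i) * (of_int (N^n) * w^(k - n + i)))"
          unfolding wn by (simp add: sum_distrib_left power_add mult_ac)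
        also have "\<dots> \<in> OK"
        proof (rule OK_closed(8), rule int_closed_sum[OF sextic_span_int_closed[OF int_closed_Ints]])
          fix i assume "i \<in> {..<n}"
          then have "k - n + i < k" using False by auto
          then show "of_int (coeff p i) * (of_int (N^n) * w^(k - n + i)) \<in> OK"
            by (rule OK_closed(7)[OF OK_closed(1) less])
        qed
        finally show ?thesis .
      qed
    qed
  qed
qed

lemma root_alg_int: "z^6 + of_int a * z^4 + of_int b * z^2 + of_int c = 0 \<Longrightarrow> alg_int z"
  unfolding alg_int_def by (rule exI[of _ "sextic a b c"]) (simp add: poly_of_int_sextic[unfolded map_poly_pCons])

lemma alpha_AI: "\<alpha> \<in> AI" "\<alpha>1 \<in> AI" "\<alpha>2 \<in> AI"
  using root_alg_int root roots alpha_K by (auto intro!: alg_int_AI)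

lemma sigma_AI: assumes "w \<in> AI" shows "\<sigma> w \<in> AI"
proof -
  obtain N where N: "N \<noteq> 0" "\<And>k. of_int N * w^k \<in> OK" using AI_E[OF assms] by blast
  obtain M where M: "M \<noteq> 0" "\<And>k. of_int M * \<alpha>1^k \<in> OK" using AI_E[OF alpha_AI(2)] by blast
  have \<sigma>OK: "of_int M * \<sigma> x \<in> OK" if x: "x \<in> OK" for x
  proof -
    obtain p :: "int poly" where p: "x = poly (map_poly of_int p) \<alpha>"
      using x unfolding sextic_span_int_eq Z_adjoin_def by blast
    have "poly (map_poly of_int p) \<alpha> \<in> K \<and> \<sigma> (poly (map_poly of_int p) \<alpha>) = poly (map_poly of_int p) \<alpha>1" for p :: "int poly"
      by (induction p) (auto simp: map_poly_pCons zero add mult of_int K_closed alpha_K)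
    moreover have "of_int M * \<alpha>1^k * poly (map_poly of_int p) \<alpha>1 \<in> OK" for k and p :: "int poly"
    proof (induction p arbitrary: k)
      case (pCons q p)
      have "of_int M * \<alpha>1^k * poly (map_poly of_int (pCons q p)) \<alpha>1 =
        of_int q * (of_int M * \<alpha>1^k) + of_int M * \<alpha>1^Suc k * poly (map_poly of_int p) \<alpha>1"
        by (simp add: map_poly_pCons algebra_simps)
      also have "\<dots> \<in> OK" by (intro OK_closed(5) OK_closed(7) M pCons.IH) (rule OK_closed(1))
      finally show ?case .
    qed (simp add: OK_closed)
    from this[of 0] show ?thesis using p calculation by simp
  qed
  show ?thesis
  proof (rule AI_I)
    show "\<sigma> w \<in> K" using AI_K[OF assms] by (rule into)
    show "M * N \<noteq> 0" using M N by simp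
    fix k
    have "\<sigma> (of_int N * w^k) = of_int N * \<sigma> w^k"
      using AI_K[OF assms] by (simp add: mult of_int power K_closed)
    then have "of_int (M * N) * \<sigma> w^k = of_int M * \<sigma> (of_int N * w^k)" by simp
    then show "of_int (M * N) * \<sigma> w^k \<in> OK" using \<sigma>OK[OF N(2)] by (simp only:)
  qed
qed

text \<open>In lowest terms every power of the denominator q divides the fixed nonzero N, which
  forces q = 1.\<close>

lemma AI_Rats: assumes "w \<in> AI" "w \<in> \<rat>" shows "w \<in> \<int>"
proof -
  obtain N where N: "N \<noteq> 0" "\<And>k. of_int N * w^k \<in> OK" using AI_E[OF assms(1)] by blast
  obtain p q :: int where pq: "q > 0" "coprime p q" "w = of_int p / of_int q" using Rats_cases'[OF assms(2)] by metis
  have dvd: "q^k dvd N" for k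
  proof -
    have "of_int N * w^k \<in> \<int>" using N(2) assms(2) by (intro OK_Rats) auto
    then obtain m where "of_int N * w^k = of_int m" by (elim Ints_cases)
    then have "of_int (N * p^k) = (of_int (m * q^k) :: complex)" using pq by (simp add: power_divide field_simps)
    then have "N * p^k = m * q^k" using of_int_eq_iff by blast
    then have "q^k dvd N * p^k" by simp
    moreover have "coprime (q^k) (p^k)" using pq(2) by (simp add: coprime_commute)
    ultimately show ?thesis by (simp add: coprime_dvd_mult_left_iff)
  qed
  have "q = 1"
  proof (rule ccontr)
    assume "q \<noteq> 1"
    then have "2 \<le> q" using pq(1) by simp
    define k where "k = nat \<bar>N\<bar>"
    have "int k < 2^k" by (metis of_nat_less_two_power)
    also have "2^k \<le> q^k" using \<open>2 \<le> q\<close> by (intro power_mono) auto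
    also have "\<dots> \<le> \<bar>N\<bar>" using dvd[of k] N(1) dvd_imp_le_int[of N "q^k"] pq(1) by simp
    finally show False by (simp add: k_def)
  qed
  then show ?thesis using pq(3) by simp
qed

lemma AI_fixed: assumes "w \<in> AI" "\<sigma> w = w" obtains n where "w = of_int n"
  using AI_Rats[OF assms(1) fixed_Rats[OF AI_K[OF assms(1)] assms(2)]] by (elim Ints_cases)

lemma sigma6: assumes "x \<in> K" shows "\<sigma> (\<sigma> (\<sigma> (\<sigma> (\<sigma> (\<sigma> x))))) = x"
proof -
  obtain u v where x: "x = u + \<alpha> * v" "u \<in> L" "v \<in> L" using assms by (auto simp: sextic_span_def)
  have "u - \<alpha> * v = u + \<alpha> * (- v)" by simp
  then show ?thesis using x sigma3_K[of u v] sigma3_K[of u "- v"] L_closed(8)[OF x(3)] by simp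
qed

text \<open>The product of X - w over the six images w of z under powers of \<sigma> is monic. Its
  coefficients lie in \<open>AI\<close> and are fixed by \<sigma>, hence are rational
  integers.\<close>

lemma AI_alg_int: assumes "z \<in> AI" shows "alg_int z"
proof -
  define P where "P zs = prod_list (map (\<lambda>w. [:- w, 1:]) zs)" for zs :: "complex list"
  have coeff_AI: "coeff (P zs) n \<in> AI" and coeff_sigma: "\<sigma> (coeff (P zs) n) = coeff (P (map \<sigma> zs)) n"
    if "set zs \<subseteq> AI" for zs n
  proof -
    have "coeff (P zs) n \<in> AI \<and> \<sigma> (coeff (P zs) n) = coeff (P (map \<sigma> zs)) n" using that
    proof (induction zs arbitrary: n)
      case Nil
      then show ?case by (cases n) (simp_all add: P_def one zero AI_closed)
    next
      case (Cons w zs)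
      have w: "w \<in> AI" "w \<in> K" using Cons.prems AI_K by auto
      have co: "coeff (P (x # xs)) n = (case n of 0 \<Rightarrow> 0 | Suc m \<Rightarrow> coeff (P xs) m) - x * coeff (P xs) n" for x xs
        by (simp add: P_def coeff_pCons split: nat.split)
      have IH: "coeff (P zs) m \<in> AI" "\<sigma> (coeff (P zs) m) = coeff (P (map \<sigma> zs)) m" "coeff (P zs) m \<in> K" for m
        using Cons AI_K by auto
      show ?case unfolding list.map co
        by (cases n) (simp_all add: IH w AI_closed K_closed diff mult minus)
    qed
    then show "coeff (P zs) n \<in> AI" "\<sigma> (coeff (P zs) n) = coeff (P (map \<sigma> zs)) n" by auto
  qed
  define zs where "zs = [z, \<sigma> z, \<sigma> (\<sigma> z), \<sigma> (\<sigma> (\<sigma> z)), \<sigma> (\<sigma> (\<sigma> (\<sigma> z))), \<sigma> (\<sigma> (\<sigma> (\<sigma> (\<sigma> z))))]"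
  have zs: "set zs \<subseteq> AI" using assms by (auto simp: zs_def intro!: sigma_AI)
  \<comment> \<open>Applying \<sigma> to the list of images only rotates it, because the sixth power
    of \<sigma> is the identity on \<open>K\<close>.\<close>
  have rotate: "prod_list (map h [r, s, t, u, v, w]) = prod_list (map h [w, r, s, t, u, v])"
    for h :: "complex \<Rightarrow> complex poly" and r s t u v w
    by (simp add: mult_ac)
  have "P (map \<sigma> zs) = P zs"
    unfolding P_def zs_def list.map(2) list.map(1)[of \<sigma>] sigma6[OF AI_K[OF assms]]
    using rotate[of "\<lambda>w. [:- w, 1:]"] by (simp only: list.map)
  then have "\<sigma> (coeff (P zs) n) = coeff (P zs) n" for n using coeff_sigma[OF zs] by simp
  then have "\<forall>n. coeff (P zs) n \<in> \<int>" using AI_Rats fixed_Rats AI_K coeff_AI[OF zs] by blast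
  moreover have "lead_coeff (P zs) = 1" by (simp add: P_def zs_def lead_coeff_mult)
  moreover have "poly (P zs) z = 0"
    unfolding P_def zs_def list.map prod_list.Cons poly_mult by simp
  ultimately show ?thesis unfolding alg_int_iff by (intro algebraic_int.intros)
qed

end

section \<open>From the integers of the cubic subfield to those of the sextic field\<close>

context cyclic_sextic
begin

lemma AI_L_conjugates:
  assumes "w = r0 + r1 * \<alpha>^2 + r2 * \<alpha>^4" "r0 \<in> \<rat>" "r1 \<in> \<rat>" "r2 \<in> \<rat>"
  shows "\<sigma> w = r0 + r1 * \<alpha>1^2 + r2 * \<alpha>1^4" "\<sigma> (\<sigma> w) = r0 + r1 * \<alpha>2^2 + r2 * \<alpha>2^4"
proof -
  show "\<sigma> w = r0 + r1 * \<alpha>1^2 + r2 * \<alpha>1^4" using assms(1) sigma_L[OF assms(2-4) alpha_K(1)] by simp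
  then show "\<sigma> (\<sigma> w) = r0 + r1 * \<alpha>2^2 + r2 * \<alpha>2^4" using sigma_L[OF assms(2-4) alpha_K(2)] by simp
qed

lemma trace_int:
  assumes "w \<in> AI" "w \<in> L" shows "\<exists>n. w + \<sigma> w + \<sigma> (\<sigma> w) = of_int n"
proof -
  have K: "w \<in> K" "\<sigma> w \<in> K" "\<sigma> (\<sigma> w) \<in> K" using assms(1) by (auto intro: AI_K into)
  have "w + \<sigma> w + \<sigma> (\<sigma> w) \<in> AI" using assms(1) by (simp add: AI_closed sigma_AI)
  moreover have "\<sigma> (w + \<sigma> w + \<sigma> (\<sigma> w)) = w + \<sigma> w + \<sigma> (\<sigma> w)"
    using K sigma3_L[OF assms(2)] by (simp add: add K_closed)
  ultimately obtain n where "w + \<sigma> w + \<sigma> (\<sigma> w) = of_int n" by (rule AI_fixed)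
  then show ?thesis ..
qed

lemma norm_int:
  assumes "w \<in> AI" "w \<in> L" shows "\<exists>n. w * \<sigma> w * \<sigma> (\<sigma> w) = of_int n"
proof -
  have K: "w \<in> K" "\<sigma> w \<in> K" "\<sigma> (\<sigma> w) \<in> K" using assms(1) by (auto intro: AI_K into)
  have "w * \<sigma> w * \<sigma> (\<sigma> w) \<in> AI" using assms(1) by (simp add: AI_closed sigma_AI)
  moreover have "\<sigma> (w * \<sigma> w * \<sigma> (\<sigma> w)) = w * \<sigma> w * \<sigma> (\<sigma> w)"
    using K sigma3_L[OF assms(2)] by (simp add: mult K_closed)
  ultimately obtain n where "w * \<sigma> w * \<sigma> (\<sigma> w) = of_int n" by (rule AI_fixed)
  then show ?thesis ..
qed

text \<open>This is the discriminant of y^3 + a y^2 + b y + c, the polynomial of \<alpha>^2.\<close>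

definition disc :: int where
  "disc = a^2 * b^2 - 4 * b^3 - 4 * a^3 * c + 18 * a * b * c - 27 * c^2"

text \<open>Cramer's rule for the system expressing the traces of \<open>w\<close>, \<open>w * \<alpha>\<^sup>2\<close>, \<open>w * \<alpha>\<^sup>4\<close> through the coordinates
  of \<open>w\<close>; the Gram determinant of the power sums is the discriminant.\<close>

lemma disc_mult_OL:
  assumes "w \<in> AI" "w \<in> L" shows "of_int disc * w \<in> OL"
proof -
  obtain r0 r1 r2 where w: "w = r0 + r1 * \<alpha>^2 + r2 * \<alpha>^4" and r: "r0 \<in> \<rat>" "r1 \<in> \<rat>" "r2 \<in> \<rat>"
    using assms(2) unfolding cubic_span_def by blast
  \<comment> \<open>These are the power sums of the conjugates of \<alpha>^2, by Newton's
    identities.\<close>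
  define p1 p2 p3 p4 where "p1 = - a" and "p2 = a^2 - 2 * b" and "p3 = 3 * a * b - 3 * c - a^3"
    and "p4 = a^4 - 4 * a^2 * b + 4 * a * c + 2 * b^2"
  define x y z where "x = \<alpha>^2" and "y = \<alpha>1^2" and "z = \<alpha>2^2"
  have e: "x + y + z = - of_int a" "x * y + x * z + y * z = of_int b" "x * y * z = - of_int c"
    using vieta by (simp_all add: x_def y_def z_def)
  have P: "x + y + z = of_int p1" "x^2 + y^2 + z^2 = of_int p2" "x^3 + y^3 + z^3 = of_int p3"
    "x^4 + y^4 + z^4 = of_int p4"
    unfolding p1_def p2_def p3_def p4_def of_int_add of_int_diff of_int_mult of_int_minus of_int_power of_int_numeral
    using e by algebra+
  have ww: "w = r0 + r1 * x + r2 * x^2" "\<sigma> w = r0 + r1 * y + r2 * y^2" "\<sigma> (\<sigma> w) = r0 + r1 * z + r2 * z^2"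
    using w AI_L_conjugates[OF w r] by (simp_all add: x_def y_def z_def flip: power_mult)
  have xL: "x \<in> AI" "x \<in> L" using alpha_AI(1) alpha_sq_cubic_span[OF int_closed_Rats] by (simp_all add: x_def AI_closed)
  have \<sigma>x: "\<sigma> x = y" "\<sigma> y = z" by (simp_all add: x_def y_def z_def sigma_beta)
  have K: "x \<in> K" "y \<in> K" "w \<in> K" "\<sigma> w \<in> K" using xL assms(1) alpha_K by (auto simp: AI_K into y_def K_closed)
  obtain t0 where t0: "w + \<sigma> w + \<sigma> (\<sigma> w) = of_int t0" using trace_int[OF assms] by blast
  have s1: "\<sigma> (w * x) = \<sigma> w * y" "\<sigma> (\<sigma> w * y) = \<sigma> (\<sigma> w) * z"
    using K by (simp_all add: mult \<sigma>x)
  obtain t1 where t1: "w * x + \<sigma> w * y + \<sigma> (\<sigma> w) * z = of_int t1"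
    using trace_int[of "w * x"] assms xL unfolding s1 by (auto simp: AI_closed L_closed)
  have s2: "\<sigma> (w * x^2) = \<sigma> w * y^2" "\<sigma> (\<sigma> w * y^2) = \<sigma> (\<sigma> w) * z^2"
    using K by (simp_all add: mult power \<sigma>x K_closed)
  obtain t2 where t2: "w * x^2 + \<sigma> w * y^2 + \<sigma> (\<sigma> w) * z^2 = of_int t2"
    using trace_int[of "w * x^2"] assms xL unfolding s2 by (auto simp: AI_closed L_closed)
  have T0: "of_int t0 = 3 * r0 + of_int p1 * r1 + of_int p2 * r2"
    unfolding t0[symmetric] P[symmetric] unfolding ww(3) unfolding ww(2) unfolding ww(1) by algebra
  have T1: "of_int t1 = of_int p1 * r0 + of_int p2 * r1 + of_int p3 * r2"
    unfolding t1[symmetric] P[symmetric] unfolding ww(3) unfolding ww(2) unfolding ww(1) by algebra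
  have T2: "of_int t2 = of_int p2 * r0 + of_int p3 * r1 + of_int p4 * r2"
    unfolding t2[symmetric] P[symmetric] unfolding ww(3) unfolding ww(2) unfolding ww(1) by algebra
  have "disc = 3 * (p2 * p4 - p3^2) - p1 * (p1 * p4 - p2 * p3) + p2 * (p1 * p3 - p2^2)"
    unfolding disc_def p1_def p2_def p3_def p4_def by algebra
  then have D: "(of_int disc :: complex) = 3 * (of_int p2 * of_int p4 - of_int p3^2) - of_int p1 * (of_int p1 * of_int p4 - of_int p2 * of_int p3)
     + of_int p2 * (of_int p1 * of_int p3 - of_int p2^2)" by simp
  have R: "of_int disc * r0 = of_int (t0 * (p2 * p4 - p3^2) - t1 * (p1 * p4 - p2 * p3) + t2 * (p1 * p3 - p2^2))"
    "of_int disc * r1 = of_int (- t0 * (p1 * p4 - p3 * p2) + t1 * (3 * p4 - p2^2) - t2 * (3 * p3 - p1 * p2))"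
    "of_int disc * r2 = of_int (t0 * (p1 * p3 - p2^2) - t1 * (3 * p3 - p1 * p2) + t2 * (3 * p2 - p1^2))"
    unfolding D of_int_add of_int_diff of_int_mult of_int_minus of_int_power of_int_numeral T0 T1 T2 by algebra+
  have "of_int disc * w = of_int disc * r0 + of_int disc * r1 * \<alpha>^2 + of_int disc * r2 * \<alpha>^4"
    unfolding w by (simp add: algebra_simps)
  also have "\<dots> \<in> OL" unfolding R by (intro cubic_span_I Ints_of_int)
  finally show ?thesis .
qed

text \<open>The translate \<alpha>^2 - r is a root of the Eisenstein polynomial y^3 + A y^2 + B y +
  C. As w has integral norm, p^3 divides the norm of p w, so p divides its coordinates in powers of
  \<alpha>^2 - r and can be cancelled.\<close>

lemma eisenstein_step:
  fixes p r :: int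
  assumes p: "prime p"
    and A: "A = a + 3 * r" and B: "B = 3 * r^2 + 2 * a * r + b" and C: "C = r^3 + a * r^2 + b * r + c"
    and dvd: "p dvd A" "p dvd B" "p dvd C" "\<not> p^2 dvd C"
    and w: "w \<in> AI" "w \<in> L" and pw: "of_int p * w \<in> OL"
  shows "w \<in> OL"
proof -
  obtain g0 g1 g2 :: int where g: "of_int p * w = of_int g0 + of_int g1 * \<alpha>^2 + of_int g2 * \<alpha>^4"
    using pw by (rule OL_obtain_int)
  \<comment> \<open>These are the coordinates of p w after substituting \<alpha>^2 = x + r.\<close>
  define h0 h1 h2 where "h0 = g0 + r * g1 + r^2 * g2" and "h1 = g1 + 2 * r * g2" and "h2 = g2"
  define x y z where "x = \<alpha>^2 - of_int r" and "y = \<alpha>1^2 - of_int r" and "z = \<alpha>2^2 - of_int r"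
  have e: "x + y + z = - of_int A" "x * y + x * z + y * z = of_int B" "x * y * z = - of_int C"
    unfolding x_def y_def z_def A B C of_int_add of_int_mult of_int_power of_int_numeral using vieta by algebra+
  have K: "w \<in> K" "\<sigma> w \<in> K" using AI_K[OF w(1)] into by auto
  have sp: "\<sigma> (of_int p * w) = of_int p * \<sigma> w" "\<sigma> (of_int p * \<sigma> w) = of_int p * \<sigma> (\<sigma> w)"
    using K by (simp_all add: mult of_int K_closed)
  note cj = AI_L_conjugates[OF g Rats_of_int Rats_of_int Rats_of_int, unfolded sp]
  have h: "of_int p * w = of_int h0 + of_int h1 * x + of_int h2 * x^2"
    "of_int p * \<sigma> w = of_int h0 + of_int h1 * y + of_int h2 * y^2"
    "of_int p * \<sigma> (\<sigma> w) = of_int h0 + of_int h1 * z + of_int h2 * z^2"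
    unfolding g cj x_def y_def z_def h0_def h1_def h2_def of_int_add of_int_mult of_int_power of_int_numeral by algebra+
  obtain n where n: "w * \<sigma> w * \<sigma> (\<sigma> w) = of_int n" using norm_int[OF w] by blast
  have norm: "(u + v * x + q * x^2) * (u + v * y + q * y^2) * (u + v * z + q * z^2) =
      u^3 - A' * u^2 * v + (A'^2 - 2 * B') * u^2 * q + B' * u * v^2 + (3 * C' - A' * B') * u * v * q
      + (B'^2 - 2 * A' * C') * u * q^2 - C' * v^3 + A' * C' * v^2 * q - B' * C' * v * q^2 + C'^2 * q^3"
    if "A' = - (x + y + z)" "B' = x * y + x * z + y * z" "C' = - (x * y * z)" for A' B' C' u v q
    unfolding that by algebra
  have "of_int p^3 * of_int n = (of_int p * w) * (of_int p * \<sigma> w) * (of_int p * \<sigma> (\<sigma> w))"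
    unfolding n[symmetric] by algebra
  also have "\<dots> = of_int (h0^3 - A * h0^2 * h1 + (A^2 - 2 * B) * h0^2 * h2 + B * h0 * h1^2 + (3 * C - A * B) * h0 * h1 * h2
      + (B^2 - 2 * A * C) * h0 * h2^2 - C * h1^3 + A * C * h1^2 * h2 - B * C * h1 * h2^2 + C^2 * h2^3)"
    unfolding h by (subst norm[of "of_int A" "of_int B" "of_int C"]) (simp_all add: e)
  finally have "(of_int (p^3 * n) :: complex) = \<dots>" by simp
  then have "h0^3 - A * h0^2 * h1 + (A^2 - 2 * B) * h0^2 * h2 + B * h0 * h1^2 + (3 * C - A * B) * h0 * h1 * h2
      + (B^2 - 2 * A * C) * h0 * h2^2 - C * h1^3 + A * C * h1^2 * h2 - B * C * h1 * h2^2 + C^2 * h2^3 = p^3 * n"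
    using of_int_eq_iff by metis
  from prime_dvd_norm_coeffs[OF p dvd this] obtain k0 k1 k2 where k: "h0 = p * k0" "h1 = p * k1" "h2 = p * k2"
    by (elim dvdE)
  have p0: "(of_int p :: complex) \<noteq> 0" using p by auto
  have "of_int p * w = of_int p * (of_int k0 + of_int k1 * x + of_int k2 * x^2)"
    unfolding h(1) k of_int_mult by algebra
  then have "w = of_int k0 + of_int k1 * x + of_int k2 * x^2" using p0 unfolding mult_cancel_left by blast
  also have "\<dots> \<in> OL" unfolding x_def using beta_OL by (simp add: OL_closed)
  finally show ?thesis .
qed

text \<open>The ring \<open>OL\<close> modulo 2 has no nonzero element of square zero. The
  \<alpha>^2 coordinate of w^2 is w2^2 (a b - c) modulo 2 with a b - c odd, so w2 is even; then the
  \<alpha>^4 and the constant coordinate give w1 and w0.\<close>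

lemma even_square_OL:
  assumes ab: "even (a * b)" and c: "odd c" and w: "w \<in> OL" and y: "y \<in> OL" "w^2 = 2 * y"
  obtains q where "q \<in> OL" "w = 2 * q"
proof -
  obtain w0 w1 w2 :: int where w012: "w = of_int w0 + of_int w1 * \<alpha>^2 + of_int w2 * \<alpha>^4"
    using w by (rule OL_obtain_int)
  obtain y0 y1 y2 :: int where y012: "y = of_int y0 + of_int y1 * \<alpha>^2 + of_int y2 * \<alpha>^4"
    using y(1) by (rule OL_obtain_int)
  have "of_int (w0^2 - 2 * w1 * w2 * c + w2^2 * a * c) + of_int (2 * w0 * w1 - 2 * b * w1 * w2 + w2^2 * (a * b - c)) * \<alpha>^2
      + of_int (2 * w0 * w2 + w1^2 - 2 * a * w1 * w2 + w2^2 * (a^2 - b)) * \<alpha>^4 = w^2"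
    unfolding w012 of_int_add of_int_diff of_int_mult of_int_power of_int_numeral using root by algebra
  also have "\<dots> = of_int (2 * y0) + of_int (2 * y1) * \<alpha>^2 + of_int (2 * y2) * \<alpha>^4"
    unfolding y(2) y012 by (simp add: algebra_simps)
  finally have eq: "w0^2 - 2 * w1 * w2 * c + w2^2 * a * c = 2 * y0" "2 * w0 * w1 - 2 * b * w1 * w2 + w2^2 * (a * b - c) = 2 * y1"
    "2 * w0 * w2 + w1^2 - 2 * a * w1 * w2 + w2^2 * (a^2 - b) = 2 * y2" by (rule OL_unique)+
  have "even (2 * w0 * w1 - 2 * b * w1 * w2 + w2^2 * (a * b - c))" unfolding eq by simp
  then have e2: "even w2" using ab c by auto
  have "even (2 * w0 * w2 + w1^2 - 2 * a * w1 * w2 + w2^2 * (a^2 - b))" unfolding eq by simp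
  then have e1: "even w1" using e2 by simp
  have "even (w0^2 - 2 * w1 * w2 * c + w2^2 * a * c)" unfolding eq by simp
  then have e0: "even w0" using e2 by simp
  obtain k0 k1 k2 where k: "w0 = 2 * k0" "w1 = 2 * k1" "w2 = 2 * k2" using e0 e1 e2 by (elim evenE)
  have "w = 2 * (of_int k0 + of_int k1 * \<alpha>^2 + of_int k2 * \<alpha>^4)" unfolding w012 k by (simp add: algebra_simps)
  moreover have "of_int k0 + of_int k1 * \<alpha>^2 + of_int k2 * \<alpha>^4 \<in> OL" by (intro cubic_span_I Ints_of_int)
  ultimately show thesis using that by blast
qed

text \<open>Write z = (u + \<alpha> v)/2. Its relative trace u and norm n lie in \<open>OL\<close>
  by hypothesis, and then v does as well. It remains to show that u and v are even, which follows
  from a congruence modulo 4 for x = \<alpha>1 \<alpha>2.\<close>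

lemma AI_subset_OK:
  assumes L: "\<And>w. w \<in> AI \<Longrightarrow> w \<in> L \<Longrightarrow> w \<in> OL"
    and c4: "c mod 4 = 1" and ab: "even (a * b)" and csq: "\<And>n. c dvd n^2 \<Longrightarrow> c dvd n"
    and z: "z \<in> AI"
  shows "z \<in> OK"
proof -
  have oddc: "odd c" using c4 by presburger
  obtain u0 v0 where z0: "z = u0 + \<alpha> * v0" "u0 \<in> L" "v0 \<in> L" using AI_K[OF z] by (auto simp: sextic_span_def)
  define u v where "u = 2 * u0" and "v = 2 * v0"
  have uvL: "u \<in> L" "v \<in> L" using z0 by (simp_all add: u_def v_def L_closed)
  have zc: "\<sigma> (\<sigma> (\<sigma> z)) = u0 - \<alpha> * v0" using sigma3_K z0 by simp
  have zcAI: "u0 - \<alpha> * v0 \<in> AI" using sigma_AI[OF sigma_AI[OF sigma_AI[OF z]]] zc by simp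
  have "u = z + (u0 - \<alpha> * v0)" by (simp add: u_def z0)
  then have uOL: "u \<in> OL" using L[OF _ uvL(1)] AI_closed(5)[OF z zcAI] by simp
  have av: "\<alpha> * v = z - (u0 - \<alpha> * v0)" by (simp add: v_def z0)
  then have avAI: "\<alpha> * v \<in> AI" using AI_closed(6)[OF z zcAI] by simp
  have bvL: "\<alpha>^2 * v \<in> L" and bvvL: "\<alpha>^2 * v^2 \<in> L"
    using uvL alpha_sq_cubic_span[OF int_closed_Rats] by (simp_all add: L_closed)
  have "\<alpha> * (\<alpha> * v) \<in> AI" "(\<alpha> * v)^2 \<in> AI" using avAI alpha_AI by (simp_all add: AI_closed)
  then have bv: "\<alpha>^2 * v \<in> OL" and bvv: "\<alpha>^2 * v^2 \<in> OL"
    using L[OF _ bvL] L[OF _ bvvL] by (simp_all add: power2_eq_square mult_ac)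
  \<comment> \<open>The square of \<alpha>^2 v is \<alpha>^2 times an element of \<open>OL\<close>,
    so c divides t0^2 and hence t0. Since c is itself a multiple of \<alpha>^2 in \<open>OL\<close>,
    the factor \<alpha>^2 can be cancelled.\<close>
  have vOL: "v \<in> OL"
  proof -
    obtain t0 t1 t2 :: int where t: "\<alpha>^2 * v = of_int t0 + of_int t1 * \<alpha>^2 + of_int t2 * \<alpha>^4"
      using bv by (rule OL_obtain_int)
    define q where "q = \<alpha>^2 * v^2 - of_int (2 * t0) * (of_int t1 + of_int t2 * \<alpha>^2) - (of_int t1 + of_int t2 * \<alpha>^2)^2 * \<alpha>^2"
    have qOL: "q \<in> OL" unfolding q_def using bvv beta_OL by (simp add: OL_closed)
    have "\<alpha>^2 * q = (\<alpha>^2 * v)^2 - 2 * of_int t0 * (of_int t1 * \<alpha>^2 + of_int t2 * \<alpha>^4) - (of_int t1 * \<alpha>^2 + of_int t2 * \<alpha>^4)^2"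
      unfolding q_def by (simp add: of_int_mult) algebra
    also have "\<dots> = of_int (t0^2) + of_int 0 * \<alpha>^2 + of_int 0 * \<alpha>^4" unfolding t by simp algebra
    finally have "c dvd t0^2" using beta_dvd_const[OF qOL] by blast
    then have "c dvd t0" by (rule csq)
    then obtain t' where t': "t0 = c * t'" by (elim dvdE)
    have "\<alpha>^2 * v = \<alpha>^2 * (- of_int t' * (\<alpha>^4 + of_int a * \<alpha>^2 + of_int b) + of_int t1 + of_int t2 * \<alpha>^2)"
      unfolding t t' of_int_mult using root by algebra
    then have "v = - of_int t' * (\<alpha>^4 + of_int a * \<alpha>^2 + of_int b) + of_int t1 + of_int t2 * \<alpha>^2"
      using alpha_nonzero unfolding mult_cancel_left by simp
    also have "\<dots> \<in> OL" using beta_OL OL_closed(9)[OF beta_OL, of 2] by (simp add: OL_closed)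
    finally show ?thesis .
  qed
  define x where "x = \<alpha>1 * \<alpha>2"
  have xOL: "x \<in> OL"
  proof (rule L)
    show "x \<in> AI" unfolding x_def using alpha_AI by (simp add: AI_closed)
    show "x \<in> L" unfolding x_def by (rule fixed3_L) (use alpha_K in \<open>simp_all add: K_closed mult minus\<close>)
  qed
  have x2: "x^2 * \<alpha>^2 = - of_int c" using vieta(3) unfolding x_def by algebra
  define n where "n = u0^2 - \<alpha>^2 * v0^2"
  have nOL: "n \<in> OL"
  proof (rule L)
    have "n = z * (u0 - \<alpha> * v0)" unfolding n_def z0(1) by algebra
    then show "n \<in> AI" using AI_closed(7)[OF z zcAI] by simp
    show "n \<in> L" unfolding n_def using z0 alpha_sq_cubic_span[OF int_closed_Rats] by (simp add: L_closed)
  qed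
  obtain m where m: "c = 4 * m + 1" using c4 by (metis mult_div_mod_eq)
  then have c': "of_int c = 4 * of_int m + (1 :: complex)" by simp
  \<comment> \<open>From u^2 = 4 n + \<alpha>^2 v^2 and x^2 \<alpha>^2 = -c = -4 m - 1, this is a
    quarter of (x u)^2 + v^2.\<close>
  define y where "y = x^2 * n - of_int m * v^2"
  have "(x * u)^2 = x^2 * (4 * n + \<alpha>^2 * v^2)" unfolding n_def u_def v_def by algebra
  also have "\<dots> = 4 * (x^2 * n) + (x^2 * \<alpha>^2) * v^2" by algebra
  finally have "(x * u)^2 = 4 * (x^2 * n) + (x^2 * \<alpha>^2) * v^2" .
  then have sq: "(x * u)^2 + v^2 = 4 * y" unfolding x2 c' y_def by algebra
  have yOL: "y \<in> OL" unfolding y_def using xOL nOL vOL OL_closed by simp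
  \<comment> \<open>First x u + v is even; substituting v = 2 q - x u into \<open>sq\<close> then
    makes (x u)^2 even, hence x u, hence v.\<close>
  have "(x * u + v)^2 = 2 * (2 * y + x * u * v)" using sq by algebra
  moreover have "2 * y + x * u * v \<in> OL" "x * u + v \<in> OL" using xOL yOL uOL vOL by (simp_all add: OL_closed)
  ultimately obtain q where q: "q \<in> OL" "x * u + v = 2 * q" using even_square_OL[OF ab oddc] by metis
  have "2 * (x * u)^2 = 2 * (2 * (y - q^2 + q * (x * u)))" using sq q(2) by algebra
  then have "(x * u)^2 = 2 * (y - q^2 + q * (x * u))" unfolding mult_cancel_left by simp
  moreover have "y - q^2 + q * (x * u) \<in> OL" "x * u \<in> OL" using xOL yOL uOL q(1) by (simp_all add: OL_closed)
  ultimately obtain q' where q': "q' \<in> OL" "x * u = 2 * q'" using even_square_OL[OF ab oddc] by metis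
  have "v = 2 * (q - q')" using q(2) q'(2) by algebra
  then have v0: "v0 = q - q'" unfolding v_def mult_cancel_left by simp
  \<comment> \<open>Multiplying x u = 2 q' by x \<alpha>^2 puts c u0 into \<open>OL\<close>; as c =
    4 m + 1 and 4 u0 = 2 u, so is u0.\<close>
  have "2 * (of_int c * u0) = 2 * (- (x * \<alpha>^2 * q'))" using x2 q'(2) unfolding u_def by algebra
  then have "of_int c * u0 = - (x * \<alpha>^2 * q')" unfolding mult_cancel_left by simp
  then have cu: "u0 = - (x * \<alpha>^2 * q') - 2 * of_int m * u" unfolding u_def c' by algebra
  have "u0 \<in> OL" unfolding cu using xOL q'(1) uOL beta_OL by (simp add: OL_closed)
  moreover have "v0 \<in> OL" unfolding v0 using q q' by (simp add: OL_closed)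
  ultimately show ?thesis unfolding z0 by (rule sextic_span_I)
qed

text \<open>By \<open>disc_mult_OL\<close> a power of p is a denominator for the integers of the
  cubic field, and \<open>eisenstein_step\<close> strips off one factor p at a time.
  \<open>AI_subset_OK\<close> then passes to the sextic field.\<close>

lemma monogenic_of_eisenstein:
  fixes p r :: int
  assumes p: "prime p" "p dvd a + 3 * r" "p dvd 3 * r^2 + 2 * a * r + b" "p dvd r^3 + a * r^2 + b * r + c"
      "\<not> p^2 dvd r^3 + a * r^2 + b * r + c" and disc: "disc = p^m"
    and c: "c mod 4 = 1" "even (a * b)" "\<And>n. c dvd n^2 \<Longrightarrow> c dvd n"
  shows "monogenic (sextic a b c)"
proof -
  have step: "w \<in> OL" if "of_int (p^j) * w \<in> OL" "w \<in> AI" "w \<in> L" for w j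
    using that
  proof (induction j arbitrary: w)
    case (Suc j)
    have mult: "of_int p * w \<in> AI" "of_int p * w \<in> L"
      by (rule AI_closed(7)[OF AI_closed(1) Suc.prems(2)], rule L_closed(7)[OF L_closed(1) Suc.prems(3)])
    have "of_int (p^j) * (of_int p * w) \<in> OL" using Suc.prems(1) by (simp add: mult_ac)
    then have "of_int p * w \<in> OL" using mult by (rule Suc.IH)
    then show ?case by (rule eisenstein_step[OF p(1) refl refl refl p(2-5) Suc.prems(2,3)])
  qed simp
  have "w \<in> OL" if "w \<in> AI" "w \<in> L" for w
    by (rule step[OF disc_mult_OL[OF that, unfolded disc] that])
  then have max: "z \<in> OK" if "z \<in> AI" for z using c that by (rule AI_subset_OK)
  have "ring_of_integers (field_gen {\<alpha>}) = OK"
    unfolding ring_of_integers_def sextic_span_rat_eq[symmetric]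
  proof (intro equalityI subsetI CollectI conjI)
    fix z assume "z \<in> {z \<in> K. alg_int z}"
    then show "z \<in> OK" by (intro max alg_int_AI) simp_all
  next
    fix z assume "z \<in> OK"
    then show "z \<in> K" "alg_int z" by (rule OK_subset_K, intro AI_alg_int OK_AI)
  qed
  then have "Z_adjoin \<alpha> = ring_of_integers (field_gen {\<alpha>})" using sextic_span_int_eq by simp
  moreover have "poly (map_poly of_int (sextic a b c)) \<alpha> = 0" unfolding poly_of_int_sextic by (rule root)
  moreover have "lead_coeff (sextic a b c) = 1" by simp
  ultimately show ?thesis unfolding monogenic_def using irr by (intro conjI exI[of _ \<alpha>])
qed

end

section \<open>The two directions of the equivalence\<close>

theorem theorem1p1:
  fixes a b c :: int
  assumes "irreducible (map_poly (of_int :: int \<Rightarrow> rat) [:c, 0, b, 0, a, 0, 1:])"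
    and "Gal_cyclic_of_order [:c, 0, b, 0, a, 0, 1:] 6"
  shows "monogenic [:c, 0, b, 0, a, 0, 1:] \<longleftrightarrow>
    (a, b, c) \<in> {(-7, 14, -7), (-6, 9, -3), (5, 6, 1), (6, 5, 1), (6, 9, 1), (9, 6, 1)}"
proof
  assume "monogenic [:c, 0, b, 0, a, 0, 1:]"
  then obtain \<alpha> where \<alpha>: "poly (map_poly of_int (sextic a b c)) \<alpha> = (0::complex)"
    and ring: "Z_adjoin \<alpha> = ring_of_integers (field_gen {\<alpha>})"
    unfolding monogenic_def by (elim conjE exE)
  interpret sextic_root a b c \<alpha>
    using assms(1) \<alpha> unfolding poly_of_int_sextic by unfold_locales
  obtain \<sigma> where "cyclic_sextic a b c \<alpha> \<sigma>" using cyclic_sextic_exists[OF assms(2)] .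
  then interpret cyclic_sextic a b c \<alpha> \<sigma> .
  interpret monogenic_cyclic_sextic a b c \<alpha> \<sigma>
    by unfold_locales (simp_all add: sextic_span_int_eq sextic_span_rat_eq ring ring_of_integers_def)
  show "(a, b, c) \<in> {(-7, 14, -7), (-6, 9, -3), (5, 6, 1), (6, 5, 1), (6, 9, 1), (9, 6, 1)}"
    by (rule coefficients_of_monogenic)
next
  assume abc: "(a, b, c) \<in> {(-7, 14, -7), (-6, 9, -3), (5, 6, 1), (6, 5, 1), (6, 9, 1), (9, 6, 1)}"
  have "\<not> constant (poly (map_poly of_int (sextic a b c) :: complex poly))"
    by (subst constant_degree) (simp add: map_poly_pCons)
  then obtain \<alpha> where \<alpha>: "poly (map_poly of_int (sextic a b c)) \<alpha> = (0::complex)"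
    using fundamental_theorem_of_algebra by blast
  interpret sextic_root a b c \<alpha>
    using assms(1) \<alpha> unfolding poly_of_int_sextic by unfold_locales
  obtain \<sigma> where "cyclic_sextic a b c \<alpha> \<sigma>" using cyclic_sextic_exists[OF assms(2)] .
  then interpret cyclic_sextic a b c \<alpha> \<sigma> .
  have prime: "prime (7 :: int)" "prime (3 :: int)" by (simp_all add: prime_int_numeral_eq)
  \<comment> \<open>In the list c is 1 or the negative of a prime, 3 or 7.\<close>
  have square: "c dvd n^2 \<Longrightarrow> c dvd n" for n
    using abc prime_dvd_power[OF prime(1), of n 2] prime_dvd_power[OF prime(2), of n 2] by auto
  have disc7: "disc = 7^2" if "(a, b, c) \<in> {(-7, 14, -7), (5, 6, 1), (6, 5, 1)}"
    using that by (auto simp: disc_def)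
  have disc3: "disc = 3^4" if "(a, b, c) \<in> {(-6, 9, -3), (6, 9, 1), (9, 6, 1)}"
    using that by (auto simp: disc_def)
  have c: "c mod 4 = 1" "even (a * b)" using abc by auto
  note mono7 = monogenic_of_eisenstein[OF prime(1) _ _ _ _ disc7 c square]
  note mono3 = monogenic_of_eisenstein[OF prime(2) _ _ _ _ disc3 c square]
  from abc consider "(a, b, c) = (-7, 14, -7)" | "(a, b, c) = (-6, 9, -3)" | "(a, b, c) = (5, 6, 1)"
    | "(a, b, c) = (6, 5, 1)" | "(a, b, c) = (6, 9, 1)" | "(a, b, c) = (9, 6, 1)" by blast
  then show "monogenic [:c, 0, b, 0, a, 0, 1:]"
  proof cases
    \<comment> \<open>The argument r is the triple root of y^3 + a y^2 + b y + c modulo p, so that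
      translating by r gives an Eisenstein polynomial.\<close>
    case 1 then show ?thesis by (intro mono7[of 0]) auto
  next
    case 2 then show ?thesis by (intro mono3[of 0]) auto
  next
    case 3 then show ?thesis by (intro mono7[of 3]) auto
  next
    case 4 then show ?thesis by (intro mono7[of "-2"]) auto
  next
    case 5 then show ?thesis by (intro mono3[of "-1"]) auto
  next
    case 6 then show ?thesis by (intro mono3[of "-1"]) auto
  qed
qed

end
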